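(* Let $A$ be an associative algebra (not necessarily with unit) over a field $\mathbb{K}$. Then the category of locally finite left $A$-modules and the category of right $A^0$-comodules are isomorphic. In the case where $A$ is unital, this isomorphism of categories restricts to an isomorphism between the category of locally finite unital left $A$-modules and the category of counital right $A^0$-comodules.
   Context: Left $A$-modules are not required to satisfy any unital condition (even if $A$ has a unit). A module is locally finite if the submodule generated by any element is finite dimensional; the category of locally finite left $A$-modules is the full subcategory of the category of left $A$-modules on these objects. The finite dual $A^0$ is the set of all $f\in A^*$ such that $\ker f$ contains a two-sided ideal of $A$ of finite codimension. It is a coassociative (not necessarily counital) coalgebra with comultiplication $f\mapsto\sum_j g_j\otimes h_j$, where $g_j,h_j\in A^0$ satisfy $f(ab)=\sum_j g_j(a)h_j(b)$ for all $a,b\in A$. If $A$ has identity $1_A$, $A^0$ has counit $f\mapsto f(1_A)$. A right comodule over a (not necessarily counital) coalgebra $(C,\delta)$ is a vector space $M$ with a linear map $\rho:M\to M\otimes C$ such that $(\rho\otimes I)\rho=(I\otimes\delta)\rho$, with no counit condition; it is counital if $C$ has a counit $\epsilon$ and $(I\otimes \epsilon)\rho=\mathrm{id}$ (with $M\otimes\mathbb{K}=M$). The isomorphism in question sends a right $A^0$-comodule $M$ with coaction $m\mapsto \sum m_0\otimes m_1$ to the left $A$-module $M$ with action $am=\sum m_1(a)m_0$, and is the identity on underlying linear maps. *)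

theory Defs
  imports
    "Jordan_Normal_Form.Missing_VectorSpace"
    "HOL-Algebra.AbelCoset"
begin

section \<open>Categories\<close>

text \<open>
  Categories are presented by a set of objects and a family of hom-sets, which need not be disjoint;
  accordingly composition and the arrow part of a functor take the objects involved as arguments.
  \<open>Comp C X Y Z g f\<close> is the composite of \<open>f : X \<rightarrow> Y\<close> and \<open>g : Y \<rightarrow> Z\<close>.
\<close>

record ('o, 'f) cat =
  Obj :: "'o set"
  Hom :: "'o \<Rightarrow> 'o \<Rightarrow> 'f set"
  Ident :: "'o \<Rightarrow> 'f"
  Comp :: "'o \<Rightarrow> 'o \<Rightarrow> 'o \<Rightarrow> 'f \<Rightarrow> 'f \<Rightarrow> 'f"

definition is_category :: "('o, 'f) cat \<Rightarrow> bool" where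
  "is_category C \<longleftrightarrow>
     (\<forall>X\<in>Obj C. Ident C X \<in> Hom C X X) \<and>
     (\<forall>X\<in>Obj C. \<forall>Y\<in>Obj C. \<forall>Z\<in>Obj C. \<forall>f\<in>Hom C X Y. \<forall>g\<in>Hom C Y Z.
        Comp C X Y Z g f \<in> Hom C X Z) \<and>
     (\<forall>X\<in>Obj C. \<forall>Y\<in>Obj C. \<forall>f\<in>Hom C X Y.
        Comp C X X Y f (Ident C X) = f \<and> Comp C X Y Y (Ident C Y) f = f) \<and>
     (\<forall>W\<in>Obj C. \<forall>X\<in>Obj C. \<forall>Y\<in>Obj C. \<forall>Z\<in>Obj C.
        \<forall>f\<in>Hom C W X. \<forall>g\<in>Hom C X Y. \<forall>h\<in>Hom C Y Z.
          Comp C W Y Z h (Comp C W X Y g f) = Comp C W X Z (Comp C X Y Z h g) f)"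

definition is_functor ::
  "('o, 'f) cat \<Rightarrow> ('p, 'g) cat \<Rightarrow> ('o \<Rightarrow> 'p) \<Rightarrow> ('o \<Rightarrow> 'o \<Rightarrow> 'f \<Rightarrow> 'g) \<Rightarrow> bool" where
  "is_functor C D Fo Fa \<longleftrightarrow>
     is_category C \<and> is_category D \<and>
     (\<forall>X\<in>Obj C. Fo X \<in> Obj D) \<and>
     (\<forall>X\<in>Obj C. \<forall>Y\<in>Obj C. \<forall>f\<in>Hom C X Y. Fa X Y f \<in> Hom D (Fo X) (Fo Y)) \<and>
     (\<forall>X\<in>Obj C. Fa X X (Ident C X) = Ident D (Fo X)) \<and>
     (\<forall>X\<in>Obj C. \<forall>Y\<in>Obj C. \<forall>Z\<in>Obj C. \<forall>f\<in>Hom C X Y. \<forall>g\<in>Hom C Y Z.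
        Fa X Z (Comp C X Y Z g f) = Comp D (Fo X) (Fo Y) (Fo Z) (Fa Y Z g) (Fa X Y f))"

definition is_category_iso ::
  "('o, 'f) cat \<Rightarrow> ('p, 'g) cat \<Rightarrow> ('o \<Rightarrow> 'p) \<Rightarrow> ('o \<Rightarrow> 'o \<Rightarrow> 'f \<Rightarrow> 'g) \<Rightarrow> bool" where
  "is_category_iso C D Fo Fa \<longleftrightarrow>
     is_functor C D Fo Fa \<and>
     (\<exists>Go Ga. is_functor D C Go Ga \<and>
        (\<forall>X\<in>Obj C. Go (Fo X) = X) \<and>
        (\<forall>X\<in>Obj C. \<forall>Y\<in>Obj C. \<forall>f\<in>Hom C X Y. Ga (Fo X) (Fo Y) (Fa X Y f) = f) \<and>
        (\<forall>X\<in>Obj D. Fo (Go X) = X) \<and>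
        (\<forall>X\<in>Obj D. \<forall>Y\<in>Obj D. \<forall>g\<in>Hom D X Y. Fa (Go X) (Go Y) (Ga X Y g) = g))"

definition full_subcat :: "('o, 'f) cat \<Rightarrow> ('o \<Rightarrow> bool) \<Rightarrow> ('o, 'f) cat" where
  "full_subcat C P = C\<lparr>Obj := {X \<in> Obj C. P X}\<rparr>"


section \<open>Linear algebra\<close>

text \<open>
  A vector space is a \<^typ>\<open>('k, 'm) module\<close> record satisfying \<^locale>\<open>vectorspace\<close>; its
  \<open>mult\<close> and \<open>one\<close> fields carry no meaning. Linear maps, coactions and actions are taken to be
  \<open>undefined\<close> off their domains, so that equality of functions is equality of maps. Carriers of
  (co)modules are arbitrary subsets of a type \<open>'m\<close>, which plays the role of a universe.
\<close>

definition lin_maps ::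
  "('k, 'r) ring_scheme \<Rightarrow> ('k, 'm, 'x) module_scheme \<Rightarrow> ('k, 'n, 'y) module_scheme \<Rightarrow> ('m \<Rightarrow> 'n) set"
  where "lin_maps K M N = module_hom K M N \<inter> extensional (carrier M)"

definition id_map :: "('k, 'm, 'x) module_scheme \<Rightarrow> 'm \<Rightarrow> 'm" where
  "id_map M = (\<lambda>x\<in>carrier M. x)"

definition quot_space ::
  "('k, 'm, 'x) module_scheme \<Rightarrow> 'm set \<Rightarrow> ('k, 'm set) module" where
  "quot_space V W =
     \<lparr>carrier = A_RCOSETS V W, mult = undefined, one = undefined,
      zero = W, add = set_add V,
      smult = (\<lambda>c X. \<Union>x\<in>X. a_r_coset V W (c \<odot>\<^bsub>V\<^esub> x))\<rparr>"

definition scalar_space :: "('k, 'r) ring_scheme \<Rightarrow> ('k, 'k) module" where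
  "scalar_space K =
     \<lparr>carrier = carrier K, mult = mult K, one = one K, zero = zero K, add = add K, smult = mult K\<rparr>"

definition free_space :: "('k, 'r) ring_scheme \<Rightarrow> 's set \<Rightarrow> ('k, 's \<Rightarrow> 'k) module" where
  "free_space K S =
     (ring.func_space K S)
       \<lparr>carrier := {u \<in> S \<rightarrow>\<^sub>E carrier K. finite {s \<in> S. u s \<noteq> \<zero>\<^bsub>K\<^esub>}}\<rparr>"

definition free_gen :: "('k, 'r) ring_scheme \<Rightarrow> 's set \<Rightarrow> 's \<Rightarrow> 's \<Rightarrow> 'k" where
  "free_gen K S s = (\<lambda>t\<in>S. if t = s then \<one>\<^bsub>K\<^esub> else \<zero>\<^bsub>K\<^esub>)"


section \<open>Tensor products\<close>

text \<open>
  The tensor product is the quotient of the free vector space on \<open>M \<times> N\<close> by the subspace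
  spanned by the bilinearity relations.
\<close>

definition tensor_rels ::
  "('k, 'r) ring_scheme \<Rightarrow> ('k, 'm, 'x) module_scheme \<Rightarrow> ('k, 'n, 'y) module_scheme
     \<Rightarrow> ('m \<times> 'n \<Rightarrow> 'k) set" where
  "tensor_rels K M N =
     (let F = free_space K (carrier M \<times> carrier N);
          d = (\<lambda>x y. free_gen K (carrier M \<times> carrier N) (x, y))
      in {d (x \<oplus>\<^bsub>M\<^esub> x') y \<ominus>\<^bsub>F\<^esub> (d x y \<oplus>\<^bsub>F\<^esub> d x' y) | x x' y.
            x \<in> carrier M \<and> x' \<in> carrier M \<and> y \<in> carrier N}
       \<union> {d x (y \<oplus>\<^bsub>N\<^esub> y') \<ominus>\<^bsub>F\<^esub> (d x y \<oplus>\<^bsub>F\<^esub> d x y') | x y y'.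
            x \<in> carrier M \<and> y \<in> carrier N \<and> y' \<in> carrier N}
       \<union> {d (c \<odot>\<^bsub>M\<^esub> x) y \<ominus>\<^bsub>F\<^esub> (c \<odot>\<^bsub>F\<^esub> d x y) | c x y.
            c \<in> carrier K \<and> x \<in> carrier M \<and> y \<in> carrier N}
       \<union> {d x (c \<odot>\<^bsub>N\<^esub> y) \<ominus>\<^bsub>F\<^esub> (c \<odot>\<^bsub>F\<^esub> d x y) | c x y.
            c \<in> carrier K \<and> x \<in> carrier M \<and> y \<in> carrier N})"

definition tensor_null ::
  "('k, 'r) ring_scheme \<Rightarrow> ('k, 'm, 'x) module_scheme \<Rightarrow> ('k, 'n, 'y) module_scheme
     \<Rightarrow> ('m \<times> 'n \<Rightarrow> 'k) set" where
  "tensor_null K M N =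
     module.span K (free_space K (carrier M \<times> carrier N)) (tensor_rels K M N)"

definition tensor_space ::
  "('k, 'r) ring_scheme \<Rightarrow> ('k, 'm, 'x) module_scheme \<Rightarrow> ('k, 'n, 'y) module_scheme
     \<Rightarrow> ('k, ('m \<times> 'n \<Rightarrow> 'k) set) module" where
  "tensor_space K M N =
     quot_space (free_space K (carrier M \<times> carrier N)) (tensor_null K M N)"

definition pure_tensor ::
  "('k, 'r) ring_scheme \<Rightarrow> ('k, 'm, 'x) module_scheme \<Rightarrow> ('k, 'n, 'y) module_scheme
     \<Rightarrow> 'm \<Rightarrow> 'n \<Rightarrow> ('m \<times> 'n \<Rightarrow> 'k) set" where
  "pure_tensor K M N x y =
     a_r_coset (free_space K (carrier M \<times> carrier N)) (tensor_null K M N)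
       (free_gen K (carrier M \<times> carrier N) (x, y))"

text \<open>
  The linear map \<open>M \<otimes> N \<rightarrow> P\<close> induced, through the universal property, by a bilinear map
  \<open>b : M \<times> N \<rightarrow> P\<close>.
\<close>

definition tensor_lift ::
  "('k, 'r) ring_scheme \<Rightarrow> ('k, 'm, 'x) module_scheme \<Rightarrow> ('k, 'n, 'y) module_scheme
     \<Rightarrow> ('k, 'p, 'z) module_scheme \<Rightarrow> ('m \<Rightarrow> 'n \<Rightarrow> 'p) \<Rightarrow> ('m \<times> 'n \<Rightarrow> 'k) set \<Rightarrow> 'p" where
  "tensor_lift K M N P b =
     (THE h. h \<in> lin_maps K (tensor_space K M N) P \<and>
             (\<forall>x\<in>carrier M. \<forall>y\<in>carrier N. h (pure_tensor K M N x y) = b x y))"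

text \<open>\<open>f \<otimes> g : M \<otimes> N \<rightarrow> M' \<otimes> N'\<close>\<close>

definition tensor_map ::
  "('k, 'r) ring_scheme \<Rightarrow> ('k, 'm, 'x) module_scheme \<Rightarrow> ('k, 'n, 'y) module_scheme
     \<Rightarrow> ('k, 'm2, 'x2) module_scheme \<Rightarrow> ('k, 'n2, 'y2) module_scheme
     \<Rightarrow> ('m \<Rightarrow> 'm2) \<Rightarrow> ('n \<Rightarrow> 'n2) \<Rightarrow> ('m \<times> 'n \<Rightarrow> 'k) set \<Rightarrow> ('m2 \<times> 'n2 \<Rightarrow> 'k) set" where
  "tensor_map K M N M' N' f g =
     tensor_lift K M N (tensor_space K M' N') (\<lambda>x y. pure_tensor K M' N' (f x) (g y))"

text \<open>\<open>(M \<otimes> N) \<otimes> P \<rightarrow> M \<otimes> (N \<otimes> P)\<close>, \<open>(x \<otimes> y) \<otimes> z \<mapsto> x \<otimes> (y \<otimes> z)\<close>\<close>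

definition tensor_assoc ::
  "('k, 'r) ring_scheme \<Rightarrow> ('k, 'm, 'x) module_scheme \<Rightarrow> ('k, 'n, 'y) module_scheme
     \<Rightarrow> ('k, 'p, 'z) module_scheme
     \<Rightarrow> (('m \<times> 'n \<Rightarrow> 'k) set \<times> 'p \<Rightarrow> 'k) set \<Rightarrow> ('m \<times> ('n \<times> 'p \<Rightarrow> 'k) set \<Rightarrow> 'k) set" where
  "tensor_assoc K M N P =
     (let T = tensor_space K M (tensor_space K N P)
      in tensor_lift K (tensor_space K M N) P T
           (\<lambda>t z. tensor_lift K M N T
              (\<lambda>x y. pure_tensor K M (tensor_space K N P) x (pure_tensor K N P y z)) t))"

text \<open>\<open>M \<otimes> K \<rightarrow> M\<close>, \<open>x \<otimes> c \<mapsto> c x\<close>\<close>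

definition tensor_unit ::
  "('k, 'r) ring_scheme \<Rightarrow> ('k, 'm, 'x) module_scheme \<Rightarrow> ('m \<times> 'k \<Rightarrow> 'k) set \<Rightarrow> 'm" where
  "tensor_unit K M = tensor_lift K M (scalar_space K) M (\<lambda>x c. c \<odot>\<^bsub>M\<^esub> x)"


section \<open>Algebras and their modules\<close>

text \<open>The field \<open>one\<close> of the record \<open>A\<close> is irrelevant: no unit is required.\<close>

locale nonunital_algebra = vectorspace K A for K and A +
  assumes alg_mult_closed:
      "\<lbrakk>a \<in> carrier A; b \<in> carrier A\<rbrakk> \<Longrightarrow> a \<otimes>\<^bsub>A\<^esub> b \<in> carrier A"
    and alg_mult_assoc:
      "\<lbrakk>a \<in> carrier A; b \<in> carrier A; c \<in> carrier A\<rbrakk>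
        \<Longrightarrow> (a \<otimes>\<^bsub>A\<^esub> b) \<otimes>\<^bsub>A\<^esub> c = a \<otimes>\<^bsub>A\<^esub> (b \<otimes>\<^bsub>A\<^esub> c)"
    and alg_distrib_right:
      "\<lbrakk>a \<in> carrier A; b \<in> carrier A; c \<in> carrier A\<rbrakk>
        \<Longrightarrow> (a \<oplus>\<^bsub>A\<^esub> b) \<otimes>\<^bsub>A\<^esub> c = a \<otimes>\<^bsub>A\<^esub> c \<oplus>\<^bsub>A\<^esub> b \<otimes>\<^bsub>A\<^esub> c"
    and alg_distrib_left:
      "\<lbrakk>a \<in> carrier A; b \<in> carrier A; c \<in> carrier A\<rbrakk>
        \<Longrightarrow> a \<otimes>\<^bsub>A\<^esub> (b \<oplus>\<^bsub>A\<^esub> c) = a \<otimes>\<^bsub>A\<^esub> b \<oplus>\<^bsub>A\<^esub> a \<otimes>\<^bsub>A\<^esub> c"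
    and alg_smult_left:
      "\<lbrakk>r \<in> carrier K; a \<in> carrier A; b \<in> carrier A\<rbrakk>
        \<Longrightarrow> (r \<odot>\<^bsub>A\<^esub> a) \<otimes>\<^bsub>A\<^esub> b = r \<odot>\<^bsub>A\<^esub> (a \<otimes>\<^bsub>A\<^esub> b)"
    and alg_smult_right:
      "\<lbrakk>r \<in> carrier K; a \<in> carrier A; b \<in> carrier A\<rbrakk>
        \<Longrightarrow> a \<otimes>\<^bsub>A\<^esub> (r \<odot>\<^bsub>A\<^esub> b) = r \<odot>\<^bsub>A\<^esub> (a \<otimes>\<^bsub>A\<^esub> b)"

definition is_identity :: "('k, 'a, 'x) module_scheme \<Rightarrow> 'a \<Rightarrow> bool" where
  "is_identity A e \<longleftrightarrow>
     e \<in> carrier A \<and> (\<forall>a\<in>carrier A. e \<otimes>\<^bsub>A\<^esub> a = a \<and> a \<otimes>\<^bsub>A\<^esub> e = a)"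

type_synonym ('k, 'a, 'm) mod_struct = "('k, 'm) module \<times> ('a \<Rightarrow> 'm \<Rightarrow> 'm)"

definition left_module ::
  "('k, 'r) ring_scheme \<Rightarrow> ('k, 'a, 'x) module_scheme \<Rightarrow> ('k, 'a, 'm) mod_struct \<Rightarrow> bool" where
  "left_module K A = (\<lambda>(M, act).
     vectorspace K M \<and>
     act \<in> extensional (carrier A) \<and>
     (\<forall>a\<in>carrier A. act a \<in> lin_maps K M M) \<and>
     (\<forall>a\<in>carrier A. \<forall>b\<in>carrier A. \<forall>m\<in>carrier M.
        act (a \<oplus>\<^bsub>A\<^esub> b) m = act a m \<oplus>\<^bsub>M\<^esub> act b m) \<and>
     (\<forall>c\<in>carrier K. \<forall>a\<in>carrier A. \<forall>m\<in>carrier M.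
        act (c \<odot>\<^bsub>A\<^esub> a) m = c \<odot>\<^bsub>M\<^esub> act a m) \<and>
     (\<forall>a\<in>carrier A. \<forall>b\<in>carrier A. \<forall>m\<in>carrier M.
        act (a \<otimes>\<^bsub>A\<^esub> b) m = act a (act b m)))"

definition module_maps ::
  "('k, 'r) ring_scheme \<Rightarrow> ('k, 'a, 'x) module_scheme
     \<Rightarrow> ('k, 'a, 'm) mod_struct \<Rightarrow> ('k, 'a, 'm) mod_struct \<Rightarrow> ('m \<Rightarrow> 'm) set" where
  "module_maps K A = (\<lambda>(M, actM) (N, actN).
     {f \<in> lin_maps K M N. \<forall>a\<in>carrier A. \<forall>m\<in>carrier M. f (actM a m) = actN a (f m)})"

definition left_module_cat ::
  "('k, 'r) ring_scheme \<Rightarrow> ('k, 'a, 'x) module_scheme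
     \<Rightarrow> (('k, 'a, 'm) mod_struct, 'm \<Rightarrow> 'm) cat" where
  "left_module_cat K A =
     \<lparr>Obj = {X. left_module K A X}, Hom = module_maps K A,
      Ident = (\<lambda>X. id_map (fst X)),
      Comp = (\<lambda>X Y Z g f. compose (carrier (fst X)) g f)\<rparr>"

definition is_act_submodule ::
  "('k, 'r) ring_scheme \<Rightarrow> ('k, 'a, 'x) module_scheme
     \<Rightarrow> ('k, 'a, 'm) mod_struct \<Rightarrow> 'm set \<Rightarrow> bool" where
  "is_act_submodule K A = (\<lambda>(M, act) N.
     subspace K N M \<and> (\<forall>a\<in>carrier A. \<forall>n\<in>N. act a n \<in> N))"

definition generated_submodule ::
  "('k, 'r) ring_scheme \<Rightarrow> ('k, 'a, 'x) module_scheme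
     \<Rightarrow> ('k, 'a, 'm) mod_struct \<Rightarrow> 'm \<Rightarrow> 'm set" where
  "generated_submodule K A X m = \<Inter>{N. is_act_submodule K A X N \<and> m \<in> N}"

definition locally_finite ::
  "('k, 'r) ring_scheme \<Rightarrow> ('k, 'a, 'x) module_scheme \<Rightarrow> ('k, 'a, 'm) mod_struct \<Rightarrow> bool" where
  "locally_finite K A X \<longleftrightarrow>
     (\<forall>m\<in>carrier (fst X).
        vectorspace.fin_dim K ((fst X)\<lparr>carrier := generated_submodule K A X m\<rparr>))"

definition locally_finite_module_cat ::
  "('k, 'r) ring_scheme \<Rightarrow> ('k, 'a, 'x) module_scheme
     \<Rightarrow> (('k, 'a, 'm) mod_struct, 'm \<Rightarrow> 'm) cat" where
  "locally_finite_module_cat K A = full_subcat (left_module_cat K A) (locally_finite K A)"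

definition unital_module :: "'a \<Rightarrow> ('k, 'a, 'm) mod_struct \<Rightarrow> bool" where
  "unital_module e = (\<lambda>(M, act). \<forall>m\<in>carrier M. act e m = m)"


section \<open>Comodules\<close>

text \<open>A coalgebra is given by its underlying space \<open>C\<close> and its comultiplication \<open>\<delta>\<close>.\<close>

type_synonym ('k, 'c, 'm) comod_struct = "('k, 'm) module \<times> ('m \<Rightarrow> ('m \<times> 'c \<Rightarrow> 'k) set)"

definition right_comodule ::
  "('k, 'r) ring_scheme \<Rightarrow> ('k, 'c, 'x) module_scheme \<Rightarrow> ('c \<Rightarrow> ('c \<times> 'c \<Rightarrow> 'k) set)
     \<Rightarrow> ('k, 'c, 'm) comod_struct \<Rightarrow> bool" where
  "right_comodule K C \<delta> = (\<lambda>(M, \<rho>).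
     vectorspace K M \<and>
     \<rho> \<in> lin_maps K M (tensor_space K M C) \<and>
     (\<forall>m\<in>carrier M.
        tensor_assoc K M C C
          (tensor_map K M C (tensor_space K M C) C \<rho> (id_map C) (\<rho> m))
        = tensor_map K M C M (tensor_space K C C) (id_map M) \<delta> (\<rho> m)))"

definition comodule_maps ::
  "('k, 'r) ring_scheme \<Rightarrow> ('k, 'c, 'x) module_scheme
     \<Rightarrow> ('k, 'c, 'm) comod_struct \<Rightarrow> ('k, 'c, 'm) comod_struct \<Rightarrow> ('m \<Rightarrow> 'm) set" where
  "comodule_maps K C = (\<lambda>(M, \<rho>M) (N, \<rho>N).
     {f \<in> lin_maps K M N.
        \<forall>m\<in>carrier M. \<rho>N (f m) = tensor_map K M C N C f (id_map C) (\<rho>M m)})"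

definition right_comodule_cat ::
  "('k, 'r) ring_scheme \<Rightarrow> ('k, 'c, 'x) module_scheme \<Rightarrow> ('c \<Rightarrow> ('c \<times> 'c \<Rightarrow> 'k) set)
     \<Rightarrow> (('k, 'c, 'm) comod_struct, 'm \<Rightarrow> 'm) cat" where
  "right_comodule_cat K C \<delta> =
     \<lparr>Obj = {X. right_comodule K C \<delta> X}, Hom = comodule_maps K C,
      Ident = (\<lambda>X. id_map (fst X)),
      Comp = (\<lambda>X Y Z g f. compose (carrier (fst X)) g f)\<rparr>"

definition counital_comodule ::
  "('k, 'r) ring_scheme \<Rightarrow> ('k, 'c, 'x) module_scheme \<Rightarrow> ('c \<Rightarrow> 'k)
     \<Rightarrow> ('k, 'c, 'm) comod_struct \<Rightarrow> bool" where
  "counital_comodule K C \<epsilon> = (\<lambda>(M, \<rho>).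
     \<forall>m\<in>carrier M.
       tensor_unit K M (tensor_map K M C M (scalar_space K) (id_map M) \<epsilon> (\<rho> m)) = m)"


section \<open>The finite dual\<close>

definition two_sided_ideal ::
  "('k, 'r) ring_scheme \<Rightarrow> ('k, 'a, 'x) module_scheme \<Rightarrow> 'a set \<Rightarrow> bool" where
  "two_sided_ideal K A I \<longleftrightarrow>
     subspace K I A \<and>
     (\<forall>a\<in>carrier A. \<forall>x\<in>I. a \<otimes>\<^bsub>A\<^esub> x \<in> I \<and> x \<otimes>\<^bsub>A\<^esub> a \<in> I)"

definition finite_codim ::
  "('k, 'r) ring_scheme \<Rightarrow> ('k, 'a, 'x) module_scheme \<Rightarrow> 'a set \<Rightarrow> bool" where
  "finite_codim K A I \<longleftrightarrow> vectorspace.fin_dim K (quot_space A I)"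

definition finite_dual ::
  "('k, 'r) ring_scheme \<Rightarrow> ('k, 'a, 'x) module_scheme \<Rightarrow> ('k, 'a \<Rightarrow> 'k) module" where
  "finite_dual K A =
     (ring.func_space K (carrier A))
       \<lparr>carrier := {f \<in> lin_maps K A (scalar_space K).
          \<exists>I. two_sided_ideal K A I \<and> finite_codim K A I \<and>
              I \<subseteq> {a \<in> carrier A. f a = \<zero>\<^bsub>K\<^esub>}}\<rparr>"

text \<open>
  The tensor \<open>\<Sum> g\<^sub>j \<otimes> h\<^sub>j\<close> does not depend on the choice of \<open>g\<^sub>j, h\<^sub>j\<close>, because
  \<open>A\<^sup>0 \<otimes> A\<^sup>0\<close> embeds into the bilinear forms on \<open>A\<close>.
\<close>

definition dual_comult ::
  "('k, 'r) ring_scheme \<Rightarrow> ('k, 'a, 'x) module_scheme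
     \<Rightarrow> ('a \<Rightarrow> 'k) \<Rightarrow> (('a \<Rightarrow> 'k) \<times> ('a \<Rightarrow> 'k) \<Rightarrow> 'k) set" where
  "dual_comult K A =
     (let D = finite_dual K A in
      (\<lambda>f\<in>carrier D. THE t. \<exists>n::nat. \<exists>g h.
        (\<forall>j<n. g j \<in> carrier D \<and> h j \<in> carrier D) \<and>
        (\<forall>a\<in>carrier A. \<forall>b\<in>carrier A.
           f (a \<otimes>\<^bsub>A\<^esub> b) = (\<Oplus>\<^bsub>K\<^esub>j\<in>{..<n}. g j a \<otimes>\<^bsub>K\<^esub> h j b)) \<and>
        t = (\<Oplus>\<^bsub>tensor_space K D D\<^esub>j\<in>{..<n}. pure_tensor K D D (g j) (h j))))"

definition dual_counit ::
  "('k, 'r) ring_scheme \<Rightarrow> ('k, 'a, 'x) module_scheme \<Rightarrow> 'a \<Rightarrow> ('a \<Rightarrow> 'k) \<Rightarrow> 'k" where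
  "dual_counit K A e = (\<lambda>f\<in>carrier (finite_dual K A). f e)"

definition dual_comodule_cat ::
  "('k, 'r) ring_scheme \<Rightarrow> ('k, 'a, 'x) module_scheme
     \<Rightarrow> (('k, 'a \<Rightarrow> 'k, 'm) comod_struct, 'm \<Rightarrow> 'm) cat" where
  "dual_comodule_cat K A = right_comodule_cat K (finite_dual K A) (dual_comult K A)"

text \<open>
  The action \<open>a m = \<Sum> m\<^sub>1(a) m\<^sub>0\<close> determined by a coaction
  \<open>\<rho> m = \<Sum> m\<^sub>0 \<otimes> m\<^sub>1\<close>.
\<close>

definition comodule_to_module ::
  "('k, 'r) ring_scheme \<Rightarrow> ('k, 'a, 'x) module_scheme
     \<Rightarrow> ('k, 'a \<Rightarrow> 'k, 'm) comod_struct \<Rightarrow> ('k, 'a, 'm) mod_struct" where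
  "comodule_to_module K A = (\<lambda>(M, \<rho>).
     (M, \<lambda>a\<in>carrier A. \<lambda>m\<in>carrier M.
           tensor_lift K M (finite_dual K A) M (\<lambda>m0 m1. m1 a \<odot>\<^bsub>M\<^esub> m0) (\<rho> m)))"

end

theory Submission
  imports Defs
begin

text \<open>
  Write \<open>A\<^sup>0\<close> for the finite dual. A coaction \<open>\<rho> : M \<rightarrow> M \<otimes> A\<^sup>0\<close> assigns to each \<open>m\<close> a tensor, and
  evaluating right factors at \<open>a\<close> turns this tensor into the element \<open>a m = \<Sum> m\<^sub>1(a) m\<^sub>0\<close> of \<open>M\<close>.
  The proof rests on the fact that a tensor in \<open>M \<otimes> A\<^sup>0\<close> is determined by these evaluations, and
  that a tensor in \<open>M \<otimes> (A\<^sup>0 \<otimes> A\<^sup>0)\<close> is determined by its evaluations at pairs \<open>(a, b)\<close>. Both are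
  instances of \<open>tensor_eqI\<close>: if a set of functionals separates the points of \<open>N\<close>, then contracting
  with them separates the points of \<open>M \<otimes> N\<close>.

  Consequently every condition on comodules may be read off after evaluation. The coassociativity
  law becomes \<open>(ab) m = a (b m)\<close> (\<open>coassociative_iff_multiplicative\<close>), colinearity of a linear map
  becomes \<open>A\<close>-linearity (\<open>colinear_iff_linear\<close>), counitality becomes \<open>e m = m\<close> (\<open>counit_map\<close>), and
  distinct coactions give distinct actions. The correspondence is thus injective on objects and
  bijective on arrows, and it remains to determine which actions occur.

  A comodule gives a locally finite module: if \<open>\<rho> m = \<Sum> x\<^sub>i \<otimes> f\<^sub>i\<close>, then elements of \<open>A\<close> with the
  same values under all \<open>f\<^sub>i\<close> act on \<open>m\<close> in the same way, so \<open>A m\<close> is finite-dimensional.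
  Conversely, an element \<open>m\<close> of a locally finite module generates a finite-dimensional submodule
  with coordinate functionals \<open>\<phi>\<^sub>j\<close> for vectors \<open>e\<^sub>j\<close>. The functionals \<open>a \<mapsto> \<phi>\<^sub>j(a m)\<close> vanish on
  the annihilator of this submodule, an ideal of finite codimension, so they belong to \<open>A\<^sup>0\<close> and
  \<open>\<Sum> e\<^sub>j \<otimes> \<phi>\<^sub>j(- m)\<close> is a coaction value for \<open>m\<close> (\<open>locally_finite_coaction_at\<close>). The
  finite-dimensional bookkeeping, here and for the comultiplication of \<open>A\<^sup>0\<close>, is carried by
  coordinates modulo a subspace of finite codimension (\<open>dual_system\<close>).
\<close>

section \<open>Isomorphisms of categories\<close>

text \<open>
  When the arrow part is the identity and the hom-sets, identities and composites agree, the
  source inherits the category axioms from the target, and the inverse of a bijection on objects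
  is a functor. For comodules this replaces a direct proof that colinear maps compose.
\<close>

lemma is_category_iso_identity_on_arrows:
  assumes D: "is_category D"
    and bij: "bij_betw Fo (Obj C) (Obj D)"
    and Hom: "\<And>X Y. X \<in> Obj C \<Longrightarrow> Y \<in> Obj C \<Longrightarrow> Hom C X Y = Hom D (Fo X) (Fo Y)"
    and Ident: "\<And>X. X \<in> Obj C \<Longrightarrow> Ident C X = Ident D (Fo X)"
    and Comp: "\<And>X Y Z. X \<in> Obj C \<Longrightarrow> Y \<in> Obj C \<Longrightarrow> Z \<in> Obj C \<Longrightarrow>
      Comp C X Y Z = Comp D (Fo X) (Fo Y) (Fo Z)"
  shows "is_category_iso C D Fo (\<lambda>X Y f. f)"
proof -
  define Go where "Go = inv_into (Obj C) Fo"
  have Fo: "Fo X \<in> Obj D" if "X \<in> Obj C" for X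
    using bij that by (auto simp: bij_betw_def)
  have Go: "Go Y \<in> Obj C" if "Y \<in> Obj D" for Y
    using bij that unfolding Go_def by (metis bij_betw_def inv_into_into)
  have GF: "Go (Fo X) = X" if "X \<in> Obj C" for X
    using bij that unfolding Go_def by (simp add: bij_betw_def)
  have FG: "Fo (Go Y) = Y" if "Y \<in> Obj D" for Y
    using bij that unfolding Go_def by (simp add: bij_betw_def f_inv_into_f)
  have C: "is_category C"
    unfolding is_category_def
    using D[unfolded is_category_def] Fo
    by (intro conjI ballI) (simp_all add: Hom Ident Comp)
  have "is_functor C D Fo (\<lambda>X Y f. f)"
    unfolding is_functor_def using C D Fo by (simp add: Hom Ident Comp)
  moreover have "is_functor D C Go (\<lambda>X Y f. f)"
    unfolding is_functor_def using C D Go by (simp add: Hom Ident Comp FG)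
  ultimately show ?thesis
    unfolding is_category_iso_def using GF FG by (intro conjI exI[of _ Go] exI[of _ "\<lambda>X Y f. f"]) auto
qed

lemma is_category_full_subcat: "is_category C \<Longrightarrow> is_category (full_subcat C P)"
  unfolding is_category_def full_subcat_def by simp

section \<open>Linear maps and subspaces\<close>

lemma module_homI:
  assumes "\<And>x. x \<in> carrier M \<Longrightarrow> f x \<in> carrier N"
    and "\<And>x y. x \<in> carrier M \<Longrightarrow> y \<in> carrier M \<Longrightarrow> f (x \<oplus>\<^bsub>M\<^esub> y) = f x \<oplus>\<^bsub>N\<^esub> f y"
    and "\<And>c x. c \<in> carrier K \<Longrightarrow> x \<in> carrier M \<Longrightarrow> f (c \<odot>\<^bsub>M\<^esub> x) = c \<odot>\<^bsub>N\<^esub> f x"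
  shows "f \<in> module_hom K M N"
  using assms unfolding module_hom_def by auto

lemma module_hom_mem: "f \<in> module_hom K M N \<Longrightarrow> x \<in> carrier M \<Longrightarrow> f x \<in> carrier N"
  unfolding module_hom_def by auto

lemma module_hom_comp:
  "f \<in> module_hom K M N \<Longrightarrow> g \<in> module_hom K N P \<Longrightarrow> (\<lambda>x. g (f x)) \<in> module_hom K M P"
  by (rule module_homI) (simp_all add: module_hom_mem module_hom_add module_hom_smult)

lemma module_hom_cong:
  assumes "vectorspace K M" and "\<And>x. x \<in> carrier M \<Longrightarrow> f x = g x"
  shows "f \<in> module_hom K M N \<longleftrightarrow> g \<in> module_hom K M N"
proof -
  interpret vectorspace K M by fact
  show ?thesis using assms(2) unfolding module_hom_def by (simp add: Pi_iff)
qed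

lemma restrict_lin_maps_iff:
  assumes "vectorspace K M"
  shows "restrict f (carrier M) \<in> lin_maps K M N \<longleftrightarrow> f \<in> module_hom K M N"
  using module_hom_cong[OF assms, of "restrict f (carrier M)" f] unfolding lin_maps_def by simp

lemma lin_maps_hom: "f \<in> lin_maps K M N \<Longrightarrow> f \<in> module_hom K M N"
  unfolding lin_maps_def by simp

lemma lin_maps_extensional: "f \<in> lin_maps K M N \<Longrightarrow> f \<in> extensional (carrier M)"
  unfolding lin_maps_def by simp

lemma lin_maps_eqI:
  "f \<in> lin_maps K M N \<Longrightarrow> g \<in> lin_maps K M N' \<Longrightarrow> (\<And>x. x \<in> carrier M \<Longrightarrow> f x = g x) \<Longrightarrow> f = g"
  unfolding lin_maps_def by (auto intro: extensionalityI)

lemma module_hom_zero: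
  assumes "vectorspace K M" "vectorspace K N" "f \<in> module_hom K M N"
  shows "f \<zero>\<^bsub>M\<^esub> = \<zero>\<^bsub>N\<^esub>"
proof -
  interpret M: vectorspace K M by fact
  interpret N: vectorspace K N by fact
  interpret mod_hom K M N f by unfold_locales (rule assms)
  show ?thesis by simp
qed

lemma module_hom_minus:
  assumes "vectorspace K M" "vectorspace K N" "f \<in> module_hom K M N"
    and "x \<in> carrier M" "y \<in> carrier M"
  shows "f (x \<ominus>\<^bsub>M\<^esub> y) = f x \<ominus>\<^bsub>N\<^esub> f y"
proof -
  interpret M: vectorspace K M by fact
  interpret N: vectorspace K N by fact
  interpret mod_hom K M N f by unfold_locales (rule assms)
  show ?thesis using assms by simp
qed

lemma module_hom_finsum:
  assumes "vectorspace K M" "vectorspace K N" "f \<in> module_hom K M N" "g \<in> I \<rightarrow> carrier M"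
  shows "f (\<Oplus>\<^bsub>M\<^esub>i\<in>I. g i) = (\<Oplus>\<^bsub>N\<^esub>i\<in>I. f (g i))"
proof -
  interpret M: vectorspace K M by fact
  interpret N: vectorspace K N by fact
  interpret mod_hom K M N f by unfold_locales (rule assms)
  show ?thesis using assms(4)
  proof (induction I rule: infinite_finite_induct)
    case (insert i I)
    then have "(\<lambda>i. f (g i)) \<in> insert i I \<rightarrow> carrier N" by auto
    with insert show ?case by simp
  qed auto
qed

lemma subspaceI:
  assumes "vectorspace K V" "W \<subseteq> carrier V" "\<zero>\<^bsub>V\<^esub> \<in> W"
    and "\<And>x y. x \<in> W \<Longrightarrow> y \<in> W \<Longrightarrow> x \<oplus>\<^bsub>V\<^esub> y \<in> W"
    and "\<And>c x. c \<in> carrier K \<Longrightarrow> x \<in> W \<Longrightarrow> c \<odot>\<^bsub>V\<^esub> x \<in> W"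
  shows "subspace K W V"
proof -
  interpret vectorspace K V by fact
  show ?thesis using assms unfolding subspace_def submodule_def by (auto intro: module_axioms)
qed

lemma subspaceD:
  assumes "subspace K W V"
  shows "vectorspace K V" "W \<subseteq> carrier V" "\<And>x. x \<in> W \<Longrightarrow> x \<in> carrier V" "\<zero>\<^bsub>V\<^esub> \<in> W"
    and "\<And>x y. x \<in> W \<Longrightarrow> y \<in> W \<Longrightarrow> x \<oplus>\<^bsub>V\<^esub> y \<in> W"
    and "\<And>c x. c \<in> carrier K \<Longrightarrow> x \<in> W \<Longrightarrow> c \<odot>\<^bsub>V\<^esub> x \<in> W"
  using assms unfolding subspace_def submodule_def by auto

lemma subspace_uminus:
  assumes "subspace K W V" "x \<in> W"
  shows "\<ominus>\<^bsub>V\<^esub> x \<in> W"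
proof -
  interpret vectorspace K V using subspaceD(1)[OF assms(1)] .
  have "(\<ominus>\<^bsub>K\<^esub> \<one>\<^bsub>K\<^esub>) \<odot>\<^bsub>V\<^esub> x \<in> W"
    using subspaceD(6)[OF assms(1)] assms(2) by simp
  then show ?thesis using subspaceD(3)[OF assms] smult_minus_1 by simp
qed

lemma subspace_minus:
  assumes "subspace K W V" "x \<in> W" "y \<in> W"
  shows "x \<ominus>\<^bsub>V\<^esub> y \<in> W"
  using subspaceD(5)[OF assms(1)] subspace_uminus[OF assms(1)] assms(2,3) by (simp add: a_minus_def)

lemma subspace_finsum:
  assumes "subspace K W V" "g \<in> I \<rightarrow> W"
  shows "(\<Oplus>\<^bsub>V\<^esub>i\<in>I. g i) \<in> W"
proof -
  interpret vectorspace K V using subspaceD(1)[OF assms(1)] .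
  show ?thesis using assms(2)
  proof (induction I rule: infinite_finite_induct)
    case (insert i I)
    have "(\<Oplus>\<^bsub>V\<^esub>i\<in>insert i I. g i) = g i \<oplus>\<^bsub>V\<^esub> (\<Oplus>\<^bsub>V\<^esub>i\<in>I. g i)"
      using insert subspaceD(3)[OF assms(1)] by (intro M.finsum_insert) auto
    then show ?case using insert subspaceD(5)[OF assms(1)] by auto
  qed (use subspaceD(4)[OF assms(1)] in auto)
qed

lemma subspace_span:
  assumes "vectorspace K V" "S \<subseteq> carrier V"
  shows "subspace K (module.span K V S) V" "S \<subseteq> module.span K V S"
proof -
  interpret vectorspace K V by fact
  show "subspace K (span S) V" using assms(2) by (rule span_is_subspace)
  show "S \<subseteq> span S" using assms(2) by (rule in_own_span)
qed

lemma span_minimal: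
  assumes "subspace K J V" "S \<subseteq> J"
  shows "module.span K V S \<subseteq> J"
proof -
  interpret vectorspace K V using subspaceD(1)[OF assms(1)] .
  show ?thesis using assms by (intro span_is_subset) auto
qed

text \<open>
  Finite dimension in terms of subspaces instead of linear combinations, so that generation can be
  tested by closure properties, without handling coefficients.
\<close>

lemma fin_dim_iff:
  assumes "vectorspace K V"
  shows "vectorspace.fin_dim K V \<longleftrightarrow>
    (\<exists>S. finite S \<and> S \<subseteq> carrier V \<and> (\<forall>J. subspace K J V \<longrightarrow> S \<subseteq> J \<longrightarrow> carrier V \<subseteq> J))"
proof -
  interpret vectorspace K V by fact
  show ?thesis unfolding fin_dim_def
  proof (intro ex_cong1 conj_cong refl iffI allI impI)
    fix S J assume "span S = carrier V" "subspace K J V" "S \<subseteq> J"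
    then show "carrier V \<subseteq> J" using span_minimal[of K J V S] by simp
  next
    fix S assume S: "S \<subseteq> carrier V" and *: "\<forall>J. subspace K J V \<longrightarrow> S \<subseteq> J \<longrightarrow> carrier V \<subseteq> J"
    have "carrier V \<subseteq> span S"
      using * subspace_span[OF assms S] by simp
    then show "span S = carrier V"
      using subspaceD(2)[OF subspace_span(1)[OF assms S]] by simp
  qed
qed

lemma scalar_space_simps [simp]:
  "carrier (scalar_space K) = carrier K" "add (scalar_space K) = add K"
  "zero (scalar_space K) = zero K" "smult (scalar_space K) = mult K"
  unfolding scalar_space_def by simp_all

lemma vectorspace_scalar_space:
  assumes "field K"
  shows "vectorspace K (scalar_space K)"
proof -
  interpret field K by fact
  show ?thesis
  proof (rule vs_criteria[OF assms])
    show "\<forall>v\<in>carrier (scalar_space K). \<exists>n\<in>carrier (scalar_space K).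
        v \<oplus>\<^bsub>scalar_space K\<^esub> n = \<zero>\<^bsub>scalar_space K\<^esub>"
      using r_neg by (metis a_inv_closed scalar_space_simps(1-3))
  qed (auto simp: a_ac m_assoc l_distr r_distr)
qed

lemma scalar_space_minus [simp]:
  assumes "field K" "x \<in> carrier K" "y \<in> carrier K"
  shows "x \<ominus>\<^bsub>scalar_space K\<^esub> y = x \<ominus>\<^bsub>K\<^esub> y"
proof -
  interpret field K by fact
  interpret S: vectorspace K "scalar_space K" by (rule vectorspace_scalar_space) fact
  have "\<ominus>\<^bsub>scalar_space K\<^esub> y = \<ominus>\<^bsub>K\<^esub> y"
    using assms S.M.minus_equality[of "\<ominus>\<^bsub>K\<^esub> y" y] by (simp add: l_neg)
  then show ?thesis by (simp add: a_minus_def)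
qed

lemma scalar_space_finsum [simp]:
  "finsum (scalar_space K) f I = finsum K f I"
  unfolding finsum_def finprod_def by simp

section \<open>Quotient spaces\<close>

lemma subspace_abelian_subgroup:
  assumes "subspace K W V"
  shows "abelian_subgroup W V"
proof -
  interpret vectorspace K V using subspaceD(1)[OF assms] .
  have "subgroup W (add_monoid V)"
    by (rule M.add.subgroupI) (use subspaceD[OF assms] subspace_uminus[OF assms] in auto)
  then show ?thesis
    by (intro abelian_subgroupI3 additive_subgroupI M.abelian_group_axioms)
qed

lemma coset_eq_iff:
  assumes "subspace K W V" "x \<in> carrier V" "y \<in> carrier V"
  shows "a_r_coset V W x = a_r_coset V W y \<longleftrightarrow> x \<ominus>\<^bsub>V\<^esub> y \<in> W"
proof -
  interpret vectorspace K V using subspaceD(1)[OF assms(1)] .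
  interpret abelian_subgroup W V by (rule subspace_abelian_subgroup) fact
  show ?thesis
    using assms(2,3) a_rcos_self a_rcos_module by (metis a_minus_def a_repr_independence a_subgroup)
qed

lemma quot_space_simps:
  "carrier (quot_space V W) = a_r_coset V W ` carrier V"
  "zero (quot_space V W) = W"
  unfolding quot_space_def by (auto simp: A_RCOSETS_def')

lemma quot_space_zero:
  assumes "subspace K W V"
  shows "zero (quot_space V W) = a_r_coset V W \<zero>\<^bsub>V\<^esub>"
proof -
  interpret vectorspace K V using subspaceD(1)[OF assms] .
  show ?thesis using subspaceD(2)[OF assms] by (simp add: quot_space_simps)
qed

lemma quot_space_add:
  assumes "subspace K W V" "x \<in> carrier V" "y \<in> carrier V"
  shows "a_r_coset V W x \<oplus>\<^bsub>quot_space V W\<^esub> a_r_coset V W y = a_r_coset V W (x \<oplus>\<^bsub>V\<^esub> y)"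
proof -
  interpret abelian_subgroup W V by (rule subspace_abelian_subgroup) fact
  show ?thesis using assms a_rcos_sum by (simp add: quot_space_def)
qed

text \<open>
  Representatives of one coset have scalar multiples in one coset, so all members of the union
  that defines scalar multiplication in the quotient coincide.
\<close>

lemma quot_space_smult:
  assumes W: "subspace K W V" and c: "c \<in> carrier K" and x: "x \<in> carrier V"
  shows "c \<odot>\<^bsub>quot_space V W\<^esub> a_r_coset V W x = a_r_coset V W (c \<odot>\<^bsub>V\<^esub> x)"
proof -
  interpret vectorspace K V using subspaceD(1)[OF W] .
  interpret abelian_subgroup W V by (rule subspace_abelian_subgroup) fact
  have *: "a_r_coset V W (c \<odot>\<^bsub>V\<^esub> y) = a_r_coset V W (c \<odot>\<^bsub>V\<^esub> x)" if "y \<in> a_r_coset V W x" for y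
  proof -
    have y: "y \<in> carrier V" using that x a_r_coset_subset_G[OF a_subset] by blast
    have "y \<ominus>\<^bsub>V\<^esub> x \<in> W"
      using coset_eq_iff[OF W y x] a_repr_independence[OF that x a_subgroup] by simp
    then have "c \<odot>\<^bsub>V\<^esub> (y \<ominus>\<^bsub>V\<^esub> x) \<in> W" using c subspaceD(6)[OF W] by blast
    then have "c \<odot>\<^bsub>V\<^esub> y \<ominus>\<^bsub>V\<^esub> c \<odot>\<^bsub>V\<^esub> x \<in> W"
      using c x y by (simp add: a_minus_def smult_r_distr smult_r_minus)
    then show ?thesis using coset_eq_iff[OF W] c x y by simp
  qed
  have "(\<Union>y\<in>a_r_coset V W x. a_r_coset V W (c \<odot>\<^bsub>V\<^esub> y)) = a_r_coset V W (c \<odot>\<^bsub>V\<^esub> x)"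
    using *[THEN equalityD1] a_rcos_self[OF x] by blast
  then show ?thesis by (simp add: quot_space_def)
qed

lemma vectorspace_quot_space:
  assumes W: "subspace K W V"
  shows "vectorspace K (quot_space V W)"
proof -
  interpret vectorspace K V using subspaceD(1)[OF W] .
  show ?thesis
  proof (rule vs_criteria)
    show "field K" ..
    show "\<forall>v\<in>carrier (quot_space V W). \<exists>n\<in>carrier (quot_space V W).
        v \<oplus>\<^bsub>quot_space V W\<^esub> n = \<zero>\<^bsub>quot_space V W\<^esub>"
    proof
      fix v assume "v \<in> carrier (quot_space V W)"
      then obtain x where x: "x \<in> carrier V" "v = a_r_coset V W x" by (auto simp: quot_space_simps)
      then show "\<exists>n\<in>carrier (quot_space V W). v \<oplus>\<^bsub>quot_space V W\<^esub> n = \<zero>\<^bsub>quot_space V W\<^esub>"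
        by (intro bexI[of _ "a_r_coset V W (\<ominus>\<^bsub>V\<^esub> x)"])
          (auto simp: quot_space_zero[OF W] quot_space_add[OF W] quot_space_simps(1) M.r_neg)
    qed
  qed (auto simp: quot_space_simps(1) quot_space_zero[OF W] quot_space_add[OF W]
      quot_space_smult[OF W] M.a_ac smult_l_distr smult_r_distr smult_assoc1)
qed

lemma coset_hom:
  assumes "subspace K W V"
  shows "a_r_coset V W \<in> module_hom K V (quot_space V W)"
  by (rule module_homI)
    (auto simp: quot_space_simps(1) quot_space_add[OF assms] quot_space_smult[OF assms])

lemma quot_space_lift:
  assumes W: "subspace K W V" and P: "vectorspace K P"
    and f: "f \<in> module_hom K V P" and kill: "\<And>x. x \<in> W \<Longrightarrow> f x = \<zero>\<^bsub>P\<^esub>"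
  obtains h where "h \<in> lin_maps K (quot_space V W) P"
    "\<And>x. x \<in> carrier V \<Longrightarrow> h (a_r_coset V W x) = f x"
proof -
  interpret vectorspace K V using subspaceD(1)[OF W] .
  interpret P: vectorspace K P by fact
  note fhom = module_hom_mem[OF f] module_hom_add[OF f] module_hom_smult[OF f]
  have eq: "f x = f y" if "x \<in> carrier V" "y \<in> carrier V" "a_r_coset V W x = a_r_coset V W y" for x y
    using that coset_eq_iff[OF W] kill[of "x \<ominus>\<^bsub>V\<^esub> y"]
      module_hom_minus[OF vectorspace_axioms P f, of x y] fhom(1) by simp
  define h0 where "h0 X = f (SOME x. x \<in> carrier V \<and> X = a_r_coset V W x)" for X
  have h0: "h0 (a_r_coset V W x) = f x" if "x \<in> carrier V" for x
    unfolding h0_def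
    by (rule someI2[of _ x]) (use that in \<open>auto intro: eq\<close>)
  have "h0 \<in> module_hom K (quot_space V W) P"
    by (rule module_homI)
      (auto simp: quot_space_simps(1) quot_space_add[OF W] quot_space_smult[OF W] h0 fhom)
  then have "restrict h0 (carrier (quot_space V W)) \<in> lin_maps K (quot_space V W) P"
    using restrict_lin_maps_iff[OF vectorspace_quot_space[OF W]] by blast
  then show ?thesis
    by (rule that) (simp add: quot_space_simps(1) h0)
qed

section \<open>Free vector spaces\<close>

lemma free_space_simps:
  "carrier (free_space K S) = {u \<in> S \<rightarrow>\<^sub>E carrier K. finite {s \<in> S. u s \<noteq> \<zero>\<^bsub>K\<^esub>}}"
  "zero (free_space K S) = (\<lambda>s\<in>S. \<zero>\<^bsub>K\<^esub>)"
  "u \<oplus>\<^bsub>free_space K S\<^esub> v = (\<lambda>s\<in>S. u s \<oplus>\<^bsub>K\<^esub> v s)"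
  "c \<odot>\<^bsub>free_space K S\<^esub> u = (\<lambda>s\<in>S. c \<otimes>\<^bsub>K\<^esub> u s)"
  if "field K"
proof -
  interpret field K by fact
  show "carrier (free_space K S) = {u \<in> S \<rightarrow>\<^sub>E carrier K. finite {s \<in> S. u s \<noteq> \<zero>\<^bsub>K\<^esub>}}"
    "zero (free_space K S) = (\<lambda>s\<in>S. \<zero>\<^bsub>K\<^esub>)"
    "u \<oplus>\<^bsub>free_space K S\<^esub> v = (\<lambda>s\<in>S. u s \<oplus>\<^bsub>K\<^esub> v s)"
    "c \<odot>\<^bsub>free_space K S\<^esub> u = (\<lambda>s\<in>S. c \<otimes>\<^bsub>K\<^esub> u s)"
    by (simp_all add: free_space_def func_space_def)
qed

lemma vectorspace_func_space:
  assumes "field K"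
  shows "vectorspace K (ring.func_space K S)"
proof -
  interpret field K by fact
  show ?thesis by (intro vectorspace.intro func_space_is_module) unfold_locales
qed

lemma vectorspace_free_space:
  assumes "field K"
  shows "vectorspace K (free_space K S)"
proof -
  interpret field K by fact
  interpret F: vectorspace K "func_space S" by (rule vectorspace_func_space) fact
  let ?W = "{u \<in> S \<rightarrow>\<^sub>E carrier K. finite {s \<in> S. u s \<noteq> \<zero>\<^bsub>K\<^esub>}}"
  have "subspace K ?W (func_space S)"
  proof (rule subspaceI[OF F.vectorspace_axioms])
    fix u v assume uv: "u \<in> ?W" "v \<in> ?W"
    have "{s \<in> S. u s \<oplus>\<^bsub>K\<^esub> v s \<noteq> \<zero>\<^bsub>K\<^esub>} \<subseteq> {s \<in> S. u s \<noteq> \<zero>\<^bsub>K\<^esub>} \<union> {s \<in> S. v s \<noteq> \<zero>\<^bsub>K\<^esub>}" by auto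
    then have "finite {s \<in> S. u s \<oplus>\<^bsub>K\<^esub> v s \<noteq> \<zero>\<^bsub>K\<^esub>}"
      using uv finite_subset by blast
    then show "u \<oplus>\<^bsub>func_space S\<^esub> v \<in> ?W"
      using uv by (auto simp: func_space_def PiE_mem2 cong: conj_cong)
  next
    fix c u assume cu: "c \<in> carrier K" "u \<in> ?W"
    have "{s \<in> S. c \<otimes>\<^bsub>K\<^esub> u s \<noteq> \<zero>\<^bsub>K\<^esub>} \<subseteq> {s \<in> S. u s \<noteq> \<zero>\<^bsub>K\<^esub>}" using cu(1) by auto
    then have "finite {s \<in> S. c \<otimes>\<^bsub>K\<^esub> u s \<noteq> \<zero>\<^bsub>K\<^esub>}"
      using cu finite_subset by blast
    then show "c \<odot>\<^bsub>func_space S\<^esub> u \<in> ?W"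
      using cu by (auto simp: func_space_def PiE_mem2 cong: conj_cong)
  qed (auto simp: func_space_def cong: conj_cong)
  then show ?thesis using F.subspace_is_vs by (simp add: free_space_def)
qed

lemma free_gen_closed:
  assumes "field K" "s \<in> S"
  shows "free_gen K S s \<in> carrier (free_space K S)"
proof -
  interpret field K by fact
  have "{t \<in> S. free_gen K S s t \<noteq> \<zero>\<^bsub>K\<^esub>} \<subseteq> {s}" by (auto simp: free_gen_def)
  then show ?thesis
    by (auto simp: free_space_simps[OF assms(1)] free_gen_def finite_subset)
qed

text \<open>
  Induction on the size of the support: a function is its value at one point, times the generator
  there, plus the function with that value erased.
\<close>

lemma free_space_induct [consumes 2, case_names zero add]:
  assumes K: "field K" and u: "u \<in> carrier (free_space K S)"
    and zero: "P (zero (free_space K S))"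
    and add: "\<And>c s u. c \<in> carrier K \<Longrightarrow> s \<in> S \<Longrightarrow> u \<in> carrier (free_space K S) \<Longrightarrow> P u \<Longrightarrow>
      P (c \<odot>\<^bsub>free_space K S\<^esub> free_gen K S s \<oplus>\<^bsub>free_space K S\<^esub> u)"
  shows "P u"
proof -
  interpret field K by fact
  note F = free_space_simps[OF K]
  have "finite {s \<in> S. u s \<noteq> \<zero>\<^bsub>K\<^esub>}" using u by (simp add: F)
  then show ?thesis using u
  proof (induction "{s \<in> S. u s \<noteq> \<zero>\<^bsub>K\<^esub>}" arbitrary: u rule: finite_induct)
    case empty
    then have "u = zero (free_space K S)"
      by (auto simp: F fun_eq_iff PiE_def extensional_def)
    then show ?case using zero by simp
  next
    case (insert s A)
    have s: "s \<in> S" using insert.hyps(4) by auto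
    define v where "v = u(s := \<zero>\<^bsub>K\<^esub>)"
    have A: "A = {t \<in> S. v t \<noteq> \<zero>\<^bsub>K\<^esub>}"
      using insert.hyps(2,4) by (auto simp: v_def)
    have v: "v \<in> carrier (free_space K S)"
      using insert.prems insert.hyps(1) A[symmetric] s by (auto simp: F v_def)
    have us: "u s \<in> carrier K" using insert.prems s by (auto simp: F)
    have "u s \<odot>\<^bsub>free_space K S\<^esub> free_gen K S s \<oplus>\<^bsub>free_space K S\<^esub> v = u"
      using insert.prems us s
      by (auto simp: F fun_eq_iff v_def free_gen_def PiE_mem2 PiE_def extensional_def Pi_iff)
    then show ?case using add[OF us s v] insert.hyps(3)[OF A v] by metis
  qed
qed

text \<open>
  The extension sends \<open>u\<close> to \<open>\<Sum> u(s) b(s)\<close>, summed over the support of \<open>u\<close>. Supports vary with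
  \<open>u\<close>, so linearity is checked after enlarging the index sets to a common finite one.
\<close>

lemma free_space_lift:
  assumes P: "vectorspace K P" and b: "b \<in> S \<rightarrow> carrier P"
  obtains h where "h \<in> module_hom K (free_space K S) P" "\<And>s. s \<in> S \<Longrightarrow> h (free_gen K S s) = b s"
proof -
  interpret P: vectorspace K P by fact
  have K: "field K" ..
  note F = free_space_simps[OF K]
  define h where "h u = (\<Oplus>\<^bsub>P\<^esub>s\<in>{s \<in> S. u s \<noteq> \<zero>\<^bsub>K\<^esub>}. u s \<odot>\<^bsub>P\<^esub> b s)" for u
  have h: "h u = (\<Oplus>\<^bsub>P\<^esub>s\<in>A. u s \<odot>\<^bsub>P\<^esub> b s)"
    if "u \<in> carrier (free_space K S)" "finite A" "A \<subseteq> S" "{s \<in> S. u s \<noteq> \<zero>\<^bsub>K\<^esub>} \<subseteq> A" for u A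
    unfolding h_def
    by (rule P.add.finprod_mono_neutral_cong_left) (use that b in \<open>auto simp: F Pi_iff PiE_mem2\<close>)
  have "h \<in> module_hom K (free_space K S) P"
  proof (rule module_homI)
    fix u assume "u \<in> carrier (free_space K S)"
    then show "h u \<in> carrier P"
      unfolding h_def using b by (intro P.finsum_closed) (auto simp: F Pi_iff PiE_mem2)
  next
    fix u v assume u: "u \<in> carrier (free_space K S)" and v: "v \<in> carrier (free_space K S)"
    interpret F: vectorspace K "free_space K S" by (rule vectorspace_free_space) fact
    let ?A = "{s \<in> S. u s \<noteq> \<zero>\<^bsub>K\<^esub>} \<union> {s \<in> S. v s \<noteq> \<zero>\<^bsub>K\<^esub>}"
    have A: "finite ?A" "?A \<subseteq> S" using u v by (auto simp: F)
    have uv: "u s \<in> carrier K" "v s \<in> carrier K" "b s \<in> carrier P" if "s \<in> ?A" for s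
      using that u v b by (auto simp: F)
    have "h (u \<oplus>\<^bsub>free_space K S\<^esub> v) = (\<Oplus>\<^bsub>P\<^esub>s\<in>?A. (u \<oplus>\<^bsub>free_space K S\<^esub> v) s \<odot>\<^bsub>P\<^esub> b s)"
      using u v A by (intro h F.M.a_closed) (auto simp: F)
    also have "\<dots> = (\<Oplus>\<^bsub>P\<^esub>s\<in>?A. u s \<odot>\<^bsub>P\<^esub> b s \<oplus>\<^bsub>P\<^esub> v s \<odot>\<^bsub>P\<^esub> b s)"
      using uv by (intro P.finsum_cong') (auto simp: F P.smult_l_distr)
    also have "\<dots> = (\<Oplus>\<^bsub>P\<^esub>s\<in>?A. u s \<odot>\<^bsub>P\<^esub> b s) \<oplus>\<^bsub>P\<^esub> (\<Oplus>\<^bsub>P\<^esub>s\<in>?A. v s \<odot>\<^bsub>P\<^esub> b s)"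
      using uv by (intro P.finsum_addf) auto
    also have "\<dots> = h u \<oplus>\<^bsub>P\<^esub> h v"
      using h[OF u A] h[OF v A] by simp
    finally show "h (u \<oplus>\<^bsub>free_space K S\<^esub> v) = h u \<oplus>\<^bsub>P\<^esub> h v" .
  next
    fix c u assume c: "c \<in> carrier K" and u: "u \<in> carrier (free_space K S)"
    interpret F: vectorspace K "free_space K S" by (rule vectorspace_free_space) fact
    let ?A = "{s \<in> S. u s \<noteq> \<zero>\<^bsub>K\<^esub>}"
    have A: "finite ?A" "?A \<subseteq> S" using u by (auto simp: F)
    have ub: "u s \<in> carrier K" "b s \<in> carrier P" if "s \<in> ?A" for s
      using that u b by (auto simp: F)
    have "h (c \<odot>\<^bsub>free_space K S\<^esub> u) = (\<Oplus>\<^bsub>P\<^esub>s\<in>?A. (c \<odot>\<^bsub>free_space K S\<^esub> u) s \<odot>\<^bsub>P\<^esub> b s)"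
      using u A c by (intro h F.smult_closed) (auto simp: F)
    also have "\<dots> = (\<Oplus>\<^bsub>P\<^esub>s\<in>?A. c \<odot>\<^bsub>P\<^esub> (u s \<odot>\<^bsub>P\<^esub> b s))"
      using ub c by (intro P.finsum_cong') (auto simp: F P.smult_assoc1)
    also have "\<dots> = c \<odot>\<^bsub>P\<^esub> h u"
      unfolding h_def using ub c by (intro P.finsum_smult[symmetric]) auto
    finally show "h (c \<odot>\<^bsub>free_space K S\<^esub> u) = c \<odot>\<^bsub>P\<^esub> h u" .
  qed
  moreover have "h (free_gen K S s) = b s" if "s \<in> S" for s
  proof -
    have "h (free_gen K S s) = (\<Oplus>\<^bsub>P\<^esub>t\<in>{s}. free_gen K S s t \<odot>\<^bsub>P\<^esub> b t)"
      using that by (intro h free_gen_closed K) (auto simp: free_gen_def)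
    also have "\<dots> = free_gen K S s s \<odot>\<^bsub>P\<^esub> b s"
      using that b by (subst P.finsum_insert) (auto simp: free_gen_def Pi_iff)
    also have "\<dots> = b s" using that b by (auto simp: free_gen_def Pi_iff)
    finally show ?thesis .
  qed
  ultimately show ?thesis by (rule that)
qed

section \<open>Tensor products\<close>

definition bilinear_map ::
  "('k, 'r) ring_scheme \<Rightarrow> ('k, 'm, 'x) module_scheme \<Rightarrow> ('k, 'n, 'y) module_scheme
     \<Rightarrow> ('k, 'p, 'z) module_scheme \<Rightarrow> ('m \<Rightarrow> 'n \<Rightarrow> 'p) \<Rightarrow> bool" where
  "bilinear_map K M N P b \<longleftrightarrow>
     (\<forall>y\<in>carrier N. (\<lambda>x. b x y) \<in> module_hom K M P) \<and>
     (\<forall>x\<in>carrier M. b x \<in> module_hom K N P)"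

lemma bilinear_mapD:
  assumes "bilinear_map K M N P b"
  shows bilinear_left: "y \<in> carrier N \<Longrightarrow> (\<lambda>x. b x y) \<in> module_hom K M P"
    and bilinear_right: "x \<in> carrier M \<Longrightarrow> b x \<in> module_hom K N P"
  using assms by (auto simp: bilinear_map_def)

lemma bilinear_mapI:
  assumes "\<And>y. y \<in> carrier N \<Longrightarrow> (\<lambda>x. b x y) \<in> module_hom K M P"
    and "\<And>x. x \<in> carrier M \<Longrightarrow> b x \<in> module_hom K N P"
  shows "bilinear_map K M N P b"
  using assms by (auto simp: bilinear_map_def)

locale tensor_product = M: vectorspace K M + N: vectorspace K N
  for K :: "('k, 'r) ring_scheme" and M :: "('k, 'm, 'x) module_scheme"
    and N :: "('k, 'n, 'y) module_scheme"
begin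

abbreviation "F \<equiv> free_space K (carrier M \<times> carrier N)"
abbreviation "T \<equiv> tensor_space K M N"
abbreviation pure (infixl "\<oslash>" 75) where "x \<oslash> y \<equiv> pure_tensor K M N x y"

lemma field_K: "field K" ..

lemma F_vs: "vectorspace K F"
  by (rule vectorspace_free_space[OF field_K])

lemma gen_closed:
  "x \<in> carrier M \<Longrightarrow> y \<in> carrier N \<Longrightarrow> free_gen K (carrier M \<times> carrier N) (x, y) \<in> carrier F"
  by (rule free_gen_closed[OF field_K]) simp

lemma tensor_rels_subset: "tensor_rels K M N \<subseteq> carrier F"
proof -
  interpret F: vectorspace K F by (rule F_vs)
  show ?thesis
    unfolding tensor_rels_def Let_def by (auto intro!: gen_closed)
qed

lemma tensor_null_subspace: "subspace K (tensor_null K M N) F"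
  unfolding tensor_null_def by (rule subspace_span[OF F_vs tensor_rels_subset])

lemma tensor_rels_null: "r \<in> tensor_rels K M N \<Longrightarrow> r \<in> tensor_null K M N"
  unfolding tensor_null_def using subspace_span(2)[OF F_vs tensor_rels_subset] by auto

lemma T_vs: "vectorspace K T"
  unfolding tensor_space_def by (rule vectorspace_quot_space[OF tensor_null_subspace])

sublocale T: vectorspace K T
  by (rule T_vs)

lemma pure_closed [simp]: "x \<in> carrier M \<Longrightarrow> y \<in> carrier N \<Longrightarrow> x \<oslash> y \<in> carrier T"
  unfolding pure_tensor_def tensor_space_def using gen_closed by (auto simp: quot_space_simps)

lemma pure_bilinear: "bilinear_map K M N T (\<oslash>)"
proof -
  interpret F: vectorspace K F by (rule F_vs)
  note S = tensor_null_subspace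
  have rel: "u \<ominus>\<^bsub>F\<^esub> v \<in> tensor_rels K M N \<Longrightarrow> u \<in> carrier F \<Longrightarrow> v \<in> carrier F \<Longrightarrow>
      a_r_coset F (tensor_null K M N) u = a_r_coset F (tensor_null K M N) v" for u v
    using coset_eq_iff[OF S] tensor_rels_null by blast
  let ?d = "\<lambda>x y. free_gen K (carrier M \<times> carrier N) (x, y)"
  have "(x \<oplus>\<^bsub>M\<^esub> x') \<oslash> y = x \<oslash> y \<oplus>\<^bsub>T\<^esub> x' \<oslash> y"
    if "x \<in> carrier M" "x' \<in> carrier M" "y \<in> carrier N" for x x' y
  proof -
    have "?d (x \<oplus>\<^bsub>M\<^esub> x') y \<ominus>\<^bsub>F\<^esub> (?d x y \<oplus>\<^bsub>F\<^esub> ?d x' y) \<in> tensor_rels K M N"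
      unfolding tensor_rels_def Let_def using that by blast
    then show ?thesis
      using rel that gen_closed by (simp add: pure_tensor_def tensor_space_def quot_space_add[OF S])
  qed
  moreover have "x \<oslash> (y \<oplus>\<^bsub>N\<^esub> y') = x \<oslash> y \<oplus>\<^bsub>T\<^esub> x \<oslash> y'"
    if "x \<in> carrier M" "y \<in> carrier N" "y' \<in> carrier N" for x y y'
  proof -
    have "?d x (y \<oplus>\<^bsub>N\<^esub> y') \<ominus>\<^bsub>F\<^esub> (?d x y \<oplus>\<^bsub>F\<^esub> ?d x y') \<in> tensor_rels K M N"
      unfolding tensor_rels_def Let_def using that by blast
    then show ?thesis
      using rel that gen_closed by (simp add: pure_tensor_def tensor_space_def quot_space_add[OF S])
  qed
  moreover have "(c \<odot>\<^bsub>M\<^esub> x) \<oslash> y = c \<odot>\<^bsub>T\<^esub> (x \<oslash> y)"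
    if "c \<in> carrier K" "x \<in> carrier M" "y \<in> carrier N" for c x y
  proof -
    have "?d (c \<odot>\<^bsub>M\<^esub> x) y \<ominus>\<^bsub>F\<^esub> (c \<odot>\<^bsub>F\<^esub> ?d x y) \<in> tensor_rels K M N"
      unfolding tensor_rels_def Let_def using that by blast
    then show ?thesis
      using rel that gen_closed by (simp add: pure_tensor_def tensor_space_def quot_space_smult[OF S])
  qed
  moreover have "x \<oslash> (c \<odot>\<^bsub>N\<^esub> y) = c \<odot>\<^bsub>T\<^esub> (x \<oslash> y)"
    if "c \<in> carrier K" "x \<in> carrier M" "y \<in> carrier N" for c x y
  proof -
    have "?d x (c \<odot>\<^bsub>N\<^esub> y) \<ominus>\<^bsub>F\<^esub> (c \<odot>\<^bsub>F\<^esub> ?d x y) \<in> tensor_rels K M N"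
      unfolding tensor_rels_def Let_def using that by blast
    then show ?thesis
      using rel that gen_closed by (simp add: pure_tensor_def tensor_space_def quot_space_smult[OF S])
  qed
  ultimately show ?thesis
    unfolding bilinear_map_def by (intro conjI ballI module_homI) auto
qed

text \<open>
  Pure tensors generate additively: the scalars of a linear combination are absorbed into left
  factors.
\<close>

lemma tensor_induct [consumes 1, case_names zero add]:
  assumes t: "t \<in> carrier T"
    and zero: "P \<zero>\<^bsub>T\<^esub>"
    and add: "\<And>x y t. x \<in> carrier M \<Longrightarrow> y \<in> carrier N \<Longrightarrow> t \<in> carrier T \<Longrightarrow> P t \<Longrightarrow> P (x \<oslash> y \<oplus>\<^bsub>T\<^esub> t)"
  shows "P t"
proof -
  interpret F: vectorspace K F by (rule F_vs)
  note S = tensor_null_subspace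
  let ?q = "a_r_coset F (tensor_null K M N)"
  have q: "?q \<in> module_hom K F T"
    unfolding tensor_space_def by (rule coset_hom[OF S])
  obtain u where u: "u \<in> carrier F" "t = ?q u"
    using t unfolding tensor_space_def by (auto simp: quot_space_simps)
  have "P (?q u)"
    using field_K u(1)
  proof (induction rule: free_space_induct)
    case zero
    show ?case using module_hom_zero[OF F_vs T_vs q] assms(2) by simp
  next
    case (add c s u)
    obtain x y where s: "s = (x, y)" "x \<in> carrier M" "y \<in> carrier N" using add by auto
    have "?q (c \<odot>\<^bsub>F\<^esub> free_gen K (carrier M \<times> carrier N) s \<oplus>\<^bsub>F\<^esub> u) = c \<odot>\<^bsub>T\<^esub> (x \<oslash> y) \<oplus>\<^bsub>T\<^esub> ?q u"
      using add s gen_closed by (simp add: module_hom_add[OF q] module_hom_smult[OF q] pure_tensor_def)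
    also have "\<dots> = (c \<odot>\<^bsub>M\<^esub> x) \<oslash> y \<oplus>\<^bsub>T\<^esub> ?q u"
      using pure_bilinear add s by (simp add: bilinear_map_def module_hom_def)
    finally show ?case
      using assms(3)[of "c \<odot>\<^bsub>M\<^esub> x" y "?q u"] add s module_hom_mem[OF q] by simp
  qed
  then show ?thesis using u by simp
qed

lemma tensor_sum_repr:
  assumes "t \<in> carrier T"
  obtains n :: nat and x y where "\<And>i. i < n \<Longrightarrow> x i \<in> carrier M" "\<And>i. i < n \<Longrightarrow> y i \<in> carrier N"
    "t = (\<Oplus>\<^bsub>T\<^esub>i\<in>{..<n}. x i \<oslash> y i)"
proof -
  have "\<exists>(n::nat) x y. (\<forall>i<n. x i \<in> carrier M \<and> y i \<in> carrier N) \<and> t = (\<Oplus>\<^bsub>T\<^esub>i\<in>{..<n}. x i \<oslash> y i)"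
    using assms
  proof (induction rule: tensor_induct)
    case zero
    show ?case by (intro exI[of _ "0::nat"]) simp
  next
    case (add x0 y0 t)
    then obtain n :: nat and x y where IH: "\<forall>i<n. x i \<in> carrier M \<and> y i \<in> carrier N"
      "t = (\<Oplus>\<^bsub>T\<^esub>i\<in>{..<n}. x i \<oslash> y i)" by blast
    let ?x = "x(n := x0)" and ?y = "y(n := y0)"
    have "(\<Oplus>\<^bsub>T\<^esub>i\<in>{..<Suc n}. ?x i \<oslash> ?y i) = ?x n \<oslash> ?y n \<oplus>\<^bsub>T\<^esub> (\<Oplus>\<^bsub>T\<^esub>i\<in>{..<n}. ?x i \<oslash> ?y i)"
      unfolding lessThan_Suc using IH(1) add by (intro T.finsum_insert) auto
    also have "(\<Oplus>\<^bsub>T\<^esub>i\<in>{..<n}. ?x i \<oslash> ?y i) = t"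
      unfolding IH(2) using IH(1) by (intro T.finsum_cong') auto
    finally have "x0 \<oslash> y0 \<oplus>\<^bsub>T\<^esub> t = (\<Oplus>\<^bsub>T\<^esub>i\<in>{..<Suc n}. ?x i \<oslash> ?y i)" by simp
    moreover have "\<forall>i<Suc n. ?x i \<in> carrier M \<and> ?y i \<in> carrier N"
      using IH(1) add by (auto simp: less_Suc_eq)
    ultimately show ?case by blast
  qed
  then show ?thesis using that by blast
qed

lemma hom_eq_on_tensors:
  assumes P: "vectorspace K P" and f: "f \<in> module_hom K T P" and g: "g \<in> module_hom K T P"
    and eq: "\<And>x y. x \<in> carrier M \<Longrightarrow> y \<in> carrier N \<Longrightarrow> f (x \<oslash> y) = g (x \<oslash> y)"
    and t: "t \<in> carrier T"
  shows "f t = g t"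
  using t
proof (induction rule: tensor_induct)
  case zero
  show ?case using module_hom_zero[OF T_vs P f] module_hom_zero[OF T_vs P g] by simp
next
  case (add x y t)
  then show ?case using eq by (simp add: module_hom_add[OF f] module_hom_add[OF g])
qed

text \<open>
  The universal property, which turns the definite description behind the lift into a usable map.
  A lift exists because the extension of \<open>b\<close> to the free space kills the bilinearity relations; it
  is unique because pure tensors generate.
\<close>

lemma tensor_lift:
  assumes P: "vectorspace K P" and b: "bilinear_map K M N P b"
  shows tensor_lift_lin: "tensor_lift K M N P b \<in> lin_maps K T P"
    and tensor_lift_pure: "\<And>x y. x \<in> carrier M \<Longrightarrow> y \<in> carrier N \<Longrightarrow>
      tensor_lift K M N P b (x \<oslash> y) = b x y"
proof -
  interpret F: vectorspace K F by (rule F_vs)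
  interpret P: vectorspace K P by fact
  let ?S = "carrier M \<times> carrier N"
  note bD = b[unfolded bilinear_map_def, THEN conjunct1, rule_format]
    b[unfolded bilinear_map_def, THEN conjunct2, rule_format]
  have bc: "b x y \<in> carrier P" if "x \<in> carrier M" "y \<in> carrier N" for x y
    using module_hom_mem[OF bD(1)] that by blast
  have bPi: "(\<lambda>s. b (fst s) (snd s)) \<in> ?S \<rightarrow> carrier P" using bc by auto
  obtain h where h: "h \<in> module_hom K F P" and hb: "\<And>s. s \<in> ?S \<Longrightarrow> h (free_gen K ?S s) = b (fst s) (snd s)"
    using free_space_lift[OF P bPi] by blast
  have minus: "h (u \<ominus>\<^bsub>F\<^esub> v) = \<zero>\<^bsub>P\<^esub>" if "u \<in> carrier F" "v \<in> carrier F" "h u = h v" for u v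
    using module_hom_minus[OF F_vs P h that(1,2)] that(3) module_hom_mem[OF h that(2)] by simp
  have "tensor_rels K M N \<subseteq> {u \<in> carrier F. h u = \<zero>\<^bsub>P\<^esub>}"
    unfolding tensor_rels_def Let_def
    by (auto intro!: minus gen_closed
        simp: module_hom_add[OF h] module_hom_smult[OF h] gen_closed hb
          module_hom_add[OF bD(1)] module_hom_smult[OF bD(1)]
          module_hom_add[OF bD(2)] module_hom_smult[OF bD(2)])
  moreover have "subspace K {u \<in> carrier F. h u = \<zero>\<^bsub>P\<^esub>} F"
    by (rule subspaceI[OF F_vs])
      (auto simp: module_hom_add[OF h] module_hom_smult[OF h] module_hom_zero[OF F_vs P h])
  ultimately have "tensor_null K M N \<subseteq> {u \<in> carrier F. h u = \<zero>\<^bsub>P\<^esub>}"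
    unfolding tensor_null_def by (intro span_minimal)
  then obtain g where g: "g \<in> lin_maps K T P"
    and gh: "\<And>u. u \<in> carrier F \<Longrightarrow> g (a_r_coset F (tensor_null K M N) u) = h u"
    unfolding tensor_space_def using quot_space_lift[OF tensor_null_subspace P h] by blast
  have gb: "g (x \<oslash> y) = b x y" if "x \<in> carrier M" "y \<in> carrier N" for x y
    using that gh gen_closed hb by (simp add: pure_tensor_def)
  have "tensor_lift K M N P b = g"
    unfolding tensor_lift_def
  proof (rule the_equality)
    fix f assume f: "f \<in> lin_maps K T P \<and> (\<forall>x\<in>carrier M. \<forall>y\<in>carrier N. f (x \<oslash> y) = b x y)"
    show "f = g"
    proof (rule lin_maps_eqI[of f K T P g P])
      fix t assume "t \<in> carrier T"
      then show "f t = g t"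
        by (rule hom_eq_on_tensors[OF P lin_maps_hom lin_maps_hom, rotated -1]) (use f g gb in simp_all)
    qed (use f g in auto)
  qed (use g gb in auto)
  with g gb show "tensor_lift K M N P b \<in> lin_maps K T P"
    "\<And>x y. x \<in> carrier M \<Longrightarrow> y \<in> carrier N \<Longrightarrow> tensor_lift K M N P b (x \<oslash> y) = b x y"
    by auto
qed

end

section \<open>Tensors are determined by separating functionals\<close>

text \<open>
  This is \<open>id \<otimes> \<phi> : M \<otimes> N \<rightarrow> M \<otimes> K\<close> followed by \<open>M \<otimes> K \<cong> M\<close>. For the evaluation of the finite dual
  at \<open>a\<close> it sends \<open>\<Sum> m\<^sub>0 \<otimes> m\<^sub>1\<close> to \<open>\<Sum> m\<^sub>1(a) m\<^sub>0\<close>.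
\<close>

definition contract ::
  "('k, 'r) ring_scheme \<Rightarrow> ('k, 'm, 'x) module_scheme \<Rightarrow> ('k, 'n, 'y) module_scheme
     \<Rightarrow> ('n \<Rightarrow> 'k) \<Rightarrow> ('m \<times> 'n \<Rightarrow> 'k) set \<Rightarrow> 'm" where
  "contract K M N \<phi> = tensor_lift K M N M (\<lambda>x y. \<phi> y \<odot>\<^bsub>M\<^esub> x)"

context tensor_product
begin

lemma contract_bilinear:
  assumes \<phi>: "\<phi> \<in> module_hom K N (scalar_space K)"
  shows "bilinear_map K M N M (\<lambda>x y. \<phi> y \<odot>\<^bsub>M\<^esub> x)"
proof -
  have [simp]: "\<phi> y \<in> carrier K" if "y \<in> carrier N" for y
    using module_hom_mem[OF \<phi> that] by simp
  show ?thesis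
    by (intro bilinear_mapI module_homI)
      (auto simp: module_hom_add[OF \<phi>] module_hom_smult[OF \<phi>] M.smult_l_distr M.smult_r_distr
        M.smult_assoc1[symmetric] M.R.m_comm)
qed

lemma contract_hom:
  "\<phi> \<in> module_hom K N (scalar_space K) \<Longrightarrow> contract K M N \<phi> \<in> module_hom K T M"
  unfolding contract_def
  by (rule lin_maps_hom[OF tensor_lift_lin[OF M.vectorspace_axioms contract_bilinear]])

lemma contract_pure:
  "\<phi> \<in> module_hom K N (scalar_space K) \<Longrightarrow> x \<in> carrier M \<Longrightarrow> y \<in> carrier N \<Longrightarrow>
    contract K M N \<phi> (x \<oslash> y) = \<phi> y \<odot>\<^bsub>M\<^esub> x"
  unfolding contract_def
  by (intro tensor_lift_pure contract_bilinear M.vectorspace_axioms)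

text \<open>
  If the last left factor is a combination of the others, a sum of \<open>n + 1\<close> values of a bilinear
  map is a sum of \<open>n\<close> values with modified right factors. The modification does not depend on the
  bilinear map, so the same step shortens a tensor and, simultaneously, all its contractions.
\<close>

lemma bilinear_sum_eliminate:
  assumes P: "vectorspace K P" and b: "bilinear_map K M N P b"
    and x: "x \<in> {..<Suc n} \<rightarrow> carrier M" and y: "y \<in> {..<Suc n} \<rightarrow> carrier N"
    and d: "d \<in> {..<n} \<rightarrow> carrier K"
    and xn: "x n = (\<Oplus>\<^bsub>M\<^esub>i\<in>{..<n}. d i \<odot>\<^bsub>M\<^esub> x i)"
  shows "(\<Oplus>\<^bsub>P\<^esub>i\<in>{..<Suc n}. b (x i) (y i)) = (\<Oplus>\<^bsub>P\<^esub>i\<in>{..<n}. b (x i) (y i \<oplus>\<^bsub>N\<^esub> d i \<odot>\<^bsub>N\<^esub> y n))"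
proof -
  interpret P: vectorspace K P by fact
  have xi: "x i \<in> carrier M" "y i \<in> carrier N" if "i < Suc n" for i
    using that x y by auto
  have di: "d i \<in> carrier K" if "i < n" for i using that d by auto
  have bc: "b u v \<in> carrier P" if "u \<in> carrier M" "v \<in> carrier N" for u v
    using module_hom_mem[OF bilinear_right[OF b]] that by blast
  have yn: "y n \<in> carrier N" using xi by simp
  have "(\<Oplus>\<^bsub>P\<^esub>i\<in>{..<n}. b (x i) (y i \<oplus>\<^bsub>N\<^esub> d i \<odot>\<^bsub>N\<^esub> y n))
      = (\<Oplus>\<^bsub>P\<^esub>i\<in>{..<n}. b (x i) (y i) \<oplus>\<^bsub>P\<^esub> b (d i \<odot>\<^bsub>M\<^esub> x i) (y n))"
    using xi di bc
    by (intro P.finsum_cong')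
      (auto simp: module_hom_add[OF bilinear_right[OF b]] module_hom_smult[OF bilinear_right[OF b]]
        module_hom_smult[OF bilinear_left[OF b]])
  also have "\<dots> = (\<Oplus>\<^bsub>P\<^esub>i\<in>{..<n}. b (x i) (y i)) \<oplus>\<^bsub>P\<^esub> (\<Oplus>\<^bsub>P\<^esub>i\<in>{..<n}. b (d i \<odot>\<^bsub>M\<^esub> x i) (y n))"
    using xi di bc by (intro P.finsum_addf) auto
  also have "(\<Oplus>\<^bsub>P\<^esub>i\<in>{..<n}. b (d i \<odot>\<^bsub>M\<^esub> x i) (y n)) = b (x n) (y n)"
    unfolding xn using xi di
    by (intro module_hom_finsum[OF M.vectorspace_axioms P bilinear_left[OF b yn], symmetric]) auto
  also have "(\<Oplus>\<^bsub>P\<^esub>i\<in>{..<n}. b (x i) (y i)) \<oplus>\<^bsub>P\<^esub> b (x n) (y n) = (\<Oplus>\<^bsub>P\<^esub>i\<in>{..<Suc n}. b (x i) (y i))"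
    unfolding lessThan_Suc using xi bc by (subst P.finsum_insert) (auto simp: P.M.a_comm)
  finally show ?thesis by simp
qed

text \<open>
  Induction on the number of summands. A last summand with right factor \<open>0\<close> is dropped. Otherwise
  some \<open>\<psi>\<close> does not vanish on the last right factor, the contraction by \<open>\<psi>\<close> expresses the last
  left factor by the others, and the elimination step applies.
\<close>

lemma finite_tensor_sum_zero:
  assumes \<Phi>: "\<Phi> \<subseteq> module_hom K N (scalar_space K)"
    and sep: "\<And>y. y \<in> carrier N \<Longrightarrow> (\<And>\<phi>. \<phi> \<in> \<Phi> \<Longrightarrow> \<phi> y = \<zero>\<^bsub>K\<^esub>) \<Longrightarrow> y = \<zero>\<^bsub>N\<^esub>"
    and "x \<in> {..<n} \<rightarrow> carrier M" "y \<in> {..<n::nat} \<rightarrow> carrier N"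
    and "\<And>\<phi>. \<phi> \<in> \<Phi> \<Longrightarrow> (\<Oplus>\<^bsub>M\<^esub>i\<in>{..<n}. \<phi> (y i) \<odot>\<^bsub>M\<^esub> x i) = \<zero>\<^bsub>M\<^esub>"
  shows "(\<Oplus>\<^bsub>T\<^esub>i\<in>{..<n}. x i \<oslash> y i) = \<zero>\<^bsub>T\<^esub>"
  using assms(3-)
proof (induction n arbitrary: y)
  case 0
  show ?case by simp
next
  case (Suc n)
  note x = Suc.prems(1) and y = Suc.prems(2) and null = Suc.prems(3)
  have xi: "x i \<in> carrier M" "y i \<in> carrier N" if "i < Suc n" for i
    using that x y by auto
  have \<phi>c: "\<phi> v \<in> carrier K" if "\<phi> \<in> \<Phi>" "v \<in> carrier N" for \<phi> v
    using module_hom_mem[of \<phi> K N "scalar_space K" v] \<Phi> that by auto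
  show ?case
  proof (cases "y n = \<zero>\<^bsub>N\<^esub>")
    case True
    have "(\<Oplus>\<^bsub>M\<^esub>i\<in>{..<n}. \<phi> (y i) \<odot>\<^bsub>M\<^esub> x i) = \<zero>\<^bsub>M\<^esub>" if \<phi>: "\<phi> \<in> \<Phi>" for \<phi>
    proof -
      have "\<phi> (y n) = \<zero>\<^bsub>K\<^esub>"
        using module_hom_zero[OF N.vectorspace_axioms vectorspace_scalar_space[OF field_K], of \<phi>] \<Phi> \<phi> True
        by auto
      then have "(\<Oplus>\<^bsub>M\<^esub>i\<in>{..<Suc n}. \<phi> (y i) \<odot>\<^bsub>M\<^esub> x i) = (\<Oplus>\<^bsub>M\<^esub>i\<in>{..<n}. \<phi> (y i) \<odot>\<^bsub>M\<^esub> x i)"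
        unfolding lessThan_Suc using xi \<phi>c[OF \<phi>] by (subst M.finsum_insert) (auto intro!: M.M.l_zero M.finsum_closed)
      then show ?thesis using null[OF \<phi>] by simp
    qed
    then have "(\<Oplus>\<^bsub>T\<^esub>i\<in>{..<n}. x i \<oslash> y i) = \<zero>\<^bsub>T\<^esub>"
      using x y by (intro Suc.IH) auto
    moreover have "x n \<oslash> y n = \<zero>\<^bsub>T\<^esub>"
      using module_hom_zero[OF N.vectorspace_axioms T_vs bilinear_right[OF pure_bilinear]] xi True by simp
    ultimately show ?thesis
      unfolding lessThan_Suc using xi by (subst T.finsum_insert) auto
  next
    case False
    then obtain \<psi> where \<psi>: "\<psi> \<in> \<Phi>" "\<psi> (y n) \<noteq> \<zero>\<^bsub>K\<^esub>"
      using sep xi(2) by blast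
    let ?c = "inv\<^bsub>K\<^esub> \<psi> (y n)"
    have c: "?c \<in> carrier K" "?c \<otimes>\<^bsub>K\<^esub> \<psi> (y n) = \<one>\<^bsub>K\<^esub>"
      using \<psi> \<phi>c[OF \<psi>(1)] xi(2)[of n] by (auto simp: M.field_Units)
    \<comment> \<open>Solving the contraction by \<open>\<psi>\<close> for the last left factor: these are its coefficients.\<close>
    define d where "d i = \<ominus>\<^bsub>K\<^esub> (?c \<otimes>\<^bsub>K\<^esub> \<psi> (y i))" for i
    have d: "d \<in> {..<n} \<rightarrow> carrier K"
      unfolding d_def using c \<phi>c[OF \<psi>(1)] xi by auto
    let ?s = "\<Oplus>\<^bsub>M\<^esub>i\<in>{..<n}. \<psi> (y i) \<odot>\<^bsub>M\<^esub> x i"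
    have s: "?s \<in> carrier M" using xi \<phi>c[OF \<psi>(1)] by (intro M.finsum_closed) auto
    have "\<psi> (y n) \<odot>\<^bsub>M\<^esub> x n \<oplus>\<^bsub>M\<^esub> ?s = \<zero>\<^bsub>M\<^esub>"
      using null[OF \<psi>(1)] xi \<phi>c[OF \<psi>(1)] unfolding lessThan_Suc by (subst (asm) M.finsum_insert) auto
    then have "\<psi> (y n) \<odot>\<^bsub>M\<^esub> x n = \<ominus>\<^bsub>M\<^esub> ?s"
      using s xi \<phi>c[OF \<psi>(1)] by (intro M.M.minus_equality[symmetric]) auto
    then have "x n = ?c \<odot>\<^bsub>M\<^esub> (\<ominus>\<^bsub>M\<^esub> ?s)"
      using c xi \<phi>c[OF \<psi>(1)] M.smult_assoc1[of ?c "\<psi> (y n)" "x n"] by simp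
    also have "\<dots> = (\<ominus>\<^bsub>K\<^esub> ?c) \<odot>\<^bsub>M\<^esub> ?s"
      using c s by (simp add: M.smult_l_minus M.smult_r_minus)
    also have "\<dots> = (\<Oplus>\<^bsub>M\<^esub>i\<in>{..<n}. (\<ominus>\<^bsub>K\<^esub> ?c) \<odot>\<^bsub>M\<^esub> (\<psi> (y i) \<odot>\<^bsub>M\<^esub> x i))"
      using c xi \<phi>c[OF \<psi>(1)] by (intro M.finsum_smult) auto
    also have "\<dots> = (\<Oplus>\<^bsub>M\<^esub>i\<in>{..<n}. d i \<odot>\<^bsub>M\<^esub> x i)"
      unfolding d_def using c xi \<phi>c[OF \<psi>(1)]
      by (intro M.finsum_cong') (auto simp: M.smult_assoc1[symmetric] M.R.l_minus)
    finally have xn: "x n = (\<Oplus>\<^bsub>M\<^esub>i\<in>{..<n}. d i \<odot>\<^bsub>M\<^esub> x i)" .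
    have "(\<Oplus>\<^bsub>T\<^esub>i\<in>{..<n}. x i \<oslash> (y i \<oplus>\<^bsub>N\<^esub> d i \<odot>\<^bsub>N\<^esub> y n)) = \<zero>\<^bsub>T\<^esub>"
    proof (rule Suc.IH)
      show "(\<Oplus>\<^bsub>M\<^esub>i\<in>{..<n}. \<phi> (y i \<oplus>\<^bsub>N\<^esub> d i \<odot>\<^bsub>N\<^esub> y n) \<odot>\<^bsub>M\<^esub> x i) = \<zero>\<^bsub>M\<^esub>" if \<phi>: "\<phi> \<in> \<Phi>" for \<phi>
        using null[OF \<phi>] \<Phi> \<phi>
          bilinear_sum_eliminate[OF M.vectorspace_axioms contract_bilinear[of \<phi>] x y d xn] by auto
    qed (use xi d in \<open>auto intro!: N.M.a_closed N.smult_closed\<close>)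
    then show ?thesis
      using bilinear_sum_eliminate[OF T_vs pure_bilinear x y d xn] by simp
  qed
qed

lemma tensor_zeroI:
  assumes \<Phi>: "\<Phi> \<subseteq> module_hom K N (scalar_space K)"
    and sep: "\<And>y. y \<in> carrier N \<Longrightarrow> (\<And>\<phi>. \<phi> \<in> \<Phi> \<Longrightarrow> \<phi> y = \<zero>\<^bsub>K\<^esub>) \<Longrightarrow> y = \<zero>\<^bsub>N\<^esub>"
    and t: "t \<in> carrier T"
    and null: "\<And>\<phi>. \<phi> \<in> \<Phi> \<Longrightarrow> contract K M N \<phi> t = \<zero>\<^bsub>M\<^esub>"
  shows "t = \<zero>\<^bsub>T\<^esub>"
proof -
  obtain n :: nat and x y where xy: "\<And>i. i < n \<Longrightarrow> x i \<in> carrier M" "\<And>i. i < n \<Longrightarrow> y i \<in> carrier N"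
    and t: "t = (\<Oplus>\<^bsub>T\<^esub>i\<in>{..<n}. x i \<oslash> y i)"
    using tensor_sum_repr[OF t] by blast
  have "(\<Oplus>\<^bsub>M\<^esub>i\<in>{..<n}. \<phi> (y i) \<odot>\<^bsub>M\<^esub> x i) = \<zero>\<^bsub>M\<^esub>" if \<phi>: "\<phi> \<in> \<Phi>" for \<phi>
  proof -
    have \<phi>h: "\<phi> \<in> module_hom K N (scalar_space K)" using \<phi> \<Phi> by blast
    have "contract K M N \<phi> t = (\<Oplus>\<^bsub>M\<^esub>i\<in>{..<n}. contract K M N \<phi> (x i \<oslash> y i))"
      unfolding t using xy
      by (intro module_hom_finsum[OF T_vs M.vectorspace_axioms contract_hom[OF \<phi>h]]) auto
    also have "\<dots> = (\<Oplus>\<^bsub>M\<^esub>i\<in>{..<n}. \<phi> (y i) \<odot>\<^bsub>M\<^esub> x i)"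
      using xy module_hom_mem[OF \<phi>h] by (intro M.finsum_cong') (auto simp: contract_pure[OF \<phi>h])
    finally show ?thesis using null[OF \<phi>] by simp
  qed
  then show ?thesis
    unfolding t using xy by (intro finite_tensor_sum_zero[OF \<Phi> sep]) auto
qed

text \<open>
  Linearity of maps into a tensor product, and identities between tensors, may thus be verified
  after contracting with enough functionals.
\<close>

lemma tensor_eqI:
  assumes \<Phi>: "\<Phi> \<subseteq> module_hom K N (scalar_space K)"
    and sep: "\<And>y. y \<in> carrier N \<Longrightarrow> (\<And>\<phi>. \<phi> \<in> \<Phi> \<Longrightarrow> \<phi> y = \<zero>\<^bsub>K\<^esub>) \<Longrightarrow> y = \<zero>\<^bsub>N\<^esub>"
    and s: "s \<in> carrier T" and t: "t \<in> carrier T"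
    and eq: "\<And>\<phi>. \<phi> \<in> \<Phi> \<Longrightarrow> contract K M N \<phi> s = contract K M N \<phi> t"
  shows "s = t"
proof -
  have "s \<ominus>\<^bsub>T\<^esub> t = \<zero>\<^bsub>T\<^esub>"
  proof (rule tensor_zeroI[OF \<Phi> sep])
    fix \<phi> assume "\<phi> \<in> \<Phi>"
    then have \<phi>h: "\<phi> \<in> module_hom K N (scalar_space K)" using \<Phi> by blast
    show "contract K M N \<phi> (s \<ominus>\<^bsub>T\<^esub> t) = \<zero>\<^bsub>M\<^esub>"
      using module_hom_minus[OF T_vs M.vectorspace_axioms contract_hom[OF \<phi>h] s t] eq[OF \<open>\<phi> \<in> \<Phi>\<close>]
        module_hom_mem[OF contract_hom[OF \<phi>h] t] by simp
  qed (use s t in auto)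
  then show ?thesis using s t by simp
qed

end

section \<open>Subspaces of finite codimension\<close>

text \<open>
  The functionals \<open>\<phi>\<^sub>j\<close> vanish on \<open>W\<close> and are the coordinates, with respect to the \<open>e\<^sub>j\<close>, of a
  vector modulo \<open>W\<close>. Such data exist exactly if \<open>W\<close> has finite codimension. The case \<open>W = 0\<close>
  provides coordinates on a finite-dimensional space.
\<close>

definition dual_system ::
  "('k, 'r) ring_scheme \<Rightarrow> ('k, 'v, 'x) module_scheme \<Rightarrow> 'v set
     \<Rightarrow> nat \<Rightarrow> (nat \<Rightarrow> 'v) \<Rightarrow> (nat \<Rightarrow> 'v \<Rightarrow> 'k) \<Rightarrow> bool" where
  "dual_system K V W n e \<phi> \<longleftrightarrow>
     (\<forall>j<n. e j \<in> carrier V \<and> \<phi> j \<in> lin_maps K V (scalar_space K) \<and> (\<forall>x\<in>W. \<phi> j x = \<zero>\<^bsub>K\<^esub>)) \<and>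
     (\<forall>v\<in>carrier V. v \<ominus>\<^bsub>V\<^esub> (\<Oplus>\<^bsub>V\<^esub>j\<in>{..<n}. \<phi> j v \<odot>\<^bsub>V\<^esub> e j) \<in> W)"

lemma functional_closed:
  "\<phi> \<in> module_hom K V (scalar_space K) \<Longrightarrow> v \<in> carrier V \<Longrightarrow> \<phi> v \<in> carrier K"
  using module_hom_mem[of \<phi> K V "scalar_space K" v] by simp

text \<open>
  The part of a vector that remains after its coordinates are removed; for a dual system these
  remainders lie in \<open>W\<close>.
\<close>

lemma coordinate_remainder_hom:
  assumes V: "vectorspace K V"
    and e: "\<And>j. j < n \<Longrightarrow> e j \<in> carrier V"
    and \<phi>: "\<And>j. j < n \<Longrightarrow> \<phi> j \<in> module_hom K V (scalar_space K)"
  shows "(\<lambda>v. v \<ominus>\<^bsub>V\<^esub> (\<Oplus>\<^bsub>V\<^esub>j\<in>{..<n::nat}. \<phi> j v \<odot>\<^bsub>V\<^esub> e j)) \<in> module_hom K V V"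
proof -
  interpret V: vectorspace K V by fact
  let ?s = "\<lambda>v. \<Oplus>\<^bsub>V\<^esub>j\<in>{..<n}. \<phi> j v \<odot>\<^bsub>V\<^esub> e j"
  have \<phi>c: "\<phi> j v \<in> carrier K" if "j < n" "v \<in> carrier V" for j v
    using functional_closed[OF \<phi>] that by blast
  have s: "?s v \<in> carrier V" if "v \<in> carrier V" for v
    using that e \<phi>c by (intro V.finsum_closed) auto
  have add: "?s (u \<oplus>\<^bsub>V\<^esub> v) = ?s u \<oplus>\<^bsub>V\<^esub> ?s v" if "u \<in> carrier V" "v \<in> carrier V" for u v
  proof -
    have "?s (u \<oplus>\<^bsub>V\<^esub> v) = (\<Oplus>\<^bsub>V\<^esub>j\<in>{..<n}. \<phi> j u \<odot>\<^bsub>V\<^esub> e j \<oplus>\<^bsub>V\<^esub> \<phi> j v \<odot>\<^bsub>V\<^esub> e j)"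
      using that e \<phi>c by (intro V.finsum_cong') (auto simp: module_hom_add[OF \<phi>] V.smult_l_distr)
    also have "\<dots> = ?s u \<oplus>\<^bsub>V\<^esub> ?s v"
      using that e \<phi>c by (intro V.finsum_addf) auto
    finally show ?thesis .
  qed
  have smult: "?s (c \<odot>\<^bsub>V\<^esub> v) = c \<odot>\<^bsub>V\<^esub> ?s v" if "c \<in> carrier K" "v \<in> carrier V" for c v
  proof -
    have "?s (c \<odot>\<^bsub>V\<^esub> v) = (\<Oplus>\<^bsub>V\<^esub>j\<in>{..<n}. c \<odot>\<^bsub>V\<^esub> (\<phi> j v \<odot>\<^bsub>V\<^esub> e j))"
      using that e \<phi>c by (intro V.finsum_cong') (auto simp: module_hom_smult[OF \<phi>] V.smult_assoc1)
    also have "\<dots> = c \<odot>\<^bsub>V\<^esub> ?s v"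
      using that e \<phi>c by (intro V.finsum_smult[symmetric]) auto
    finally show ?thesis .
  qed
  show ?thesis
  proof (rule module_homI)
    fix u v assume uv: "u \<in> carrier V" "v \<in> carrier V"
    show "u \<oplus>\<^bsub>V\<^esub> v \<ominus>\<^bsub>V\<^esub> ?s (u \<oplus>\<^bsub>V\<^esub> v) = u \<ominus>\<^bsub>V\<^esub> ?s u \<oplus>\<^bsub>V\<^esub> (v \<ominus>\<^bsub>V\<^esub> ?s v)"
      using uv s by (simp add: add a_minus_def V.M.minus_add V.M.a_ac)
  next
    fix c v assume cv: "c \<in> carrier K" "v \<in> carrier V"
    show "c \<odot>\<^bsub>V\<^esub> v \<ominus>\<^bsub>V\<^esub> ?s (c \<odot>\<^bsub>V\<^esub> v) = c \<odot>\<^bsub>V\<^esub> (v \<ominus>\<^bsub>V\<^esub> ?s v)"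
      using cv s by (simp add: smult a_minus_def V.smult_r_distr V.smult_r_minus)
  qed (use s in auto)
qed

text \<open>
  Passing to a hyperplane of \<open>J\<close> costs one more coordinate: unless \<open>\<theta>\<close> is zero on \<open>J\<close>, choose \<open>b\<close>
  in \<open>J\<close> with \<open>\<theta> b = 1\<close> and use as new coordinate the value of \<open>\<theta>\<close> on the remainder modulo \<open>J\<close>.
  Both constructions of dual systems below iterate this step.
\<close>

lemma dual_system_kernel_step:
  assumes J: "subspace K J V" and \<theta>: "\<theta> \<in> module_hom K (V\<lparr>carrier := J\<rparr>) (scalar_space K)"
    and ds: "dual_system K V J n e \<phi>"
  shows "\<exists>n e \<phi>. dual_system K V {v \<in> J. \<theta> v = \<zero>\<^bsub>K\<^esub>} n e \<phi>"
proof (cases "\<forall>v\<in>J. \<theta> v = \<zero>\<^bsub>K\<^esub>")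
  case True
  then have "{v \<in> J. \<theta> v = \<zero>\<^bsub>K\<^esub>} = J" by auto
  then show ?thesis using ds by auto
next
  case False
  have V: "vectorspace K V" using subspaceD(1)[OF J] .
  interpret V: vectorspace K V by (rule V)
  have K: "field K" ..
  note JD = subspaceD[OF J]
  have \<theta>c: "\<theta> v \<in> carrier K" if "v \<in> J" for v
    using module_hom_mem[OF \<theta>] that by simp
  have \<theta>add: "\<theta> (u \<oplus>\<^bsub>V\<^esub> v) = \<theta> u \<oplus>\<^bsub>K\<^esub> \<theta> v" if "u \<in> J" "v \<in> J" for u v
    using module_hom_add[OF \<theta>] that by simp
  have \<theta>smult: "\<theta> (c \<odot>\<^bsub>V\<^esub> v) = c \<otimes>\<^bsub>K\<^esub> \<theta> v" if "c \<in> carrier K" "v \<in> J" for c v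
    using module_hom_smult[OF \<theta>] that by simp
  obtain j0 where j0: "j0 \<in> J" "\<theta> j0 \<noteq> \<zero>\<^bsub>K\<^esub>" using False by auto
  define b where "b = (inv\<^bsub>K\<^esub> \<theta> j0) \<odot>\<^bsub>V\<^esub> j0"
  have inv: "inv\<^bsub>K\<^esub> \<theta> j0 \<in> carrier K" "inv\<^bsub>K\<^esub> \<theta> j0 \<otimes>\<^bsub>K\<^esub> \<theta> j0 = \<one>\<^bsub>K\<^esub>"
    using j0 \<theta>c by (auto simp: V.field_Units)
  have b: "b \<in> J" "\<theta> b = \<one>\<^bsub>K\<^esub>"
    unfolding b_def using inv j0 JD(6) \<theta>smult by auto
  have e: "e j \<in> carrier V" and \<phi>: "\<phi> j \<in> lin_maps K V (scalar_space K)" and \<phi>0: "x \<in> J \<Longrightarrow> \<phi> j x = \<zero>\<^bsub>K\<^esub>"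
    if "j < n" for j x
    using ds that by (auto simp: dual_system_def)
  define r where "r v = v \<ominus>\<^bsub>V\<^esub> (\<Oplus>\<^bsub>V\<^esub>j\<in>{..<n}. \<phi> j v \<odot>\<^bsub>V\<^esub> e j)" for v
  have rJ: "r v \<in> J" if "v \<in> carrier V" for v
    using ds that by (auto simp: dual_system_def r_def)
  have r: "r \<in> module_hom K V V"
    unfolding r_def using e lin_maps_hom[OF \<phi>] by (intro coordinate_remainder_hom[OF V]) auto
  \<comment> \<open>On \<open>J\<close> all coordinates vanish, so \<open>r\<close> is a projection onto \<open>J\<close>.\<close>
  have rfix: "r v = v" if "v \<in> J" for v
  proof -
    have "(\<Oplus>\<^bsub>V\<^esub>j\<in>{..<n}. \<phi> j v \<odot>\<^bsub>V\<^esub> e j) = (\<Oplus>\<^bsub>V\<^esub>j\<in>{..<n}. \<zero>\<^bsub>V\<^esub>)"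
      using that e by (intro V.finsum_cong') (auto simp: \<phi>0)
    then show ?thesis using JD(3)[OF that] by (simp add: r_def a_minus_def)
  qed
  \<comment> \<open>The functional \<open>\<theta>\<close> is given on \<open>J\<close> only; composing it with the remainder extends it to \<open>V\<close>.\<close>
  define \<psi> where "\<psi> = (\<lambda>v\<in>carrier V. \<theta> (r v))"
  have \<psi>: "\<psi> \<in> lin_maps K V (scalar_space K)"
    unfolding \<psi>_def restrict_lin_maps_iff[OF V]
    by (rule module_homI) (simp_all add: rJ \<theta>c \<theta>add \<theta>smult module_hom_add[OF r] module_hom_smult[OF r])
  have "dual_system K V {v \<in> J. \<theta> v = \<zero>\<^bsub>K\<^esub>} (Suc n) (e(n := b)) (\<phi>(n := \<psi>))"
    unfolding dual_system_def
  proof (intro conjI allI impI ballI)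
    fix j x assume "j < Suc n" "x \<in> {v \<in> J. \<theta> v = \<zero>\<^bsub>K\<^esub>}"
    then show "(\<phi>(n := \<psi>)) j x = \<zero>\<^bsub>K\<^esub>"
      using \<phi>0 rfix JD(3) by (auto simp: \<psi>_def less_Suc_eq)
  next
    fix v assume v: "v \<in> carrier V"
    have \<phi>c: "\<phi> j v \<in> carrier K" if "j < n" for j
      using functional_closed[OF lin_maps_hom[OF \<phi>[OF that]] v] .
    have \<psi>c: "\<psi> v \<in> carrier K"
      using functional_closed[OF lin_maps_hom[OF \<psi>] v] .
    have bV: "b \<in> carrier V" using JD(3) b by blast
    let ?s = "\<Oplus>\<^bsub>V\<^esub>j\<in>{..<n}. \<phi> j v \<odot>\<^bsub>V\<^esub> e j"
    have s: "?s \<in> carrier V" using e \<phi>c by (intro V.finsum_closed) auto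
    have "(\<Oplus>\<^bsub>V\<^esub>j\<in>{..<Suc n}. (\<phi>(n := \<psi>)) j v \<odot>\<^bsub>V\<^esub> (e(n := b)) j)
        = \<psi> v \<odot>\<^bsub>V\<^esub> b \<oplus>\<^bsub>V\<^esub> (\<Oplus>\<^bsub>V\<^esub>j\<in>{..<n}. (\<phi>(n := \<psi>)) j v \<odot>\<^bsub>V\<^esub> (e(n := b)) j)"
      unfolding lessThan_Suc using e \<phi>c \<psi>c bV by (subst V.finsum_insert) auto
    also have "(\<Oplus>\<^bsub>V\<^esub>j\<in>{..<n}. (\<phi>(n := \<psi>)) j v \<odot>\<^bsub>V\<^esub> (e(n := b)) j) = ?s"
      using e \<phi>c by (intro V.finsum_cong') auto
    finally have "v \<ominus>\<^bsub>V\<^esub> (\<Oplus>\<^bsub>V\<^esub>j\<in>{..<Suc n}. (\<phi>(n := \<psi>)) j v \<odot>\<^bsub>V\<^esub> (e(n := b)) j)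
        = v \<ominus>\<^bsub>V\<^esub> (\<psi> v \<odot>\<^bsub>V\<^esub> b \<oplus>\<^bsub>V\<^esub> ?s)" by simp
    also have "\<dots> = r v \<oplus>\<^bsub>V\<^esub> (\<ominus>\<^bsub>K\<^esub> \<psi> v) \<odot>\<^bsub>V\<^esub> b"
      using v s \<psi>c bV by (simp add: r_def a_minus_def V.M.minus_add V.smult_l_minus V.M.a_ac)
    finally have eq: "v \<ominus>\<^bsub>V\<^esub> (\<Oplus>\<^bsub>V\<^esub>j\<in>{..<Suc n}. (\<phi>(n := \<psi>)) j v \<odot>\<^bsub>V\<^esub> (e(n := b)) j)
        = r v \<oplus>\<^bsub>V\<^esub> (\<ominus>\<^bsub>K\<^esub> \<psi> v) \<odot>\<^bsub>V\<^esub> b" .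
    have "\<psi> v = \<theta> (r v)" using v by (simp add: \<psi>_def)
    then have "\<theta> (r v \<oplus>\<^bsub>V\<^esub> (\<ominus>\<^bsub>K\<^esub> \<psi> v) \<odot>\<^bsub>V\<^esub> b) = \<zero>\<^bsub>K\<^esub>"
      using rJ[OF v] b \<psi>c JD(6) by (simp add: \<theta>add \<theta>smult V.R.r_neg)
    then show "v \<ominus>\<^bsub>V\<^esub> (\<Oplus>\<^bsub>V\<^esub>j\<in>{..<Suc n}. (\<phi>(n := \<psi>)) j v \<odot>\<^bsub>V\<^esub> (e(n := b)) j) \<in> {v \<in> J. \<theta> v = \<zero>\<^bsub>K\<^esub>}"
      unfolding eq using rJ[OF v] b \<psi>c JD(5,6) by simp
  qed (use e \<phi> \<psi> b JD(3) in \<open>auto simp: less_Suc_eq\<close>)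
  then show ?thesis by blast
qed

lemma kernels_subspace:
  assumes "vectorspace K V" "\<Phi> \<subseteq> module_hom K V (scalar_space K)"
  shows "subspace K {v \<in> carrier V. \<forall>\<phi>\<in>\<Phi>. \<phi> v = \<zero>\<^bsub>K\<^esub>} V"
proof -
  interpret vectorspace K V by fact
  have \<phi>: "\<phi> \<in> module_hom K V (scalar_space K)" if "\<phi> \<in> \<Phi>" for \<phi> using assms(2) that by blast
  have K: "field K" ..
  show ?thesis
  proof (rule subspaceI[OF assms(1)], goal_cases)
    case (3 x y)
    have "\<phi> (x \<oplus>\<^bsub>V\<^esub> y) = \<zero>\<^bsub>K\<^esub>" if "\<phi> \<in> \<Phi>" for \<phi>
    proof -
      have "x \<in> carrier V" "y \<in> carrier V" "\<phi> x = \<zero>\<^bsub>K\<^esub>" "\<phi> y = \<zero>\<^bsub>K\<^esub>" using 3 that by blast+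
      then show ?thesis using module_hom_add[OF \<phi>[OF that]] by simp
    qed
    moreover have "x \<oplus>\<^bsub>V\<^esub> y \<in> carrier V" using 3 by auto
    ultimately show ?case by blast
  next
    case (4 c x)
    have "\<phi> (c \<odot>\<^bsub>V\<^esub> x) = \<zero>\<^bsub>K\<^esub>" if "\<phi> \<in> \<Phi>" for \<phi>
    proof -
      have "x \<in> carrier V" "\<phi> x = \<zero>\<^bsub>K\<^esub>" using 4 that by blast+
      then show ?thesis using module_hom_smult[OF \<phi>[OF that]] 4(1) by simp
    qed
    moreover have "c \<odot>\<^bsub>V\<^esub> x \<in> carrier V" using 4 by auto
    ultimately show ?case by blast
  qed (use module_hom_zero[OF assms(1) vectorspace_scalar_space[OF K] \<phi>] in auto)
qed

lemma dual_system_trivial: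
  assumes "vectorspace K V"
  shows "\<exists>n e \<phi>. dual_system K V (carrier V) n e \<phi>"
proof -
  interpret vectorspace K V by fact
  have "dual_system K V (carrier V) 0 e \<phi>" for e \<phi> by (auto simp: dual_system_def)
  then show ?thesis by blast
qed

lemma dual_system_kernels:
  assumes V: "vectorspace K V" and "finite \<Phi>" "\<Phi> \<subseteq> module_hom K V (scalar_space K)"
  shows "\<exists>n e \<psi>. dual_system K V {v \<in> carrier V. \<forall>\<phi>\<in>\<Phi>. \<phi> v = \<zero>\<^bsub>K\<^esub>} n e \<psi>"
  using assms(2,3)
proof (induction \<Phi>)
  case empty
  show ?case using dual_system_trivial[OF V] by auto
next
  case (insert \<theta> \<Phi>)
  let ?J = "{v \<in> carrier V. \<forall>\<phi>\<in>\<Phi>. \<phi> v = \<zero>\<^bsub>K\<^esub>}"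
  have J: "subspace K ?J V" using insert.prems by (intro kernels_subspace[OF V]) auto
  have \<theta>: "\<theta> \<in> module_hom K V (scalar_space K)" using insert.prems by auto
  then have \<theta>J: "\<theta> \<in> module_hom K (V\<lparr>carrier := ?J\<rparr>) (scalar_space K)"
    by (intro module_homI)
      (auto simp: module_hom_add[OF \<theta>] module_hom_smult[OF \<theta>] functional_closed[OF \<theta>])
  obtain n e \<psi> where "dual_system K V ?J n e \<psi>"
    using insert.IH insert.prems by blast
  note dual_system_kernel_step[OF J \<theta>J this]
  moreover have "{v \<in> ?J. \<theta> v = \<zero>\<^bsub>K\<^esub>} = {v \<in> carrier V. \<forall>\<phi>\<in>insert \<theta> \<Phi>. \<phi> v = \<zero>\<^bsub>K\<^esub>}" by auto
  ultimately show ?case by simp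
qed

text \<open>
  A vector space generated by finitely many vectors modulo \<open>W\<close> has a dual system for \<open>W\<close>. Add one
  generator \<open>s\<close> to \<open>W\<close> and apply the induction hypothesis to \<open>W + K s\<close>; if \<open>s\<close> is not in \<open>W\<close>, then
  \<open>W\<close> is the kernel of the functional that reads off the coefficient of \<open>s\<close>.
\<close>

lemma dual_system_generators:
  assumes "finite S" "S \<subseteq> carrier V" "subspace K W V"
    and "\<And>J. subspace K J V \<Longrightarrow> W \<subseteq> J \<Longrightarrow> S \<subseteq> J \<Longrightarrow> carrier V \<subseteq> J"
  shows "\<exists>n e \<phi>. dual_system K V W n e \<phi>"
  using assms
proof (induction S arbitrary: W)
  case empty
  then have "W = carrier V" using subspaceD(2)[OF empty(2)] by auto
  then show ?case using dual_system_trivial[OF subspaceD(1)[OF empty(2)]] by auto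
next
  case (insert s S)
  note W = insert.prems(2) and gen = insert.prems(3)
  note WD = subspaceD[OF W]
  have V: "vectorspace K V" using WD(1) .
  interpret V: vectorspace K V by (rule V)
  have s: "s \<in> carrier V" using insert.prems(1) by auto
  show ?case
  proof (cases "s \<in> W")
    case True
    show ?thesis
      using insert.prems True by (intro insert.IH[OF _ W] gen) auto
  next
    case False
    let ?J = "{w \<oplus>\<^bsub>V\<^esub> c \<odot>\<^bsub>V\<^esub> s | w c. w \<in> W \<and> c \<in> carrier K}"
    have addJ: "(w \<oplus>\<^bsub>V\<^esub> c \<odot>\<^bsub>V\<^esub> s) \<oplus>\<^bsub>V\<^esub> (w' \<oplus>\<^bsub>V\<^esub> c' \<odot>\<^bsub>V\<^esub> s) = (w \<oplus>\<^bsub>V\<^esub> w') \<oplus>\<^bsub>V\<^esub> (c \<oplus>\<^bsub>K\<^esub> c') \<odot>\<^bsub>V\<^esub> s"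
      if "w \<in> W" "w' \<in> W" "c \<in> carrier K" "c' \<in> carrier K" for w w' c c'
      using that WD(3) s by (simp add: V.smult_l_distr V.M.a_ac)
    have smultJ: "a \<odot>\<^bsub>V\<^esub> (w \<oplus>\<^bsub>V\<^esub> c \<odot>\<^bsub>V\<^esub> s) = a \<odot>\<^bsub>V\<^esub> w \<oplus>\<^bsub>V\<^esub> (a \<otimes>\<^bsub>K\<^esub> c) \<odot>\<^bsub>V\<^esub> s"
      if "w \<in> W" "a \<in> carrier K" "c \<in> carrier K" for w a c
      using that WD(3) s by (simp add: V.smult_r_distr V.smult_assoc1)
    have J: "subspace K ?J V"
    proof (rule subspaceI[OF V])
      show "\<zero>\<^bsub>V\<^esub> \<in> ?J" using WD(4) s by (auto intro!: exI[of _ "\<zero>\<^bsub>V\<^esub>"] exI[of _ "\<zero>\<^bsub>K\<^esub>"])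
    next
      fix x y assume "x \<in> ?J" "y \<in> ?J"
      then show "x \<oplus>\<^bsub>V\<^esub> y \<in> ?J" using addJ WD(5) V.R.a_closed by blast
    next
      fix a x assume "a \<in> carrier K" "x \<in> ?J"
      then show "a \<odot>\<^bsub>V\<^esub> x \<in> ?J" using smultJ WD(6) V.R.m_closed by blast
    qed (use WD(3) s in auto)
    have uniq: "c = c'" if "w \<in> W" "w' \<in> W" "c \<in> carrier K" "c' \<in> carrier K"
      and eq: "w \<oplus>\<^bsub>V\<^esub> c \<odot>\<^bsub>V\<^esub> s = w' \<oplus>\<^bsub>V\<^esub> c' \<odot>\<^bsub>V\<^esub> s" for w w' c c'
    proof (rule ccontr)
      assume "c \<noteq> c'"
      define a where "a = c' \<ominus>\<^bsub>K\<^esub> c"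
      have a: "a \<in> carrier K" "a \<noteq> \<zero>\<^bsub>K\<^esub>" using that \<open>c \<noteq> c'\<close> by (auto simp: a_def)
      have wV: "w \<in> carrier V" "w' \<in> carrier V" using that WD(3) by auto
      have "a \<odot>\<^bsub>V\<^esub> s = c' \<odot>\<^bsub>V\<^esub> s \<ominus>\<^bsub>V\<^esub> c \<odot>\<^bsub>V\<^esub> s"
        using that s by (simp add: a_def a_minus_def V.smult_l_distr V.smult_l_minus)
      also have "c' \<odot>\<^bsub>V\<^esub> s = \<ominus>\<^bsub>V\<^esub> w' \<oplus>\<^bsub>V\<^esub> (w \<oplus>\<^bsub>V\<^esub> c \<odot>\<^bsub>V\<^esub> s)"
        unfolding eq using that(1-4) s wV by (simp add: V.M.r_neg1)
      also have "\<dots> \<ominus>\<^bsub>V\<^esub> c \<odot>\<^bsub>V\<^esub> s = \<ominus>\<^bsub>V\<^esub> w' \<oplus>\<^bsub>V\<^esub> w"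
        using that(1-4) s wV by (simp add: a_minus_def V.M.a_assoc V.M.r_neg)
      also have "\<dots> = w \<ominus>\<^bsub>V\<^esub> w'" using wV by (simp add: a_minus_def V.M.a_comm)
      finally have "a \<odot>\<^bsub>V\<^esub> s \<in> W" using subspace_minus[OF W] that by simp
      then have "inv\<^bsub>K\<^esub> a \<odot>\<^bsub>V\<^esub> (a \<odot>\<^bsub>V\<^esub> s) \<in> W" using WD(6) a by simp
      moreover have "inv\<^bsub>K\<^esub> a \<odot>\<^bsub>V\<^esub> (a \<odot>\<^bsub>V\<^esub> s) = s"
        using a s V.smult_assoc1[of "inv\<^bsub>K\<^esub> a" a s] by (simp add: V.field_Units)
      ultimately show False using False by simp
    qed
    define \<theta> where "\<theta> v = (THE c. c \<in> carrier K \<and> (\<exists>w\<in>W. v = w \<oplus>\<^bsub>V\<^esub> c \<odot>\<^bsub>V\<^esub> s))" for v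
    have \<theta>eq: "\<theta> (w \<oplus>\<^bsub>V\<^esub> c \<odot>\<^bsub>V\<^esub> s) = c" if "w \<in> W" "c \<in> carrier K" for w c
      unfolding \<theta>_def using that uniq by (intro the_equality) blast+
    have \<theta>: "\<theta> \<in> module_hom K (V\<lparr>carrier := ?J\<rparr>) (scalar_space K)"
    proof (rule module_homI)
      fix x y assume "x \<in> carrier (V\<lparr>carrier := ?J\<rparr>)" "y \<in> carrier (V\<lparr>carrier := ?J\<rparr>)"
      then obtain w c w' c' where xy: "w \<in> W" "c \<in> carrier K" "x = w \<oplus>\<^bsub>V\<^esub> c \<odot>\<^bsub>V\<^esub> s"
        "w' \<in> W" "c' \<in> carrier K" "y = w' \<oplus>\<^bsub>V\<^esub> c' \<odot>\<^bsub>V\<^esub> s" by auto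
      then show "\<theta> (x \<oplus>\<^bsub>V\<lparr>carrier := ?J\<rparr>\<^esub> y) = \<theta> x \<oplus>\<^bsub>scalar_space K\<^esub> \<theta> y"
        using addJ \<theta>eq WD(5) by simp
    next
      fix a x assume "a \<in> carrier K" "x \<in> carrier (V\<lparr>carrier := ?J\<rparr>)"
      then show "\<theta> (a \<odot>\<^bsub>V\<lparr>carrier := ?J\<rparr>\<^esub> x) = a \<odot>\<^bsub>scalar_space K\<^esub> \<theta> x"
        using smultJ \<theta>eq WD(6) by auto
    qed (auto simp: \<theta>eq)
    have "{v \<in> ?J. \<theta> v = \<zero>\<^bsub>K\<^esub>} = W"
    proof (intro equalityI subsetI)
      fix v assume "v \<in> W"
      moreover have "v = v \<oplus>\<^bsub>V\<^esub> \<zero>\<^bsub>K\<^esub> \<odot>\<^bsub>V\<^esub> s" using \<open>v \<in> W\<close> WD(3) s by simp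
      ultimately show "v \<in> {v \<in> ?J. \<theta> v = \<zero>\<^bsub>K\<^esub>}"
        using \<theta>eq[of v "\<zero>\<^bsub>K\<^esub>"] by auto
    qed (use \<theta>eq WD(3) s in auto)
    moreover have "\<exists>n e \<phi>. dual_system K V ?J n e \<phi>"
    proof (rule insert.IH[OF _ J])
      fix J' assume J': "subspace K J' V" "?J \<subseteq> J'" "S \<subseteq> J'"
      have "w \<in> ?J" if "w \<in> W" for w
        using that WD(3) s by (auto intro!: exI[of _ w] exI[of _ "\<zero>\<^bsub>K\<^esub>"])
      moreover have "s \<in> ?J"
        using WD(4) s by (auto intro!: exI[of _ "\<zero>\<^bsub>V\<^esub>"] exI[of _ "\<one>\<^bsub>K\<^esub>"])
      ultimately show "carrier V \<subseteq> J'" using J' by (intro gen) auto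
    qed (use insert.prems in auto)
    then obtain n e \<phi> where "dual_system K V ?J n e \<phi>" by blast
    note dual_system_kernel_step[OF J \<theta> this]
    ultimately show ?thesis by simp
  qed
qed

lemma fin_dim_coordinates:
  assumes "vectorspace K V" "vectorspace.fin_dim K V"
  shows "\<exists>n e \<phi>. dual_system K V {\<zero>\<^bsub>V\<^esub>} n e \<phi>"
proof -
  interpret vectorspace K V by fact
  have "subspace K {\<zero>\<^bsub>V\<^esub>} V" by (rule subspaceI[OF assms(1)]) auto
  then show ?thesis
    using assms fin_dim_iff[OF assms(1)] dual_system_generators[of _ V K "{\<zero>\<^bsub>V\<^esub>}"] by metis
qed

lemma finite_codim_iff_dual_system:
  assumes W: "subspace K W V"
  shows "finite_codim K V W \<longleftrightarrow> (\<exists>n e \<phi>. dual_system K V W n e \<phi>)"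
proof
  note WD = subspaceD[OF W]
  have V: "vectorspace K V" using WD(1) .
  interpret V: vectorspace K V by (rule V)
  let ?Q = "quot_space V W" and ?q = "a_r_coset V W"
  have Q: "vectorspace K ?Q" by (rule vectorspace_quot_space[OF W])
  note q = coset_hom[OF W]
  {
    assume "finite_codim K V W"
    then obtain C where C: "finite C" "C \<subseteq> carrier ?Q"
      and gen: "\<And>J. subspace K J ?Q \<Longrightarrow> C \<subseteq> J \<Longrightarrow> carrier ?Q \<subseteq> J"
      unfolding finite_codim_def fin_dim_iff[OF Q] by blast
    obtain S where S: "S \<subseteq> carrier V" "finite S" "C = ?q ` S"
      using C finite_subset_image[of C ?q "carrier V"] by (auto simp: quot_space_simps)
    show "\<exists>n e \<phi>. dual_system K V W n e \<phi>"
    proof (rule dual_system_generators[OF S(2,1) W])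
      fix J assume J: "subspace K J V" "W \<subseteq> J" "S \<subseteq> J"
      note JD = subspaceD[OF J(1)]
      have "subspace K (?q ` J) ?Q"
      proof (rule subspaceI[OF Q])
        show "\<zero>\<^bsub>?Q\<^esub> \<in> ?q ` J" using JD(4) quot_space_zero[OF W] by blast
      next
        fix x y assume "x \<in> ?q ` J" "y \<in> ?q ` J"
        then show "x \<oplus>\<^bsub>?Q\<^esub> y \<in> ?q ` J" using JD(3,5) by (auto simp: quot_space_add[OF W])
      next
        fix c x assume "c \<in> carrier K" "x \<in> ?q ` J"
        then show "c \<odot>\<^bsub>?Q\<^esub> x \<in> ?q ` J" using JD(3,6) by (auto simp: quot_space_smult[OF W])
      qed (use JD(3) in \<open>auto simp: quot_space_simps\<close>)
      then have sub: "carrier ?Q \<subseteq> ?q ` J" using S(3) J(3) by (intro gen) auto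
      show "carrier V \<subseteq> J"
      proof
        fix v assume v: "v \<in> carrier V"
        then obtain j where j: "j \<in> J" "?q v = ?q j" using sub by (auto simp: quot_space_simps)
        then have "v \<ominus>\<^bsub>V\<^esub> j \<in> J" using coset_eq_iff[OF W v] JD(3) J(2) by auto
        then have "(v \<ominus>\<^bsub>V\<^esub> j) \<oplus>\<^bsub>V\<^esub> j \<in> J" using JD(5) j by blast
        then show "v \<in> J" using v j JD(3) by (simp add: a_minus_def V.M.a_assoc V.M.l_neg)
      qed
    qed
  next
    assume "\<exists>n e \<phi>. dual_system K V W n e \<phi>"
    then obtain n e \<phi> where ds: "dual_system K V W n e \<phi>" by blast
    have e: "e j \<in> carrier V" and \<phi>: "\<phi> j \<in> lin_maps K V (scalar_space K)" if "j < n" for j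
      using ds that by (auto simp: dual_system_def)
    have r: "v \<ominus>\<^bsub>V\<^esub> (\<Oplus>\<^bsub>V\<^esub>j\<in>{..<n}. \<phi> j v \<odot>\<^bsub>V\<^esub> e j) \<in> W" if "v \<in> carrier V" for v
      using ds that by (auto simp: dual_system_def)
    show "finite_codim K V W"
      unfolding finite_codim_def fin_dim_iff[OF Q]
    proof (intro exI[of _ "?q ` e ` {..<n}"] conjI allI impI subsetI)
      fix J X assume J: "subspace K J ?Q" "?q ` e ` {..<n} \<subseteq> J" and X: "X \<in> carrier ?Q"
      obtain v where v: "v \<in> carrier V" "X = ?q v" using X by (auto simp: quot_space_simps)
      have \<phi>c: "\<phi> j v \<in> carrier K" if "j < n" for j
        using functional_closed[OF lin_maps_hom[OF \<phi>[OF that]] v(1)] .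
      let ?s = "\<Oplus>\<^bsub>V\<^esub>j\<in>{..<n}. \<phi> j v \<odot>\<^bsub>V\<^esub> e j"
      have qe: "?q (e j) \<in> J" if "j < n" for j using J(2) that by auto
      have "?s \<in> carrier V" using e \<phi>c by (intro V.finsum_closed) auto
      then have "X = ?q ?s" using coset_eq_iff[OF W v(1)] r[OF v(1)] v(2) by simp
      also have "?q ?s = (\<Oplus>\<^bsub>?Q\<^esub>j\<in>{..<n}. ?q (\<phi> j v \<odot>\<^bsub>V\<^esub> e j))"
        using e \<phi>c by (intro module_hom_finsum[OF V Q q]) auto
      also have "\<dots> \<in> J"
        using qe e \<phi>c J subspaceD(6)[OF J(1)]
        by (intro subspace_finsum[OF J(1)]) (auto simp: quot_space_smult[OF W, symmetric])
      finally show "X \<in> J" .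
    qed (use e in \<open>auto simp: quot_space_simps\<close>)
  }
qed

text \<open>
  A vector whose coordinates vanish equals its remainder, which lies in \<open>W\<close>.
\<close>

lemma dual_system_imp_kernels:
  assumes W: "subspace K W V" and ds: "dual_system K V W n e \<phi>"
  shows "W = {v \<in> carrier V. \<forall>\<psi>\<in>\<phi> ` {..<n}. \<psi> v = \<zero>\<^bsub>K\<^esub>}"
proof (intro equalityI subsetI)
  interpret vectorspace K V using subspaceD(1)[OF W] .
  fix v assume v: "v \<in> {v \<in> carrier V. \<forall>\<psi>\<in>\<phi> ` {..<n}. \<psi> v = \<zero>\<^bsub>K\<^esub>}"
  have "(\<Oplus>\<^bsub>V\<^esub>j\<in>{..<n}. \<phi> j v \<odot>\<^bsub>V\<^esub> e j) = (\<Oplus>\<^bsub>V\<^esub>j\<in>{..<n}. \<zero>\<^bsub>V\<^esub>)"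
    using v ds by (intro M.finsum_cong') (auto simp: dual_system_def)
  then have "(\<Oplus>\<^bsub>V\<^esub>j\<in>{..<n}. \<phi> j v \<odot>\<^bsub>V\<^esub> e j) = \<zero>\<^bsub>V\<^esub>" by simp
  moreover have "v \<ominus>\<^bsub>V\<^esub> (\<Oplus>\<^bsub>V\<^esub>j\<in>{..<n}. \<phi> j v \<odot>\<^bsub>V\<^esub> e j) \<in> W"
    using v ds by (auto simp: dual_system_def)
  moreover have "\<ominus>\<^bsub>V\<^esub> \<zero>\<^bsub>V\<^esub> = \<zero>\<^bsub>V\<^esub>"
    using M.minus_equality[of "\<zero>\<^bsub>V\<^esub>" "\<zero>\<^bsub>V\<^esub>"] by simp
  ultimately show "v \<in> W" using v by (simp add: a_minus_def)
qed (use ds subspaceD(3)[OF W] in \<open>auto simp: dual_system_def\<close>)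

lemma finite_codim_kernels:
  assumes "vectorspace K V" "finite \<Phi>" "\<Phi> \<subseteq> module_hom K V (scalar_space K)"
  shows "finite_codim K V {v \<in> carrier V. \<forall>\<phi>\<in>\<Phi>. \<phi> v = \<zero>\<^bsub>K\<^esub>}"
  using finite_codim_iff_dual_system[OF kernels_subspace[OF assms(1,3)]] dual_system_kernels[OF assms]
  by simp

text \<open>
  Both subspaces are finite intersections of kernels, hence so is their intersection.
\<close>

lemma finite_codim_Int:
  assumes W: "subspace K W V" "finite_codim K V W" and W': "subspace K W' V" "finite_codim K V W'"
  shows "finite_codim K V (W \<inter> W')"
proof -
  have V: "vectorspace K V" using subspaceD(1)[OF W(1)] .
  obtain n e \<phi> where ds: "dual_system K V W n e \<phi>"
    using W(2) finite_codim_iff_dual_system[OF W(1)] by auto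
  obtain n' e' \<phi>' where ds': "dual_system K V W' n' e' \<phi>'"
    using W'(2) finite_codim_iff_dual_system[OF W'(1)] by auto
  let ?\<Phi> = "\<phi> ` {..<n} \<union> \<phi>' ` {..<n'}"
  have "W \<inter> W' = {v \<in> carrier V. \<forall>\<psi>\<in>?\<Phi>. \<psi> v = \<zero>\<^bsub>K\<^esub>}"
    unfolding dual_system_imp_kernels[OF W(1) ds] dual_system_imp_kernels[OF W'(1) ds'] by auto
  moreover have "?\<Phi> \<subseteq> module_hom K V (scalar_space K)"
    using ds ds' by (auto simp: dual_system_def intro!: lin_maps_hom)
  ultimately show ?thesis using finite_codim_kernels[OF V, of ?\<Phi>] by simp
qed

section \<open>The finite dual\<close>

lemma finite_dual_simps:
  assumes "field K"
  shows "carrier (finite_dual K A) = {f \<in> lin_maps K A (scalar_space K).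
          \<exists>I. two_sided_ideal K A I \<and> finite_codim K A I \<and> I \<subseteq> {a \<in> carrier A. f a = \<zero>\<^bsub>K\<^esub>}}"
    and "zero (finite_dual K A) = (\<lambda>a\<in>carrier A. \<zero>\<^bsub>K\<^esub>)"
    and "f \<oplus>\<^bsub>finite_dual K A\<^esub> g = (\<lambda>a\<in>carrier A. f a \<oplus>\<^bsub>K\<^esub> g a)"
    and "c \<odot>\<^bsub>finite_dual K A\<^esub> f = (\<lambda>a\<in>carrier A. c \<otimes>\<^bsub>K\<^esub> f a)"
proof -
  interpret field K by fact
  show "carrier (finite_dual K A) = {f \<in> lin_maps K A (scalar_space K).
          \<exists>I. two_sided_ideal K A I \<and> finite_codim K A I \<and> I \<subseteq> {a \<in> carrier A. f a = \<zero>\<^bsub>K\<^esub>}}"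
    "zero (finite_dual K A) = (\<lambda>a\<in>carrier A. \<zero>\<^bsub>K\<^esub>)"
    "f \<oplus>\<^bsub>finite_dual K A\<^esub> g = (\<lambda>a\<in>carrier A. f a \<oplus>\<^bsub>K\<^esub> g a)"
    "c \<odot>\<^bsub>finite_dual K A\<^esub> f = (\<lambda>a\<in>carrier A. c \<otimes>\<^bsub>K\<^esub> f a)"
    by (simp_all add: finite_dual_def func_space_def)
qed

context nonunital_algebra
begin

abbreviation "D \<equiv> finite_dual K A"

lemma K_field: "field K" ..

lemma A_vs: "vectorspace K A" ..

lemma S_vs: "vectorspace K (scalar_space K)"
  by (rule vectorspace_scalar_space[OF K_field])

lemmas D_simps = finite_dual_simps[OF K_field, of A]

lemma finite_dual_lin: "f \<in> carrier D \<Longrightarrow> f \<in> lin_maps K A (scalar_space K)"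
  by (simp add: D_simps)

lemma finite_dual_hom: "f \<in> carrier D \<Longrightarrow> f \<in> module_hom K A (scalar_space K)"
  by (rule lin_maps_hom[OF finite_dual_lin])

lemma finite_dual_closed [simp]: "f \<in> carrier D \<Longrightarrow> a \<in> carrier A \<Longrightarrow> f a \<in> carrier K"
  by (rule functional_closed[OF finite_dual_hom])

lemma finite_dualI:
  assumes "f \<in> lin_maps K A (scalar_space K)" "two_sided_ideal K A I" "finite_codim K A I"
    and "\<And>a. a \<in> I \<Longrightarrow> f a = \<zero>\<^bsub>K\<^esub>"
  shows "f \<in> carrier D"
proof -
  have "I \<subseteq> carrier A" using assms(2) subspaceD(2) by (auto simp: two_sided_ideal_def)
  then show ?thesis using assms by (auto simp: D_simps)
qed

lemma finite_dual_ideal: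
  assumes "f \<in> carrier D"
  obtains I where "two_sided_ideal K A I" "finite_codim K A I" "\<And>a. a \<in> I \<Longrightarrow> f a = \<zero>\<^bsub>K\<^esub>"
  using assms by (auto simp: D_simps)

lemma two_sided_idealD:
  assumes "two_sided_ideal K A I"
  shows "subspace K I A" "\<And>a x. a \<in> carrier A \<Longrightarrow> x \<in> I \<Longrightarrow> a \<otimes>\<^bsub>A\<^esub> x \<in> I"
    "\<And>a x. a \<in> carrier A \<Longrightarrow> x \<in> I \<Longrightarrow> x \<otimes>\<^bsub>A\<^esub> a \<in> I"
  using assms by (auto simp: two_sided_ideal_def)

text \<open>
  The sum of two functionals vanishes on the intersection of the two ideals, which is an ideal of
  finite codimension again.
\<close>

lemma finite_dual_vs: "vectorspace K D"
proof -
  let ?P = "func_space (carrier A)"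
  have P: "vectorspace K ?P" by (rule vectorspace_func_space[OF K_field])
  have ops: "zero ?P = zero D" "add ?P = add D" "smult ?P = smult D"
    by (simp_all add: finite_dual_def)
  have "subspace K (carrier D) ?P"
  proof (rule subspaceI[OF P], unfold ops)
    show "carrier D \<subseteq> carrier ?P"
    proof
      fix f assume f: "f \<in> carrier D"
      then show "f \<in> carrier ?P"
        using lin_maps_extensional[OF finite_dual_lin[OF f]] by (auto simp: func_space_def PiE_def)
    qed
  next
    have "two_sided_ideal K A (carrier A)"
      unfolding two_sided_ideal_def using alg_mult_closed by (auto intro!: subspaceI[OF A_vs])
    moreover have "finite_codim K A (carrier A)"
      using finite_codim_kernels[OF A_vs, of "{}"] by simp
    moreover have "zero D \<in> lin_maps K A (scalar_space K)"
      unfolding D_simps restrict_lin_maps_iff[OF A_vs] by (intro module_homI) auto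
    ultimately show "zero D \<in> carrier D" by (intro finite_dualI[of _ "carrier A"]) (auto simp: D_simps)
  next
    fix f g assume f: "f \<in> carrier D" and g: "g \<in> carrier D"
    obtain I where I: "two_sided_ideal K A I" "finite_codim K A I" "\<And>a. a \<in> I \<Longrightarrow> f a = \<zero>\<^bsub>K\<^esub>"
      using finite_dual_ideal[OF f] by blast
    obtain J where J: "two_sided_ideal K A J" "finite_codim K A J" "\<And>a. a \<in> J \<Longrightarrow> g a = \<zero>\<^bsub>K\<^esub>"
      using finite_dual_ideal[OF g] by blast
    note ID = two_sided_idealD[OF I(1)] and JD = two_sided_idealD[OF J(1)]
    have "subspace K (I \<inter> J) A"
      using subspaceD[OF ID(1)] subspaceD[OF JD(1)] by (intro subspaceI[OF A_vs]) auto
    then have "two_sided_ideal K A (I \<inter> J)"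
      using ID JD by (auto simp: two_sided_ideal_def)
    moreover have "finite_codim K A (I \<inter> J)"
      by (rule finite_codim_Int[OF ID(1) I(2) JD(1) J(2)])
    moreover have "f \<oplus>\<^bsub>D\<^esub> g \<in> lin_maps K A (scalar_space K)"
      unfolding D_simps restrict_lin_maps_iff[OF A_vs] using f g
      by (intro module_homI)
        (auto simp: module_hom_add[OF finite_dual_hom] module_hom_smult[OF finite_dual_hom] R.a_ac r_distr)
    ultimately show "f \<oplus>\<^bsub>D\<^esub> g \<in> carrier D"
      using subspaceD(3)[OF ID(1)] I(3) J(3) by (intro finite_dualI[of _ "I \<inter> J"]) (auto simp: D_simps)
  next
    fix c f assume c: "c \<in> carrier K" and f: "f \<in> carrier D"
    obtain I where I: "two_sided_ideal K A I" "finite_codim K A I" "\<And>a. a \<in> I \<Longrightarrow> f a = \<zero>\<^bsub>K\<^esub>"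
      using finite_dual_ideal[OF f] by blast
    have "c \<odot>\<^bsub>D\<^esub> f \<in> lin_maps K A (scalar_space K)"
      unfolding D_simps restrict_lin_maps_iff[OF A_vs] using c f
      by (intro module_homI)
        (auto simp: module_hom_add[OF finite_dual_hom] module_hom_smult[OF finite_dual_hom] r_distr R.m_lcomm)
    then show "c \<odot>\<^bsub>D\<^esub> f \<in> carrier D"
      using subspaceD(3)[OF two_sided_idealD(1)[OF I(1)]] I(3) c
      by (intro finite_dualI[OF _ I(1,2)]) (auto simp: D_simps)
  qed
  then have "vectorspace K (?P\<lparr>carrier := carrier D\<rparr>)"
    by (rule vectorspace.subspace_is_vs[OF P])
  moreover have "?P\<lparr>carrier := carrier D\<rparr> = D" by (simp add: finite_dual_def)
  ultimately show ?thesis by simp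
qed

sublocale D: vectorspace K D
  by (rule finite_dual_vs)

lemma eval_hom: "a \<in> carrier A \<Longrightarrow> (\<lambda>f. f a) \<in> module_hom K D (scalar_space K)"
  by (rule module_homI) (auto simp: D_simps(3,4))

lemma finite_dual_zeroI:
  assumes "f \<in> carrier D" "\<And>a. a \<in> carrier A \<Longrightarrow> f a = \<zero>\<^bsub>K\<^esub>"
  shows "f = \<zero>\<^bsub>D\<^esub>"
  using assms lin_maps_extensional[OF finite_dual_lin[OF assms(1)]]
  by (auto simp: D_simps(2) fun_eq_iff extensional_def)

lemma tensor_product_dual: "vectorspace K M \<Longrightarrow> tensor_product K M D"
  by (simp add: tensor_product_def finite_dual_vs)

lemma tensor_dual_eqI:
  assumes M: "vectorspace K M" and "s \<in> carrier (tensor_space K M D)" "t \<in> carrier (tensor_space K M D)"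
    and "\<And>a. a \<in> carrier A \<Longrightarrow> contract K M D (\<lambda>f. f a) s = contract K M D (\<lambda>f. f a) t"
  shows "s = t"
proof -
  interpret tensor_product K M D by (rule tensor_product_dual[OF M])
  show ?thesis
  proof (rule tensor_eqI[of "(\<lambda>a f. f a) ` carrier A"])
    fix f assume "f \<in> carrier D" "\<And>\<phi>. \<phi> \<in> (\<lambda>a f. f a) ` carrier A \<Longrightarrow> \<phi> f = \<zero>\<^bsub>K\<^esub>"
    then show "f = \<zero>\<^bsub>D\<^esub>" by (intro finite_dual_zeroI) blast+
  qed (use assms eval_hom in auto)
qed

abbreviation "DD \<equiv> tensor_space K D D"

sublocale DD: tensor_product K D D
  by (rule tensor_product_dual[OF finite_dual_vs])

text \<open>
  The functional \<open>g \<otimes> h \<mapsto> g(a) h(b)\<close>. Written as a contraction of the right factor followed by an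
  evaluation of the left one, it inherits separation of points from two applications of the
  criterion for a single tensor product.
\<close>

definition eval2 :: "'c \<Rightarrow> 'c \<Rightarrow> (('c \<Rightarrow> 'a) \<times> ('c \<Rightarrow> 'a) \<Rightarrow> 'a) set \<Rightarrow> 'a" where
  "eval2 a b t = contract K D D (\<lambda>f. f b) t a"

lemma eval2_hom:
  assumes "a \<in> carrier A" "b \<in> carrier A"
  shows "eval2 a b \<in> module_hom K DD (scalar_space K)"
  unfolding eval2_def
  by (rule module_hom_comp[OF DD.contract_hom[OF eval_hom] eval_hom]) fact+

lemma eval2_pure:
  assumes "a \<in> carrier A" "b \<in> carrier A" "g \<in> carrier D" "h \<in> carrier D"
  shows "eval2 a b (pure_tensor K D D g h) = g a \<otimes>\<^bsub>K\<^esub> h b"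
  unfolding eval2_def using assms
  by (simp add: DD.contract_pure[OF eval_hom] D_simps(4) R.m_comm)

lemma eval2_separates:
  assumes t: "t \<in> carrier DD" and "\<And>a b. a \<in> carrier A \<Longrightarrow> b \<in> carrier A \<Longrightarrow> eval2 a b t = \<zero>\<^bsub>K\<^esub>"
  shows "t = \<zero>\<^bsub>DD\<^esub>"
proof (rule tensor_dual_eqI[OF finite_dual_vs t])
  fix b assume b: "b \<in> carrier A"
  have "contract K D D (\<lambda>f. f b) t = \<zero>\<^bsub>D\<^esub>"
    using assms b module_hom_mem[OF DD.contract_hom[OF eval_hom[OF b]] t]
    by (intro finite_dual_zeroI) (auto simp: eval2_def)
  also have "\<dots> = contract K D D (\<lambda>f. f b) \<zero>\<^bsub>DD\<^esub>"
    using module_hom_zero[OF DD.T_vs finite_dual_vs DD.contract_hom[OF eval_hom[OF b]]] by simp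
  finally show "contract K D D (\<lambda>f. f b) t = contract K D D (\<lambda>f. f b) \<zero>\<^bsub>DD\<^esub>" .
qed auto

lemma eval2_eqI:
  assumes s: "s \<in> carrier DD" and t: "t \<in> carrier DD"
    and eq: "\<And>a b. a \<in> carrier A \<Longrightarrow> b \<in> carrier A \<Longrightarrow> eval2 a b s = eval2 a b t"
  shows "s = t"
proof -
  have "s \<ominus>\<^bsub>DD\<^esub> t = \<zero>\<^bsub>DD\<^esub>"
  proof (rule eval2_separates)
    fix a b assume ab: "a \<in> carrier A" "b \<in> carrier A"
    have "eval2 a b t \<in> carrier K" using functional_closed[OF eval2_hom[OF ab] t] .
    then show "eval2 a b (s \<ominus>\<^bsub>DD\<^esub> t) = \<zero>\<^bsub>K\<^esub>"
      using module_hom_minus[OF DD.T_vs S_vs eval2_hom[OF ab] s t] eq[OF ab] K_field by simp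
  qed (use s t in auto)
  then show ?thesis using s t by simp
qed

text \<open>
  Let \<open>f\<close> vanish on the ideal \<open>I\<close> and expand \<open>a\<close> modulo \<open>I\<close> as \<open>\<Sum> \<phi>\<^sub>j(a) e\<^sub>j\<close>. Since \<open>I\<close> is a
  right ideal, \<open>f(ab) = \<Sum> \<phi>\<^sub>j(a) f(e\<^sub>j b)\<close>; since it is a left ideal, the functionals
  \<open>b \<mapsto> f(e\<^sub>j b)\<close> vanish on \<open>I\<close>, too.
\<close>

lemma comult_decomposition:
  assumes f: "f \<in> carrier D"
  obtains n :: nat and g h where "\<And>j. j < n \<Longrightarrow> g j \<in> carrier D" "\<And>j. j < n \<Longrightarrow> h j \<in> carrier D"
    "\<And>a b. a \<in> carrier A \<Longrightarrow> b \<in> carrier A \<Longrightarrow>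
      f (a \<otimes>\<^bsub>A\<^esub> b) = (\<Oplus>\<^bsub>K\<^esub>j\<in>{..<n}. g j a \<otimes>\<^bsub>K\<^esub> h j b)"
proof -
  obtain I where I: "two_sided_ideal K A I" "finite_codim K A I" and f0: "\<And>a. a \<in> I \<Longrightarrow> f a = \<zero>\<^bsub>K\<^esub>"
    using finite_dual_ideal[OF f] by blast
  note ID = two_sided_idealD[OF I(1)]
  obtain n e \<phi> where ds: "dual_system K A I n e \<phi>"
    using I(2) finite_codim_iff_dual_system[OF ID(1)] by blast
  have e: "e j \<in> carrier A" and \<phi>: "\<phi> j \<in> lin_maps K A (scalar_space K)"
    and \<phi>0: "\<And>x. x \<in> I \<Longrightarrow> \<phi> j x = \<zero>\<^bsub>K\<^esub>" if "j < n" for j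
    using ds that by (auto simp: dual_system_def)
  note fhom = finite_dual_hom[OF f]
  define h where "h j = (\<lambda>b\<in>carrier A. f (e j \<otimes>\<^bsub>A\<^esub> b))" for j
  have "\<phi> j \<in> carrier D" if "j < n" for j
    using \<phi> \<phi>0 that by (intro finite_dualI[OF _ I]) auto
  moreover have "h j \<in> carrier D" if j: "j < n" for j
  proof (rule finite_dualI[OF _ I])
    show "h j \<in> lin_maps K A (scalar_space K)"
      unfolding h_def restrict_lin_maps_iff[OF A_vs] using e[OF j] f
      by (intro module_homI)
        (auto simp: alg_mult_closed alg_distrib_left alg_smult_right module_hom_add[OF fhom]
          module_hom_smult[OF fhom])
    show "h j x = \<zero>\<^bsub>K\<^esub>" if "x \<in> I" for x
      using that subspaceD(3)[OF ID(1) that] e[OF j] ID(2) f0 by (simp add: h_def)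
  qed
  moreover have "f (a \<otimes>\<^bsub>A\<^esub> b) = (\<Oplus>\<^bsub>K\<^esub>j\<in>{..<n}. \<phi> j a \<otimes>\<^bsub>K\<^esub> h j b)"
    if a: "a \<in> carrier A" and b: "b \<in> carrier A" for a b
  proof -
    let ?F = "\<lambda>x. f (x \<otimes>\<^bsub>A\<^esub> b)" and ?s = "\<Oplus>\<^bsub>A\<^esub>j\<in>{..<n}. \<phi> j a \<odot>\<^bsub>A\<^esub> e j"
    have F: "?F \<in> module_hom K A (scalar_space K)"
      using b f
      by (intro module_homI)
        (auto simp: alg_mult_closed alg_distrib_right alg_smult_left module_hom_add[OF fhom]
          module_hom_smult[OF fhom])
    have \<phi>c: "\<phi> j a \<in> carrier K" if "j < n" for j
      using functional_closed[OF lin_maps_hom[OF \<phi>[OF that]] a] .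
    have s: "?s \<in> carrier A" using e \<phi>c by (intro M.finsum_closed) auto
    have "a \<ominus>\<^bsub>A\<^esub> ?s \<in> I" using ds a by (auto simp: dual_system_def)
    then have "?F (a \<ominus>\<^bsub>A\<^esub> ?s) = \<zero>\<^bsub>K\<^esub>" using ID(3)[OF b] f0 by simp
    then have "?F a \<ominus>\<^bsub>K\<^esub> ?F ?s = \<zero>\<^bsub>K\<^esub>"
      using module_hom_minus[OF A_vs S_vs F a s] K_field functional_closed[OF F] a s by simp
    then have "?F a = ?F ?s"
      using functional_closed[OF F] a s by simp
    also have "?F ?s = (\<Oplus>\<^bsub>K\<^esub>j\<in>{..<n}. ?F (\<phi> j a \<odot>\<^bsub>A\<^esub> e j))"
      using module_hom_finsum[OF A_vs S_vs F, of "\<lambda>j. \<phi> j a \<odot>\<^bsub>A\<^esub> e j" "{..<n}"] e \<phi>c by simp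
    also have "\<dots> = (\<Oplus>\<^bsub>K\<^esub>j\<in>{..<n}. \<phi> j a \<otimes>\<^bsub>K\<^esub> h j b)"
      using e \<phi>c b f
      by (intro R.finsum_cong')
        (auto simp: h_def alg_smult_left alg_mult_closed module_hom_smult[OF fhom])
    finally show ?thesis .
  qed
  ultimately show ?thesis by (rule that)
qed

text \<open>
  The tensors in the description of the comultiplication of \<open>f\<close> all have the evaluations \<open>f(ab)\<close>,
  so there is only one. From here on the comultiplication is used only through these evaluations.
\<close>

lemma dual_comult:
  assumes f: "f \<in> carrier D"
  shows dual_comult_closed: "dual_comult K A f \<in> carrier DD"
    and eval2_dual_comult: "\<And>a b. a \<in> carrier A \<Longrightarrow> b \<in> carrier A \<Longrightarrow>
      eval2 a b (dual_comult K A f) = f (a \<otimes>\<^bsub>A\<^esub> b)"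
proof -
  define P where "P t \<longleftrightarrow> (\<exists>n::nat. \<exists>g h.
        (\<forall>j<n. g j \<in> carrier D \<and> h j \<in> carrier D) \<and>
        (\<forall>a\<in>carrier A. \<forall>b\<in>carrier A.
           f (a \<otimes>\<^bsub>A\<^esub> b) = (\<Oplus>\<^bsub>K\<^esub>j\<in>{..<n}. g j a \<otimes>\<^bsub>K\<^esub> h j b)) \<and>
        t = (\<Oplus>\<^bsub>DD\<^esub>j\<in>{..<n}. pure_tensor K D D (g j) (h j)))" for t
  have P: "t \<in> carrier DD \<and> (\<forall>a\<in>carrier A. \<forall>b\<in>carrier A. eval2 a b t = f (a \<otimes>\<^bsub>A\<^esub> b))" if Pt: "P t" for t
  proof -
    obtain n :: nat and g h where gh: "\<And>j. j < n \<Longrightarrow> g j \<in> carrier D" "\<And>j. j < n \<Longrightarrow> h j \<in> carrier D"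
      and fab: "\<And>a b. a \<in> carrier A \<Longrightarrow> b \<in> carrier A \<Longrightarrow>
           f (a \<otimes>\<^bsub>A\<^esub> b) = (\<Oplus>\<^bsub>K\<^esub>j\<in>{..<n}. g j a \<otimes>\<^bsub>K\<^esub> h j b)"
      and t: "t = (\<Oplus>\<^bsub>DD\<^esub>j\<in>{..<n}. pure_tensor K D D (g j) (h j))"
      using Pt unfolding P_def by blast
    have "eval2 a b t = f (a \<otimes>\<^bsub>A\<^esub> b)" if ab: "a \<in> carrier A" "b \<in> carrier A" for a b
    proof -
      have "eval2 a b t = (\<Oplus>\<^bsub>K\<^esub>j\<in>{..<n}. eval2 a b (pure_tensor K D D (g j) (h j)))"
        using module_hom_finsum[OF DD.T_vs S_vs eval2_hom[OF ab],
            of "\<lambda>j. pure_tensor K D D (g j) (h j)" "{..<n}"] gh by (simp add: t)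
      also have "\<dots> = (\<Oplus>\<^bsub>K\<^esub>j\<in>{..<n}. g j a \<otimes>\<^bsub>K\<^esub> h j b)"
        using gh ab by (intro R.finsum_cong') (auto simp: eval2_pure)
      finally show ?thesis using fab[OF ab] by simp
    qed
    moreover have "t \<in> carrier DD" unfolding t using gh by (intro DD.T.finsum_closed) auto
    ultimately show ?thesis by blast
  qed
  obtain n :: nat and g h where "\<And>j. j < n \<Longrightarrow> g j \<in> carrier D" "\<And>j. j < n \<Longrightarrow> h j \<in> carrier D"
    "\<And>a b. a \<in> carrier A \<Longrightarrow> b \<in> carrier A \<Longrightarrow>
      f (a \<otimes>\<^bsub>A\<^esub> b) = (\<Oplus>\<^bsub>K\<^esub>j\<in>{..<n}. g j a \<otimes>\<^bsub>K\<^esub> h j b)"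
    using comult_decomposition[OF f] by blast
  then have "P (\<Oplus>\<^bsub>DD\<^esub>j\<in>{..<n}. pure_tensor K D D (g j) (h j))"
    unfolding P_def by blast
  moreover have "s = t" if "P s" "P t" for s t
    using P[OF that(1)] P[OF that(2)] by (intro eval2_eqI) simp_all
  ultimately have "\<exists>!t. P t" by blast
  then have "P (THE t. P t)" by (rule theI')
  then have "P (dual_comult K A f)"
    using f by (simp add: dual_comult_def Let_def P_def)
  then show "dual_comult K A f \<in> carrier DD"
    "\<And>a b. a \<in> carrier A \<Longrightarrow> b \<in> carrier A \<Longrightarrow> eval2 a b (dual_comult K A f) = f (a \<otimes>\<^bsub>A\<^esub> b)"
    using P by blast+
qed

lemma dual_comult_lin: "dual_comult K A \<in> lin_maps K D DD"
proof -
  have "dual_comult K A \<in> module_hom K D DD"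
  proof (rule module_homI)
    fix f g assume fg: "f \<in> carrier D" "g \<in> carrier D"
    show "dual_comult K A (f \<oplus>\<^bsub>D\<^esub> g) = dual_comult K A f \<oplus>\<^bsub>DD\<^esub> dual_comult K A g"
      by (rule eval2_eqI)
        (use fg in \<open>simp_all add: dual_comult_closed eval2_dual_comult module_hom_add[OF eval2_hom]
          module_hom_add[OF eval_hom] alg_mult_closed\<close>)
  next
    fix c f assume cf: "c \<in> carrier K" "f \<in> carrier D"
    show "dual_comult K A (c \<odot>\<^bsub>D\<^esub> f) = c \<odot>\<^bsub>DD\<^esub> dual_comult K A f"
      by (rule eval2_eqI)
        (use cf in \<open>simp_all add: dual_comult_closed eval2_dual_comult module_hom_smult[OF eval2_hom]
          module_hom_smult[OF eval_hom] alg_mult_closed\<close>)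
  qed (rule dual_comult_closed)
  then show ?thesis by (simp add: lin_maps_def dual_comult_def Let_def)
qed

end

section \<open>Functoriality of tensor products\<close>

lemma id_map_lin: "vectorspace K M \<Longrightarrow> id_map M \<in> lin_maps K M M"
  unfolding id_map_def by (subst restrict_lin_maps_iff) (auto intro: module_homI)

lemma id_map_apply [simp]: "x \<in> carrier M \<Longrightarrow> id_map M x = x"
  by (simp add: id_map_def)

lemma module_hom_pointwise:
  assumes P: "vectorspace K P" and f: "f \<in> module_hom K M P"
  shows module_hom_pointwise_add: "g \<in> module_hom K M P \<Longrightarrow> (\<lambda>x. f x \<oplus>\<^bsub>P\<^esub> g x) \<in> module_hom K M P"
    and module_hom_pointwise_smult: "c \<in> carrier K \<Longrightarrow> (\<lambda>x. c \<odot>\<^bsub>P\<^esub> f x) \<in> module_hom K M P"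
proof -
  interpret P: vectorspace K P by fact
  note [simp] = module_hom_mem[OF f] module_hom_add[OF f] module_hom_smult[OF f]
  show "(\<lambda>x. c \<odot>\<^bsub>P\<^esub> f x) \<in> module_hom K M P" if "c \<in> carrier K"
    using that by (intro module_homI)
      (simp_all add: P.smult_r_distr P.smult_assoc1[symmetric] P.R.m_comm)
  show "(\<lambda>x. f x \<oplus>\<^bsub>P\<^esub> g x) \<in> module_hom K M P" if g: "g \<in> module_hom K M P"
    by (rule module_homI)
      (simp_all add: module_hom_mem[OF g] module_hom_add[OF g] module_hom_smult[OF g]
        P.M.a_ac P.smult_r_distr)
qed

lemma tensor_map:
  assumes "tensor_product K M N" "tensor_product K M' N'"
    and f: "f \<in> module_hom K M M'" and g: "g \<in> module_hom K N N'"
  shows tensor_map_lin: "tensor_map K M N M' N' f g \<in> lin_maps K (tensor_space K M N) (tensor_space K M' N')"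
    and tensor_map_pure: "\<And>x y. x \<in> carrier M \<Longrightarrow> y \<in> carrier N \<Longrightarrow>
      tensor_map K M N M' N' f g (pure_tensor K M N x y) = pure_tensor K M' N' (f x) (g y)"
proof -
  interpret S: tensor_product K M N by fact
  interpret S': tensor_product K M' N' by fact
  have b: "bilinear_map K M N (tensor_space K M' N') (\<lambda>x y. pure_tensor K M' N' (f x) (g y))"
  proof (rule bilinear_mapI)
    fix y assume "y \<in> carrier N"
    then have "g y \<in> carrier N'" by (rule module_hom_mem[OF g])
    then show "(\<lambda>x. pure_tensor K M' N' (f x) (g y)) \<in> module_hom K M (tensor_space K M' N')"
      by (rule module_hom_comp[OF f bilinear_left[OF S'.pure_bilinear]])
  next
    fix x assume "x \<in> carrier M"
    then have "f x \<in> carrier M'" by (rule module_hom_mem[OF f])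
    then show "(\<lambda>y. pure_tensor K M' N' (f x) (g y)) \<in> module_hom K N (tensor_space K M' N')"
      by (rule module_hom_comp[OF g bilinear_right[OF S'.pure_bilinear]])
  qed
  show "tensor_map K M N M' N' f g \<in> lin_maps K (tensor_space K M N) (tensor_space K M' N')"
    unfolding tensor_map_def by (rule S.tensor_lift_lin[OF S'.T_vs b])
  show "tensor_map K M N M' N' f g (pure_tensor K M N x y) = pure_tensor K M' N' (f x) (g y)"
    if "x \<in> carrier M" "y \<in> carrier N" for x y
    unfolding tensor_map_def by (rule S.tensor_lift_pure[OF S'.T_vs b that])
qed

text \<open>
  In the coassociativity law the associator meets \<open>t \<otimes> z\<close> for a general tensor \<open>t\<close>. Hence the
  second claim gives its value as a linear function of \<open>t\<close>, which is determined by its values at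
  pure tensors.
\<close>

lemma tensor_assoc:
  assumes M: "vectorspace K M" and N: "vectorspace K N" and P: "vectorspace K P"
  shows tensor_assoc_lin: "tensor_assoc K M N P \<in> lin_maps K
      (tensor_space K (tensor_space K M N) P) (tensor_space K M (tensor_space K N P))"
    and tensor_assoc_pure: "\<And>z. z \<in> carrier P \<Longrightarrow> \<exists>h \<in> module_hom K (tensor_space K M N)
        (tensor_space K M (tensor_space K N P)).
      (\<forall>x\<in>carrier M. \<forall>y\<in>carrier N. h (pure_tensor K M N x y) =
        pure_tensor K M (tensor_space K N P) x (pure_tensor K N P y z)) \<and>
      (\<forall>t\<in>carrier (tensor_space K M N).
        tensor_assoc K M N P (pure_tensor K (tensor_space K M N) P t z) = h t)"
proof -
  interpret MN: tensor_product K M N using M N by (simp add: tensor_product_def)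
  interpret NP: tensor_product K N P using N P by (simp add: tensor_product_def)
  interpret MN_P: tensor_product K MN.T P using MN.T_vs P by (simp add: tensor_product_def)
  interpret M_NP: tensor_product K M NP.T using M NP.T_vs by (simp add: tensor_product_def)
  let ?b = "\<lambda>z x y. M_NP.pure x (NP.pure y z)"
  define L where "L t z = tensor_lift K M N M_NP.T (?b z) t" for t z
  have b: "bilinear_map K M N M_NP.T (?b z)" if z: "z \<in> carrier P" for z
  proof (rule bilinear_mapI)
    fix y assume "y \<in> carrier N"
    then show "(\<lambda>x. ?b z x y) \<in> module_hom K M M_NP.T"
      using z by (intro bilinear_left[OF M_NP.pure_bilinear]) simp
  next
    fix x assume x: "x \<in> carrier M"
    show "?b z x \<in> module_hom K N M_NP.T"
      by (rule module_hom_comp[OF bilinear_left[OF NP.pure_bilinear z]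
            bilinear_right[OF M_NP.pure_bilinear x]])
  qed
  have L: "(\<lambda>t. L t z) \<in> module_hom K MN.T M_NP.T" if "z \<in> carrier P" for z
    unfolding L_def by (rule lin_maps_hom[OF MN.tensor_lift_lin[OF M_NP.T_vs b[OF that]]])
  have Lp: "L (MN.pure x y) z = ?b z x y" if "z \<in> carrier P" "x \<in> carrier M" "y \<in> carrier N" for x y z
    unfolding L_def by (rule MN.tensor_lift_pure[OF M_NP.T_vs b[OF that(1)] that(2,3)])
  have pure_hom: "(\<lambda>z. ?b z x y) \<in> module_hom K P M_NP.T" if "x \<in> carrier M" "y \<in> carrier N" for x y
    by (rule module_hom_comp[OF bilinear_right[OF NP.pure_bilinear that(2)]
          bilinear_right[OF M_NP.pure_bilinear that(1)]])
  have bil: "bilinear_map K MN.T P M_NP.T L"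
  proof (rule bilinear_mapI)
    fix t assume t: "t \<in> carrier MN.T"
    show "L t \<in> module_hom K P M_NP.T"
    proof (rule module_homI)
      fix z assume "z \<in> carrier P"
      then show "L t z \<in> carrier M_NP.T" using module_hom_mem[OF L t] by simp
    next
      fix z z' assume z: "z \<in> carrier P" "z' \<in> carrier P"
      show "L t (z \<oplus>\<^bsub>P\<^esub> z') = L t z \<oplus>\<^bsub>M_NP.T\<^esub> L t z'"
      proof (rule MN.hom_eq_on_tensors[OF M_NP.T_vs L
            module_hom_pointwise_add[OF M_NP.T_vs L L] _ t])
        show "L (MN.pure x y) (z \<oplus>\<^bsub>P\<^esub> z') = L (MN.pure x y) z \<oplus>\<^bsub>M_NP.T\<^esub> L (MN.pure x y) z'"
          if "x \<in> carrier M" "y \<in> carrier N" for x y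
          using that z Lp module_hom_add[OF pure_hom[OF that] z] by simp
      qed (use z in auto)
    next
      fix c z assume z: "c \<in> carrier K" "z \<in> carrier P"
      show "L t (c \<odot>\<^bsub>P\<^esub> z) = c \<odot>\<^bsub>M_NP.T\<^esub> L t z"
      proof (rule MN.hom_eq_on_tensors[OF M_NP.T_vs L
            module_hom_pointwise_smult[OF M_NP.T_vs L] _ t])
        show "L (MN.pure x y) (c \<odot>\<^bsub>P\<^esub> z) = c \<odot>\<^bsub>M_NP.T\<^esub> L (MN.pure x y) z"
          if "x \<in> carrier M" "y \<in> carrier N" for x y
          using that z Lp module_hom_smult[OF pure_hom[OF that] z] by simp
      qed (use z in auto)
    qed
  qed (rule L)
  have assoc: "tensor_assoc K M N P = tensor_lift K MN.T P M_NP.T L"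
    by (simp add: tensor_assoc_def Let_def L_def[abs_def])
  show "tensor_assoc K M N P \<in> lin_maps K MN_P.T M_NP.T"
    unfolding assoc by (rule MN_P.tensor_lift_lin[OF M_NP.T_vs bil])
  show "\<exists>h \<in> module_hom K MN.T M_NP.T.
      (\<forall>x\<in>carrier M. \<forall>y\<in>carrier N. h (MN.pure x y) = ?b z x y) \<and>
      (\<forall>t\<in>carrier MN.T. tensor_assoc K M N P (MN_P.pure t z) = h t)" if "z \<in> carrier P" for z
    using that L Lp MN_P.tensor_lift_pure[OF M_NP.T_vs bil]
    unfolding assoc by (intro bexI[of _ "\<lambda>t. L t z"]) simp_all
qed

section \<open>Coactions as actions\<close>

context nonunital_algebra
begin

text \<open>
  The action of \<open>a\<close> on a comodule is the coaction followed by this map.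
\<close>

abbreviation ev where "ev M a \<equiv> contract K M D (\<lambda>f. f a)"

lemma comodule_to_module_eq:
  "comodule_to_module K A (M, \<rho>) = (M, \<lambda>a\<in>carrier A. \<lambda>m\<in>carrier M. ev M a (\<rho> m))"
  by (simp add: comodule_to_module_def contract_def)

lemma ev_hom:
  assumes "vectorspace K M" "a \<in> carrier A"
  shows "ev M a \<in> module_hom K (tensor_space K M D) M"
  by (rule tensor_product.contract_hom[OF tensor_product_dual eval_hom]) fact+

lemma ev_pure:
  assumes "vectorspace K M" "a \<in> carrier A" "x \<in> carrier M" "f \<in> carrier D"
  shows "ev M a (pure_tensor K M D x f) = f a \<odot>\<^bsub>M\<^esub> x"
  by (rule tensor_product.contract_pure[OF tensor_product_dual eval_hom]) fact+

lemma ev_add: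
  assumes M: "vectorspace K M" and ab: "a \<in> carrier A" "b \<in> carrier A"
    and t: "t \<in> carrier (tensor_space K M D)"
  shows "ev M (a \<oplus>\<^bsub>A\<^esub> b) t = ev M a t \<oplus>\<^bsub>M\<^esub> ev M b t"
proof -
  interpret M: vectorspace K M by fact
  interpret MD: tensor_product K M D by (rule tensor_product_dual[OF M])
  note h = ev_hom[OF M ab(1)] ev_hom[OF M ab(2)]
  show ?thesis
  proof (rule MD.hom_eq_on_tensors[OF M ev_hom[OF M] module_hom_pointwise_add[OF M h] _ t])
    show "ev M (a \<oplus>\<^bsub>A\<^esub> b) (MD.pure x f) = ev M a (MD.pure x f) \<oplus>\<^bsub>M\<^esub> ev M b (MD.pure x f)"
      if "x \<in> carrier M" "f \<in> carrier D" for x f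
      using that ab by (simp add: ev_pure[OF M] module_hom_add[OF finite_dual_hom] M.smult_l_distr)
  qed (use ab in simp)
qed

lemma ev_smult:
  assumes M: "vectorspace K M" and ca: "c \<in> carrier K" "a \<in> carrier A"
    and t: "t \<in> carrier (tensor_space K M D)"
  shows "ev M (c \<odot>\<^bsub>A\<^esub> a) t = c \<odot>\<^bsub>M\<^esub> ev M a t"
proof -
  interpret M: vectorspace K M by fact
  interpret MD: tensor_product K M D by (rule tensor_product_dual[OF M])
  show ?thesis
  proof (rule MD.hom_eq_on_tensors[OF M ev_hom[OF M] module_hom_pointwise_smult[OF M ev_hom[OF M ca(2)] ca(1)] _ t])
    show "ev M (c \<odot>\<^bsub>A\<^esub> a) (MD.pure x f) = c \<odot>\<^bsub>M\<^esub> ev M a (MD.pure x f)"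
      if "x \<in> carrier M" "f \<in> carrier D" for x f
      using that ca by (simp add: ev_pure[OF M] module_hom_smult[OF finite_dual_hom] M.smult_assoc1)
  qed (use ca in simp)
qed

text \<open>
  Evaluate both sides of the coassociativity law, which live in \<open>M \<otimes> (A\<^sup>0 \<otimes> A\<^sup>0)\<close>, at all pairs
  \<open>(a, b)\<close>. On the left \<open>x \<otimes> h\<close> becomes \<open>\<rho> x \<otimes> h\<close> and evaluates to \<open>a (h(b) x)\<close>, so \<open>\<rho> m\<close>
  evaluates to \<open>a (b m)\<close>. On the right \<open>x \<otimes> f\<close> becomes \<open>x \<otimes> \<delta> f\<close> and evaluates to \<open>f(ab) x\<close>, so
  \<open>\<rho> m\<close> evaluates to \<open>(ab) m\<close>. These evaluations separate tensors, so the law at \<open>m\<close> says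
  precisely that \<open>(ab) m = a (b m)\<close>.
\<close>

lemma coassociative_iff_multiplicative:
  assumes M: "vectorspace K M" and \<rho>: "\<rho> \<in> lin_maps K M (tensor_space K M D)" and m: "m \<in> carrier M"
  shows "tensor_assoc K M D D (tensor_map K M D (tensor_space K M D) D \<rho> (id_map D) (\<rho> m))
      = tensor_map K M D M (tensor_space K D D) (id_map M) (dual_comult K A) (\<rho> m)
    \<longleftrightarrow> (\<forall>a\<in>carrier A. \<forall>b\<in>carrier A. ev M (a \<otimes>\<^bsub>A\<^esub> b) (\<rho> m) = ev M a (\<rho> (ev M b (\<rho> m))))"
    (is "tensor_assoc K M D D (?l (\<rho> m)) = ?r (\<rho> m) \<longleftrightarrow> ?mult")
proof -
  interpret M: vectorspace K M by fact
  interpret MD: tensor_product K M D by (rule tensor_product_dual[OF M])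
  interpret MD_D: tensor_product K MD.T D by (rule tensor_product_dual[OF MD.T_vs])
  interpret M_DD: tensor_product K M DD using M DD.T_vs by (simp add: tensor_product_def)
  let ?assoc = "tensor_assoc K M D D"
  define E where "E a b = contract K M DD (eval2 a b)" for a b
  note \<rho>h = lin_maps_hom[OF \<rho>]
  have E: "E a b \<in> module_hom K M_DD.T M" if "a \<in> carrier A" "b \<in> carrier A" for a b
    unfolding E_def by (rule M_DD.contract_hom[OF eval2_hom]) fact+
  have Ep: "E a b (M_DD.pure x s) = eval2 a b s \<odot>\<^bsub>M\<^esub> x"
    if "a \<in> carrier A" "b \<in> carrier A" "x \<in> carrier M" "s \<in> carrier DD" for a b x s
    unfolding E_def by (rule M_DD.contract_pure[OF eval2_hom]) fact+
  have Einj: "s = t" if "s \<in> carrier M_DD.T" "t \<in> carrier M_DD.T"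
    and "\<And>a b. a \<in> carrier A \<Longrightarrow> b \<in> carrier A \<Longrightarrow> E a b s = E a b t" for s t
  proof (rule M_DD.tensor_eqI[OF _ _ that(1,2)])
    let ?\<Phi> = "(\<lambda>(a, b). eval2 a b) ` (carrier A \<times> carrier A)"
    show "?\<Phi> \<subseteq> module_hom K DD (scalar_space K)" using eval2_hom by auto
    show "u = \<zero>\<^bsub>DD\<^esub>" if "u \<in> carrier DD" "\<And>\<phi>. \<phi> \<in> ?\<Phi> \<Longrightarrow> \<phi> u = \<zero>\<^bsub>K\<^esub>" for u
      using that by (intro eval2_separates) auto
    show "contract K M DD \<phi> s = contract K M DD \<phi> t" if "\<phi> \<in> ?\<Phi>" for \<phi>
      using that \<open>\<And>a b. a \<in> carrier A \<Longrightarrow> b \<in> carrier A \<Longrightarrow> E a b s = E a b t\<close> by (auto simp: E_def)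
  qed
  have idD: "id_map D \<in> module_hom K D D" and idM: "id_map M \<in> module_hom K M M"
    using lin_maps_hom[OF id_map_lin] finite_dual_vs M by blast+
  note l = tensor_map[OF MD.tensor_product_axioms MD_D.tensor_product_axioms \<rho>h idD]
  note r = tensor_map[OF MD.tensor_product_axioms M_DD.tensor_product_axioms idM
      lin_maps_hom[OF dual_comult_lin]]
  note al = module_hom_comp[OF lin_maps_hom[OF l(1)] lin_maps_hom[OF tensor_assoc_lin[OF M finite_dual_vs finite_dual_vs]]]
  note rh = lin_maps_hom[OF r(1)]
  have L: "E a b (?assoc (?l t)) = ev M a (\<rho> (ev M b t))"
    if a: "a \<in> carrier A" and b: "b \<in> carrier A" and t: "t \<in> carrier MD.T" for a b t
  proof (rule MD.hom_eq_on_tensors[OF M module_hom_comp[OF al E[OF a b]]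
        module_hom_comp[OF module_hom_comp[OF ev_hom[OF M b] \<rho>h] ev_hom[OF M a]] _ t])
    fix x h assume x: "x \<in> carrier M" and h: "h \<in> carrier D"
    obtain L where L: "L \<in> module_hom K MD.T M_DD.T"
      and Lp: "\<And>y g. y \<in> carrier M \<Longrightarrow> g \<in> carrier D \<Longrightarrow> L (MD.pure y g) = M_DD.pure y (DD.pure g h)"
      and La: "\<And>s. s \<in> carrier MD.T \<Longrightarrow> ?assoc (MD_D.pure s h) = L s"
      using tensor_assoc_pure[OF M finite_dual_vs finite_dual_vs h] by blast
    have "E a b (L s) = h b \<odot>\<^bsub>M\<^esub> ev M a s" if s: "s \<in> carrier MD.T" for s
    proof (rule MD.hom_eq_on_tensors[OF M module_hom_comp[OF L E[OF a b]]
          module_hom_pointwise_smult[OF M ev_hom[OF M a]] _ s])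
      show "E a b (L (MD.pure y g)) = h b \<odot>\<^bsub>M\<^esub> ev M a (MD.pure y g)"
        if "y \<in> carrier M" "g \<in> carrier D" for y g
        using that a b h
        by (simp add: Lp Ep eval2_pure ev_pure[OF M] M.smult_assoc1[symmetric] R.m_comm)
    qed (use b h in simp)
    moreover have "?assoc (?l (MD.pure x h)) = L (\<rho> x)"
      using x h module_hom_mem[OF \<rho>h x] by (simp add: l(2) La)
    ultimately show "E a b (?assoc (?l (MD.pure x h))) = ev M a (\<rho> (ev M b (MD.pure x h)))"
      using x h a b module_hom_mem[OF \<rho>h x]
      by (simp add: ev_pure[OF M] module_hom_smult[OF \<rho>h] module_hom_smult[OF ev_hom[OF M a]])
  qed
  have R: "E a b (?r t) = ev M (a \<otimes>\<^bsub>A\<^esub> b) t"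
    if a: "a \<in> carrier A" and b: "b \<in> carrier A" and t: "t \<in> carrier MD.T" for a b t
  proof (rule MD.hom_eq_on_tensors[OF M module_hom_comp[OF rh E[OF a b]] ev_hom[OF M] _ t])
    show "E a b (?r (MD.pure x f)) = ev M (a \<otimes>\<^bsub>A\<^esub> b) (MD.pure x f)"
      if "x \<in> carrier M" "f \<in> carrier D" for x f
      using that a b
      by (simp add: r(2) Ep ev_pure[OF M] dual_comult_closed eval2_dual_comult alg_mult_closed)
  qed (use a b in \<open>simp add: alg_mult_closed\<close>)
  have \<rho>m: "\<rho> m \<in> carrier MD.T" using module_hom_mem[OF \<rho>h m] .
  show ?thesis
  proof
    assume "?assoc (?l (\<rho> m)) = ?r (\<rho> m)"
    then show ?mult using L[OF _ _ \<rho>m] R[OF _ _ \<rho>m] by metis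
  next
    assume mult: ?mult
    show "?assoc (?l (\<rho> m)) = ?r (\<rho> m)"
      using mult L[OF _ _ \<rho>m] R[OF _ _ \<rho>m]
      by (intro Einj module_hom_mem[OF al \<rho>m] module_hom_mem[OF rh \<rho>m]) simp
  qed
qed

text \<open>
  Evaluating \<open>(f \<otimes> id) (\<rho> m)\<close> at \<open>a\<close> gives \<open>f (a m)\<close>, and evaluations separate tensors.
\<close>

lemma colinear_iff_linear:
  assumes M: "vectorspace K M" and N: "vectorspace K N"
    and \<rho>: "\<rho> \<in> lin_maps K M (tensor_space K M D)" and \<sigma>: "\<sigma> \<in> lin_maps K N (tensor_space K N D)"
    and f: "f \<in> lin_maps K M N" and m: "m \<in> carrier M"
  shows "\<sigma> (f m) = tensor_map K M D N D f (id_map D) (\<rho> m) \<longleftrightarrow>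
    (\<forall>a\<in>carrier A. f (ev M a (\<rho> m)) = ev N a (\<sigma> (f m)))"
proof -
  interpret MD: tensor_product K M D by (rule tensor_product_dual[OF M])
  interpret ND: tensor_product K N D by (rule tensor_product_dual[OF N])
  interpret N: vectorspace K N by fact
  note fh = lin_maps_hom[OF f]
  have idD: "id_map D \<in> module_hom K D D" using lin_maps_hom[OF id_map_lin[OF finite_dual_vs]] .
  note tm = tensor_map[OF MD.tensor_product_axioms ND.tensor_product_axioms fh idD]
  note th = lin_maps_hom[OF tm(1)]
  have *: "ev N a (tensor_map K M D N D f (id_map D) t) = f (ev M a t)"
    if a: "a \<in> carrier A" and t: "t \<in> carrier MD.T" for a t
  proof (rule MD.hom_eq_on_tensors[OF N module_hom_comp[OF th ev_hom[OF N a]]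
        module_hom_comp[OF ev_hom[OF M a] fh] _ t])
    show "ev N a (tensor_map K M D N D f (id_map D) (MD.pure x h)) = f (ev M a (MD.pure x h))"
      if "x \<in> carrier M" "h \<in> carrier D" for x h
      using that a module_hom_mem[OF fh]
      by (simp add: tm(2) ev_pure[OF M] ev_pure[OF N] module_hom_smult[OF fh])
  qed
  have \<rho>m: "\<rho> m \<in> carrier MD.T" using module_hom_mem[OF lin_maps_hom[OF \<rho>] m] .
  have fm: "f m \<in> carrier N" using module_hom_mem[OF fh m] .
  have \<sigma>m: "\<sigma> (f m) \<in> carrier ND.T" using module_hom_mem[OF lin_maps_hom[OF \<sigma>] fm] .
  show ?thesis
  proof
    assume "\<sigma> (f m) = tensor_map K M D N D f (id_map D) (\<rho> m)"
    then show "\<forall>a\<in>carrier A. f (ev M a (\<rho> m)) = ev N a (\<sigma> (f m))"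
      using *[OF _ \<rho>m] by simp
  next
    assume eq: "\<forall>a\<in>carrier A. f (ev M a (\<rho> m)) = ev N a (\<sigma> (f m))"
    show "\<sigma> (f m) = tensor_map K M D N D f (id_map D) (\<rho> m)"
      by (rule tensor_dual_eqI[OF N \<sigma>m module_hom_mem[OF th \<rho>m]]) (use eq * \<rho>m in simp)
  qed
qed

text \<open>
  Both sides send \<open>x \<otimes> f\<close> to \<open>f(e) x\<close>: applying the counit is acting by the identity of the
  algebra.
\<close>

lemma counit_map:
  assumes e: "e \<in> carrier A" and M: "vectorspace K M" and t: "t \<in> carrier (tensor_space K M D)"
  shows "tensor_unit K M (tensor_map K M D M (scalar_space K) (id_map M) (dual_counit K A e) t) = ev M e t"
proof -
  interpret MD: tensor_product K M D by (rule tensor_product_dual[OF M])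
  interpret MK: tensor_product K M "scalar_space K" using M S_vs by (simp add: tensor_product_def)
  have i: "(\<lambda>c. c) \<in> module_hom K (scalar_space K) (scalar_space K)" by (rule module_homI) auto
  have u: "tensor_unit K M = contract K M (scalar_space K) (\<lambda>c. c)"
    by (simp add: tensor_unit_def contract_def)
  have ce: "dual_counit K A e \<in> module_hom K D (scalar_space K)"
    unfolding dual_counit_def using lin_maps_hom restrict_lin_maps_iff[OF finite_dual_vs] eval_hom[OF e] by blast
  have counit: "dual_counit K A e f = f e" if "f \<in> carrier D" for f
    using that by (simp add: dual_counit_def)
  note tm = tensor_map[OF MD.tensor_product_axioms MK.tensor_product_axioms
      lin_maps_hom[OF id_map_lin[OF M]] ce]
  show ?thesis
    unfolding u
  proof (rule MD.hom_eq_on_tensors[OF M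
        module_hom_comp[OF lin_maps_hom[OF tm(1)] MK.contract_hom[OF i]] ev_hom[OF M e] _ t])
    fix x f assume "x \<in> carrier M" "f \<in> carrier D"
    then show "contract K M (scalar_space K) (\<lambda>c. c)
        (tensor_map K M D M (scalar_space K) (id_map M) (dual_counit K A e) (MD.pure x f)) = ev M e (MD.pure x f)"
      using e by (simp add: tm(2) ev_pure[OF M] counit MK.contract_pure[OF i])
  qed
qed

end

section \<open>Modules\<close>

lemma left_module_iff:
  "left_module K A (M, act) \<longleftrightarrow>
     vectorspace K M \<and> act \<in> extensional (carrier A) \<and>
     (\<forall>a\<in>carrier A. act a \<in> lin_maps K M M) \<and>
     (\<forall>a\<in>carrier A. \<forall>b\<in>carrier A. \<forall>m\<in>carrier M. act (a \<oplus>\<^bsub>A\<^esub> b) m = act a m \<oplus>\<^bsub>M\<^esub> act b m) \<and>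
     (\<forall>c\<in>carrier K. \<forall>a\<in>carrier A. \<forall>m\<in>carrier M. act (c \<odot>\<^bsub>A\<^esub> a) m = c \<odot>\<^bsub>M\<^esub> act a m) \<and>
     (\<forall>a\<in>carrier A. \<forall>b\<in>carrier A. \<forall>m\<in>carrier M. act (a \<otimes>\<^bsub>A\<^esub> b) m = act a (act b m))"
  by (simp add: left_module_def)

context nonunital_algebra
begin

lemma left_moduleD:
  assumes "left_module K A (M, act)"
  shows "vectorspace K M" "act \<in> extensional (carrier A)"
    and "\<And>a. a \<in> carrier A \<Longrightarrow> act a \<in> lin_maps K M M"
    and "\<And>a. a \<in> carrier A \<Longrightarrow> act a \<in> module_hom K M M"
    and "\<And>a m. a \<in> carrier A \<Longrightarrow> m \<in> carrier M \<Longrightarrow> act a m \<in> carrier M"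
    and "\<And>m. m \<in> carrier M \<Longrightarrow> (\<lambda>a. act a m) \<in> module_hom K A M"
    and "\<And>a b m. a \<in> carrier A \<Longrightarrow> b \<in> carrier A \<Longrightarrow> m \<in> carrier M \<Longrightarrow>
      act (a \<otimes>\<^bsub>A\<^esub> b) m = act a (act b m)"
proof -
  note a = assms[unfolded left_module_iff]
  show lin: "act a \<in> lin_maps K M M" if "a \<in> carrier A" for a using a that by blast
  show hom: "act a \<in> module_hom K M M" if "a \<in> carrier A" for a by (rule lin_maps_hom[OF lin[OF that]])
  show mem: "act a m \<in> carrier M" if "a \<in> carrier A" "m \<in> carrier M" for a m
    by (rule module_hom_mem[OF hom[OF that(1)] that(2)])
  show "(\<lambda>a. act a m) \<in> module_hom K A M" if "m \<in> carrier M" for m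
    using a that mem by (intro module_homI) auto
qed (use assms in \<open>auto simp: left_module_iff\<close>)

text \<open>
  Without a unit the element \<open>m\<close> need not lie in \<open>A m\<close>, whence the additional summand \<open>K m\<close>.
\<close>

lemma generated_submodule_eq:
  assumes X: "left_module K A (M, act)" and m: "m \<in> carrier M"
  shows "generated_submodule K A (M, act) m =
      {c \<odot>\<^bsub>M\<^esub> m \<oplus>\<^bsub>M\<^esub> act a m | c a. c \<in> carrier K \<and> a \<in> carrier A}" (is "_ = ?H")
    and "is_act_submodule K A (M, act) (generated_submodule K A (M, act) m)"
    and "m \<in> generated_submodule K A (M, act) m"
proof -
  note XD = left_moduleD[OF X]
  interpret X: vectorspace K M by (rule XD(1))
  note am = XD(6)[OF m]
  have mem: "c \<odot>\<^bsub>M\<^esub> m \<oplus>\<^bsub>M\<^esub> act a m \<in> ?H" if "c \<in> carrier K" "a \<in> carrier A" for c a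
    using that by blast
  have act0: "act \<zero>\<^bsub>A\<^esub> m = \<zero>\<^bsub>M\<^esub>" by (rule module_hom_zero[OF A_vs XD(1) am])
  have sub: "subspace K ?H M"
  proof (rule subspaceI[OF XD(1)])
    show "\<zero>\<^bsub>M\<^esub> \<in> ?H" using mem[of "\<zero>\<^bsub>K\<^esub>" "\<zero>\<^bsub>A\<^esub>"] act0 m by simp
  next
    fix x y assume "x \<in> ?H" "y \<in> ?H"
    then obtain c a d b where x: "c \<in> carrier K" "a \<in> carrier A" "x = c \<odot>\<^bsub>M\<^esub> m \<oplus>\<^bsub>M\<^esub> act a m"
      and y: "d \<in> carrier K" "b \<in> carrier A" "y = d \<odot>\<^bsub>M\<^esub> m \<oplus>\<^bsub>M\<^esub> act b m" by auto
    have "x \<oplus>\<^bsub>M\<^esub> y = (c \<oplus>\<^bsub>K\<^esub> d) \<odot>\<^bsub>M\<^esub> m \<oplus>\<^bsub>M\<^esub> act (a \<oplus>\<^bsub>A\<^esub> b) m"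
      using x y m XD(5) by (simp add: module_hom_add[OF am] X.smult_l_distr X.M.a_ac)
    then show "x \<oplus>\<^bsub>M\<^esub> y \<in> ?H" using x y by auto
  next
    fix d x assume d: "d \<in> carrier K" and "x \<in> ?H"
    then obtain c a where x: "c \<in> carrier K" "a \<in> carrier A" "x = c \<odot>\<^bsub>M\<^esub> m \<oplus>\<^bsub>M\<^esub> act a m" by auto
    have "d \<odot>\<^bsub>M\<^esub> x = (d \<otimes>\<^bsub>K\<^esub> c) \<odot>\<^bsub>M\<^esub> m \<oplus>\<^bsub>M\<^esub> act (d \<odot>\<^bsub>A\<^esub> a) m"
      using x d m XD(5) by (simp add: module_hom_smult[OF am] X.smult_r_distr X.smult_assoc1)
    then show "d \<odot>\<^bsub>M\<^esub> x \<in> ?H" using x d by auto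
  qed (use m XD(5) in auto)
  have "act b x \<in> ?H" if b: "b \<in> carrier A" and "x \<in> ?H" for b x
  proof -
    obtain c a where x: "c \<in> carrier K" "a \<in> carrier A" "x = c \<odot>\<^bsub>M\<^esub> m \<oplus>\<^bsub>M\<^esub> act a m"
      using \<open>x \<in> ?H\<close> by auto
    \<comment> \<open>\<open>b (c m + a m) = (c b + b a) m\<close>, without a multiple of \<open>m\<close>\<close>
    have "act b x = act (c \<odot>\<^bsub>A\<^esub> b \<oplus>\<^bsub>A\<^esub> b \<otimes>\<^bsub>A\<^esub> a) m"
      using x b m XD(5,7) alg_mult_closed
      by (simp add: module_hom_add[OF am] module_hom_smult[OF am] module_hom_add[OF XD(4)]
          module_hom_smult[OF XD(4)])
    then show ?thesis
      using mem[of "\<zero>\<^bsub>K\<^esub>" "c \<odot>\<^bsub>A\<^esub> b \<oplus>\<^bsub>A\<^esub> b \<otimes>\<^bsub>A\<^esub> a"] x b m XD(5) alg_mult_closed by simp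
  qed
  then have H: "is_act_submodule K A (M, act) ?H" using sub by (simp add: is_act_submodule_def)
  have mH: "m \<in> ?H" using mem[of "\<one>\<^bsub>K\<^esub>" "\<zero>\<^bsub>A\<^esub>"] act0 m by simp
  have least: "?H \<subseteq> N" if N: "is_act_submodule K A (M, act) N" "m \<in> N" for N
  proof -
    have "subspace K N M" using N by (simp add: is_act_submodule_def)
    note ND = subspaceD[OF this]
    show ?thesis
    proof
      fix x assume "x \<in> ?H"
      then obtain c a where x: "c \<in> carrier K" "a \<in> carrier A" "x = c \<odot>\<^bsub>M\<^esub> m \<oplus>\<^bsub>M\<^esub> act a m" by auto
      have "act a m \<in> N" using N x(2) by (simp add: is_act_submodule_def)
      then show "x \<in> N" unfolding x(3) using ND(5,6) N(2) x(1) by blast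
    qed
  qed
  show eq: "generated_submodule K A (M, act) m = ?H"
    unfolding generated_submodule_def
  proof (rule equalityI)
    show "\<Inter> {N. is_act_submodule K A (M, act) N \<and> m \<in> N} \<subseteq> ?H"
      using H mH by (intro Inter_lower) simp
    show "?H \<subseteq> \<Inter> {N. is_act_submodule K A (M, act) N \<and> m \<in> N}"
      using least by (intro Inter_greatest) simp
  qed
  show "is_act_submodule K A (M, act) (generated_submodule K A (M, act) m)" unfolding eq by (rule H)
  show "m \<in> generated_submodule K A (M, act) m" unfolding eq by (rule mH)
qed

lemma comodule_to_module_left_module:
  assumes M: "vectorspace K M" and \<rho>: "\<rho> \<in> lin_maps K M (tensor_space K M D)"
  shows "left_module K A (comodule_to_module K A (M, \<rho>)) \<longleftrightarrow>
    right_comodule K D (dual_comult K A) (M, \<rho>)"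
proof -
  interpret M: vectorspace K M by (rule M)
  note \<rho>h = lin_maps_hom[OF \<rho>]
  have \<rho>m: "\<rho> m \<in> carrier (tensor_space K M D)" if "m \<in> carrier M" for m
    by (rule module_hom_mem[OF \<rho>h that])
  have c: "ev M a (\<rho> m) \<in> carrier M" if "a \<in> carrier A" "m \<in> carrier M" for a m
    by (rule module_hom_mem[OF ev_hom[OF M that(1)] \<rho>m[OF that(2)]])
  have lin: "(\<lambda>m\<in>carrier M. ev M a (\<rho> m)) \<in> lin_maps K M M" if "a \<in> carrier A" for a
    unfolding restrict_lin_maps_iff[OF M] by (rule module_hom_comp[OF \<rho>h ev_hom[OF M that]])
  have "left_module K A (comodule_to_module K A (M, \<rho>)) \<longleftrightarrow>
      (\<forall>m\<in>carrier M. \<forall>a\<in>carrier A. \<forall>b\<in>carrier A. ev M (a \<otimes>\<^bsub>A\<^esub> b) (\<rho> m) = ev M a (\<rho> (ev M b (\<rho> m))))"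
    unfolding comodule_to_module_eq left_module_iff using M lin c \<rho>m
    by (auto simp: alg_mult_closed ev_add[OF M] ev_smult[OF M])
  also have "\<dots> \<longleftrightarrow> right_comodule K D (dual_comult K A) (M, \<rho>)"
    unfolding right_comodule_def using M \<rho> coassociative_iff_multiplicative[OF M \<rho>] by simp
  finally show ?thesis .
qed

lemma right_comoduleD:
  assumes "right_comodule K D (dual_comult K A) (M, \<rho>)"
  shows "vectorspace K M" "\<rho> \<in> lin_maps K M (tensor_space K M D)"
  using assms by (auto simp: right_comodule_def)

text \<open>
  Write \<open>\<rho> m = \<Sum> x\<^sub>i \<otimes> f\<^sub>i\<close>. An element of \<open>A\<close> killed by all \<open>f\<^sub>i\<close> annihilates \<open>m\<close>, and the common
  kernel of the \<open>f\<^sub>i\<close> has finite codimension, so \<open>A m\<close> is spanned by finitely many \<open>e\<^sub>j m\<close>.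
\<close>

lemma comodule_to_module_locally_finite:
  assumes X: "right_comodule K D (dual_comult K A) (M, \<rho>)"
  shows "locally_finite K A (comodule_to_module K A (M, \<rho>))"
proof -
  note M = right_comoduleD(1)[OF X] and \<rho> = right_comoduleD(2)[OF X]
  interpret MD: tensor_product K M D by (rule tensor_product_dual[OF M])
  define act where "act = (\<lambda>a\<in>carrier A. \<lambda>m\<in>carrier M. ev M a (\<rho> m))"
  have ctm: "comodule_to_module K A (M, \<rho>) = (M, act)"
    by (simp add: comodule_to_module_eq act_def)
  have mod: "left_module K A (M, act)"
    using comodule_to_module_left_module[OF M \<rho>] X ctm by simp
  note XD = left_moduleD[OF mod]
  have "vectorspace.fin_dim K (M\<lparr>carrier := generated_submodule K A (M, act) m\<rparr>)" if m: "m \<in> carrier M" for m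
  proof -
    let ?G = "generated_submodule K A (M, act) m"
    note G = generated_submodule_eq[OF mod m]
    have Gsub: "subspace K ?G M" using G(2) by (simp add: is_act_submodule_def)
    have Gvs: "vectorspace K (M\<lparr>carrier := ?G\<rparr>)"
      by (rule vectorspace.subspace_is_vs[OF M Gsub])
    have \<rho>m: "\<rho> m \<in> carrier MD.T" using module_hom_mem[OF lin_maps_hom[OF \<rho>] m] .
    obtain n :: nat and x f where xf: "\<And>i. i < n \<Longrightarrow> x i \<in> carrier M" "\<And>i. i < n \<Longrightarrow> f i \<in> carrier D"
      and sum: "\<rho> m = (\<Oplus>\<^bsub>MD.T\<^esub>i\<in>{..<n}. MD.pure (x i) (f i))"
      using MD.tensor_sum_repr[OF \<rho>m] by blast
    \<comment> \<open>Elements on which all \<open>f\<^sub>i\<close> vanish annihilate \<open>m\<close>.\<close>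
    have act0: "act a m = \<zero>\<^bsub>M\<^esub>" if a: "a \<in> carrier A" and "\<forall>\<phi>\<in>f ` {..<n}. \<phi> a = \<zero>\<^bsub>K\<^esub>" for a
    proof -
      have "act a m = (\<Oplus>\<^bsub>M\<^esub>i\<in>{..<n}. ev M a (MD.pure (x i) (f i)))"
        using a m module_hom_finsum[OF MD.T_vs M ev_hom[OF M a], of "\<lambda>i. MD.pure (x i) (f i)" "{..<n}"] xf
        by (simp add: act_def sum)
      also have "\<dots> = (\<Oplus>\<^bsub>M\<^esub>i\<in>{..<n}. \<zero>\<^bsub>M\<^esub>)"
        using that xf by (intro MD.M.finsum_cong') (auto simp: ev_pure[OF M])
      finally show ?thesis by simp
    qed
    have "f ` {..<n} \<subseteq> module_hom K A (scalar_space K)" using xf(2) finite_dual_hom by auto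
    then obtain k e \<psi> where ds:
      "dual_system K A {a \<in> carrier A. \<forall>\<phi>\<in>f ` {..<n}. \<phi> a = \<zero>\<^bsub>K\<^esub>} k e \<psi>"
      using dual_system_kernels[OF A_vs, of "f ` {..<n}"] by auto
    have e: "e j \<in> carrier A" and \<psi>: "\<psi> j \<in> lin_maps K A (scalar_space K)" if "j < k" for j
      using ds that by (auto simp: dual_system_def)
    let ?S = "insert m ((\<lambda>j. act (e j) m) ` {..<k})"
    note am = XD(6)[OF m]
    have actG: "act a m \<in> ?G" if "a \<in> carrier A" for a
      using G(2,3) that by (simp add: is_act_submodule_def)
    show ?thesis
      unfolding fin_dim_iff[OF Gvs]
    proof (intro exI[of _ ?S] conjI allI impI)
      show "?S \<subseteq> carrier (M\<lparr>carrier := ?G\<rparr>)" using G(3) actG e by auto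
    next
      fix J assume J: "subspace K J (M\<lparr>carrier := ?G\<rparr>)" and SJ: "?S \<subseteq> J"
      have JM: "subspace K J M"
        using subspaceD[OF J] subspaceD(3)[OF Gsub] by (intro subspaceI[OF M]) auto
      note JD = subspaceD[OF JM]
      have actJ: "act a m \<in> J" if a: "a \<in> carrier A" for a
      proof -
        have \<psi>c: "\<psi> j a \<in> carrier K" if "j < k" for j
          using functional_closed[OF lin_maps_hom[OF \<psi>[OF that]] a] .
        let ?s = "\<Oplus>\<^bsub>A\<^esub>j\<in>{..<k}. \<psi> j a \<odot>\<^bsub>A\<^esub> e j"
        have s: "?s \<in> carrier A" using e \<psi>c by (intro M.finsum_closed) auto
        have "act (a \<ominus>\<^bsub>A\<^esub> ?s) m = \<zero>\<^bsub>M\<^esub>"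
          using ds a s by (intro act0) (auto simp: dual_system_def)
        then have "act a m = act ?s m"
          using module_hom_minus[OF A_vs M am a s] XD(5)[OF a m] XD(5)[OF s m] by simp
        also have "\<dots> = (\<Oplus>\<^bsub>M\<^esub>j\<in>{..<k}. act (\<psi> j a \<odot>\<^bsub>A\<^esub> e j) m)"
          using e \<psi>c by (intro module_hom_finsum[OF A_vs M am]) auto
        also have "\<dots> \<in> J"
        proof (rule subspace_finsum[OF JM], rule Pi_I)
          fix j assume "j \<in> {..<k}"
          then have "act (e j) m \<in> J" "e j \<in> carrier A" "\<psi> j a \<in> carrier K" using SJ e \<psi>c by auto
          then show "act (\<psi> j a \<odot>\<^bsub>A\<^esub> e j) m \<in> J"
            using JD(6) by (simp add: module_hom_smult[OF am])
        qed
        finally show ?thesis .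
      qed
      show "carrier (M\<lparr>carrier := ?G\<rparr>) \<subseteq> J"
        using SJ actJ JD(5,6) by (auto simp: G(1))
    qed auto
  qed
  then show ?thesis by (simp add: ctm locally_finite_def)
qed

text \<open>
  Take coordinates \<open>\<phi>\<^sub>j\<close> with respect to \<open>e\<^sub>j\<close> on the finite-dimensional submodule \<open>G\<close> generated
  by \<open>m\<close>. Then \<open>a m = \<Sum> \<phi>\<^sub>j(a m) e\<^sub>j\<close>, so \<open>\<Sum> e\<^sub>j \<otimes> (a \<mapsto> \<phi>\<^sub>j(a m))\<close> is the required tensor,
  provided that its right factors lie in the finite dual. They vanish on the annihilator of \<open>G\<close>.
  This is a two-sided ideal because \<open>G\<close> is a submodule, and it has finite codimension because it
  is the common kernel of the finitely many matrix coefficients of \<open>A\<close> acting on \<open>G\<close>.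
\<close>

lemma locally_finite_coaction_at:
  assumes X: "left_module K A (M, act)" and lf: "locally_finite K A (M, act)" and m: "m \<in> carrier M"
  shows "\<exists>t\<in>carrier (tensor_space K M D). \<forall>a\<in>carrier A. ev M a t = act a m"
proof -
  note XD = left_moduleD[OF X]
  note M = XD(1)
  interpret MD: tensor_product K M D by (rule tensor_product_dual[OF M])
  let ?G = "generated_submodule K A (M, act) m"
  let ?V = "M\<lparr>carrier := ?G\<rparr>"
  note G = generated_submodule_eq[OF X m]
  have Gsub: "subspace K ?G M" and actG: "\<And>a g. a \<in> carrier A \<Longrightarrow> g \<in> ?G \<Longrightarrow> act a g \<in> ?G"
    using G(2) by (auto simp: is_act_submodule_def)
  note GD = subspaceD[OF Gsub]
  have V: "vectorspace K ?V"
    by (rule vectorspace.subspace_is_vs[OF M Gsub])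
  interpret V: vectorspace K ?V by (rule V)
  have "vectorspace.fin_dim K ?V" using lf m by (simp add: locally_finite_def)
  then obtain n e \<phi> where ds: "dual_system K ?V {\<zero>\<^bsub>?V\<^esub>} n e \<phi>"
    using fin_dim_coordinates[OF V] by blast
  have e: "e j \<in> ?G" and \<phi>: "\<phi> j \<in> module_hom K ?V (scalar_space K)" if "j < n" for j
    using ds that by (auto simp: dual_system_def lin_maps_def)
  have \<phi>c: "\<phi> j g \<in> carrier K" if "j < n" "g \<in> ?G" for j g
    using functional_closed[OF \<phi>] that by simp
  have coord: "g = (\<Oplus>\<^bsub>M\<^esub>j\<in>{..<n}. \<phi> j g \<odot>\<^bsub>M\<^esub> e j)" if g: "g \<in> ?G" for g
  proof -
    have s: "(\<lambda>j. \<phi> j g \<odot>\<^bsub>?V\<^esub> e j) \<in> {..<n} \<rightarrow> carrier ?V"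
      using e \<phi>c g GD(6) by auto
    have sc: "(\<Oplus>\<^bsub>?V\<^esub>j\<in>{..<n}. \<phi> j g \<odot>\<^bsub>?V\<^esub> e j) \<in> carrier ?V"
      by (rule V.finsum_closed[OF s])
    have "g \<ominus>\<^bsub>?V\<^esub> (\<Oplus>\<^bsub>?V\<^esub>j\<in>{..<n}. \<phi> j g \<odot>\<^bsub>?V\<^esub> e j) = \<zero>\<^bsub>?V\<^esub>"
      using ds g unfolding dual_system_def by simp
    then have "g = (\<Oplus>\<^bsub>?V\<^esub>j\<in>{..<n}. \<phi> j g \<odot>\<^bsub>?V\<^esub> e j)"
      using V.M.minus_other_side[OF _ sc, of g] g by simp
    \<comment> \<open>The inclusion of \<open>G\<close> into \<open>M\<close> is linear, so sums may be formed in either space.\<close>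
    also have "\<dots> = (\<Oplus>\<^bsub>M\<^esub>j\<in>{..<n}. \<phi> j g \<odot>\<^bsub>?V\<^esub> e j)"
      using GD(3) by (intro module_hom_finsum[OF V M _ s, of "\<lambda>x. x"] module_homI) auto
    finally show ?thesis by simp
  qed
  \<comment> \<open>The matrix coefficients \<open>a \<mapsto> \<phi>\<^sub>j(a g)\<close>.\<close>
  define mc where "mc j g = (\<lambda>a\<in>carrier A. \<phi> j (act a g))" for j g
  have mc: "mc j g \<in> lin_maps K A (scalar_space K)" if "j < n" "g \<in> ?G" for j g
  proof -
    have "(\<lambda>a. act a g) \<in> module_hom K A ?V"
      using that actG XD(6)[OF GD(3)[OF that(2)]] by (intro module_homI) (auto simp: module_hom_def)
    then show ?thesis
      unfolding mc_def restrict_lin_maps_iff[OF A_vs]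
      by (rule module_hom_comp[OF _ \<phi>[OF that(1)]])
  qed
  let ?\<Phi> = "(\<lambda>(i, j). mc i (e j)) ` ({..<n} \<times> {..<n})"
  let ?I = "{a \<in> carrier A. \<forall>\<psi>\<in>?\<Phi>. \<psi> a = \<zero>\<^bsub>K\<^esub>}"
  have \<Phi>: "?\<Phi> \<subseteq> module_hom K A (scalar_space K)" using mc e by (auto intro!: lin_maps_hom)
  have ann: "a \<in> ?I \<longleftrightarrow> a \<in> carrier A \<and> (\<forall>g\<in>?G. act a g = \<zero>\<^bsub>M\<^esub>)" for a
  proof (intro iffI conjI ballI)
    fix g assume "a \<in> ?I" and g: "g \<in> ?G"
    then have a: "a \<in> carrier A" "\<forall>\<psi>\<in>?\<Phi>. \<psi> a = \<zero>\<^bsub>K\<^esub>" by simp_all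
    have ae: "act a (e j) = \<zero>\<^bsub>M\<^esub>" if j: "j < n" for j
    proof -
      have "\<phi> i (act a (e j)) = \<zero>\<^bsub>K\<^esub>" if "i < n" for i
      proof -
        have "mc i (e j) \<in> ?\<Phi>" using that j by (intro image_eqI[of _ _ "(i, j)"]) auto
        then have "mc i (e j) a = \<zero>\<^bsub>K\<^esub>" using a(2) by blast
        then show ?thesis using a(1) by (simp add: mc_def)
      qed
      then have "(\<Oplus>\<^bsub>M\<^esub>i\<in>{..<n}. \<phi> i (act a (e j)) \<odot>\<^bsub>M\<^esub> e i) = (\<Oplus>\<^bsub>M\<^esub>i\<in>{..<n}. \<zero>\<^bsub>M\<^esub>)"
        using e GD(3) by (intro MD.M.finsum_cong') auto
      then show ?thesis using coord[OF actG[OF a(1) e[OF j]]] by simp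
    qed
    have "act a g = (\<Oplus>\<^bsub>M\<^esub>j\<in>{..<n}. act a (\<phi> j g \<odot>\<^bsub>M\<^esub> e j))"
      by (subst coord[OF g], rule module_hom_finsum[OF M M XD(4)[OF a(1)]])
        (use e GD(3) \<phi>c g in auto)
    also have "\<dots> = (\<Oplus>\<^bsub>M\<^esub>j\<in>{..<n}. \<zero>\<^bsub>M\<^esub>)"
      using e GD(3) \<phi>c g ae by (intro MD.M.finsum_cong') (auto simp: module_hom_smult[OF XD(4)[OF a(1)]])
    finally show "act a g = \<zero>\<^bsub>M\<^esub>" by simp
  next
    assume "a \<in> carrier A \<and> (\<forall>g\<in>?G. act a g = \<zero>\<^bsub>M\<^esub>)"
    then have "a \<in> carrier A" "mc i (e j) a = \<zero>\<^bsub>K\<^esub>" if "i < n" "j < n" for i j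
      using that e module_hom_zero[OF V S_vs \<phi>[OF that(1)]] by (simp_all add: mc_def)
    then show "a \<in> ?I" using \<open>a \<in> carrier A \<and> _\<close> by auto
  qed simp
  have "two_sided_ideal K A ?I"
    unfolding two_sided_ideal_def
  proof (intro conjI ballI)
    show "subspace K ?I A" by (rule kernels_subspace[OF A_vs \<Phi>])
    fix a x assume a: "a \<in> carrier A" and x: "x \<in> ?I"
    have x': "x \<in> carrier A" "\<And>g. g \<in> ?G \<Longrightarrow> act x g = \<zero>\<^bsub>M\<^esub>" using x ann by blast+
    show "a \<otimes>\<^bsub>A\<^esub> x \<in> ?I"
      unfolding ann using a x' GD(3) module_hom_zero[OF M M XD(4)[OF a]]
      by (simp add: alg_mult_closed XD(7))
    show "x \<otimes>\<^bsub>A\<^esub> a \<in> ?I"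
      unfolding ann using a x' GD(3) actG by (simp add: alg_mult_closed XD(7))
  qed
  moreover have "finite_codim K A ?I" by (rule finite_codim_kernels[OF A_vs _ \<Phi>]) simp
  ultimately have mcD: "mc j m \<in> carrier D" if "j < n" for j
  proof (rule finite_dualI[OF mc[OF that G(3)]])
    fix a assume "a \<in> ?I"
    then have "a \<in> carrier A" "act a m = \<zero>\<^bsub>M\<^esub>" using ann G(3) by blast+
    then show "mc j m a = \<zero>\<^bsub>K\<^esub>"
      using module_hom_zero[OF V S_vs \<phi>[OF that]] by (simp add: mc_def)
  qed
  let ?t = "\<Oplus>\<^bsub>MD.T\<^esub>j\<in>{..<n}. MD.pure (e j) (mc j m)"
  have p: "(\<lambda>j. MD.pure (e j) (mc j m)) \<in> {..<n} \<rightarrow> carrier MD.T"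
    using e GD(3) mcD by auto
  have "ev M a ?t = act a m" if a: "a \<in> carrier A" for a
  proof -
    have "ev M a ?t = (\<Oplus>\<^bsub>M\<^esub>j\<in>{..<n}. ev M a (MD.pure (e j) (mc j m)))"
      by (rule module_hom_finsum[OF MD.T_vs M ev_hom[OF M a] p])
    also have "\<dots> = (\<Oplus>\<^bsub>M\<^esub>j\<in>{..<n}. \<phi> j (act a m) \<odot>\<^bsub>M\<^esub> e j)"
      using e GD(3) mcD a \<phi>c[OF _ actG[OF a G(3)]]
      by (intro MD.M.finsum_cong') (auto simp: ev_pure[OF M], simp add: mc_def)
    also have "\<dots> = act a m" by (rule coord[OF actG[OF a G(3)], symmetric])
    finally show ?thesis .
  qed
  moreover have "?t \<in> carrier MD.T" by (rule MD.T.finsum_closed[OF p])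
  ultimately show ?thesis by blast
qed

text \<open>
  The tensors with evaluations \<open>a m\<close> are unique, so they depend linearly on \<open>m\<close>; coassociativity
  is then the multiplicativity of the action.
\<close>

lemma locally_finite_comes_from_comodule:
  assumes X: "left_module K A (M, act)" and lf: "locally_finite K A (M, act)"
  shows "\<exists>\<rho>. right_comodule K D (dual_comult K A) (M, \<rho>) \<and> comodule_to_module K A (M, \<rho>) = (M, act)"
proof -
  note XD = left_moduleD[OF X]
  note M = XD(1)
  interpret MD: tensor_product K M D by (rule tensor_product_dual[OF M])
  define r where "r m = (SOME t. t \<in> carrier MD.T \<and> (\<forall>a\<in>carrier A. ev M a t = act a m))" for m
  have r: "r m \<in> carrier MD.T" "\<And>a. a \<in> carrier A \<Longrightarrow> ev M a (r m) = act a m" if "m \<in> carrier M" for m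
    using someI_ex[OF locally_finite_coaction_at[OF X lf that, unfolded Bex_def], folded r_def] by simp_all
  define \<rho> where "\<rho> = restrict r (carrier M)"
  have \<rho>: "\<rho> \<in> lin_maps K M MD.T"
    unfolding \<rho>_def restrict_lin_maps_iff[OF M]
  proof (rule module_homI)
    fix x y assume xy: "x \<in> carrier M" "y \<in> carrier M"
    show "r (x \<oplus>\<^bsub>M\<^esub> y) = r x \<oplus>\<^bsub>MD.T\<^esub> r y"
      by (rule tensor_dual_eqI[OF M])
        (use xy r in \<open>simp_all add: module_hom_add[OF ev_hom[OF M]] module_hom_add[OF XD(4)]\<close>)
  next
    fix c x assume cx: "c \<in> carrier K" "x \<in> carrier M"
    show "r (c \<odot>\<^bsub>M\<^esub> x) = c \<odot>\<^bsub>MD.T\<^esub> r x"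
      by (rule tensor_dual_eqI[OF M])
        (use cx r in \<open>simp_all add: module_hom_smult[OF ev_hom[OF M]] module_hom_smult[OF XD(4)]\<close>)
  qed (rule r(1))
  have "(\<lambda>m\<in>carrier M. ev M a (\<rho> m)) = act a" if a: "a \<in> carrier A" for a
    using lin_maps_extensional[OF XD(3)[OF a]] a r(2)
    by (intro extensionalityI[of _ "carrier M"]) (auto simp: \<rho>_def)
  then have "comodule_to_module K A (M, \<rho>) = (M, act)"
    unfolding comodule_to_module_eq using XD(2)
    by (auto intro!: extensionalityI[of _ "carrier A"])
  then show ?thesis
    using comodule_to_module_left_module[OF M \<rho>] X by auto
qed

section \<open>The isomorphism of categories\<close>

text \<open>
  A coaction is recovered from the action because evaluations separate tensors; the image consists
  of the locally finite modules by the two preceding constructions.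
\<close>

lemma comodule_to_module_bij:
  "bij_betw (comodule_to_module K A) {X. right_comodule K D (dual_comult K A) X}
     {X. left_module K A X \<and> locally_finite K A X}"
proof (rule bij_betw_imageI)
  show "inj_on (comodule_to_module K A) {X. right_comodule K D (dual_comult K A) X}"
  proof (rule inj_onI)
    fix X Y assume "X \<in> {X. right_comodule K D (dual_comult K A) X}" "Y \<in> {X. right_comodule K D (dual_comult K A) X}"
      and eq: "comodule_to_module K A X = comodule_to_module K A Y"
    obtain M \<rho> N \<sigma> where XY: "X = (M, \<rho>)" "Y = (N, \<sigma>)" by fastforce
    then have "right_comodule K D (dual_comult K A) (M, \<rho>)" "right_comodule K D (dual_comult K A) (N, \<sigma>)"
      using \<open>X \<in> _\<close> \<open>Y \<in> _\<close> by auto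
    note R = right_comoduleD[OF this(1)] right_comoduleD[OF this(2)]
    have N: "N = M" using eq by (simp add: XY comodule_to_module_eq)
    have "\<rho> m = \<sigma> m" if m: "m \<in> carrier M" for m
    proof (rule tensor_dual_eqI[OF R(1)])
      show "\<rho> m \<in> carrier (tensor_space K M D)" "\<sigma> m \<in> carrier (tensor_space K M D)"
        using module_hom_mem[OF lin_maps_hom[OF R(2)] m] module_hom_mem[OF lin_maps_hom[OF R(4)]] N m by auto
      fix a assume a: "a \<in> carrier A"
      have "snd (comodule_to_module K A X) a m = snd (comodule_to_module K A Y) a m" using eq by simp
      then show "ev M a (\<rho> m) = ev M a (\<sigma> m)" using a m by (simp add: XY N comodule_to_module_eq)
    qed
    then have "\<rho> = \<sigma>" using R(2,4) N by (intro lin_maps_eqI[of \<rho> K M]) auto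
    then show "X = Y" by (simp add: XY N)
  qed
  show "comodule_to_module K A ` {X. right_comodule K D (dual_comult K A) X} =
      {X. left_module K A X \<and> locally_finite K A X}"
  proof (intro equalityI subsetI)
    fix Y assume "Y \<in> comodule_to_module K A ` {X. right_comodule K D (dual_comult K A) X}"
    then obtain M \<rho> where X: "right_comodule K D (dual_comult K A) (M, \<rho>)" "Y = comodule_to_module K A (M, \<rho>)"
      by auto
    then show "Y \<in> {X. left_module K A X \<and> locally_finite K A X}"
      using comodule_to_module_left_module[OF right_comoduleD[OF X(1)]]
        comodule_to_module_locally_finite[OF X(1)] by simp
  next
    fix Y assume Y: "Y \<in> {X. left_module K A X \<and> locally_finite K A X}"
    obtain M act where MY: "Y = (M, act)" by fastforce
    then obtain \<rho> where "right_comodule K D (dual_comult K A) (M, \<rho>)" "Y = comodule_to_module K A (M, \<rho>)"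
      using locally_finite_comes_from_comodule[of M act] Y by auto
    then show "Y \<in> comodule_to_module K A ` {X. right_comodule K D (dual_comult K A) X}"
      by (intro image_eqI[of _ _ "(M, \<rho>)"]) simp_all
  qed
qed

lemma left_module_category: "is_category (left_module_cat K A)"
proof -
  have id: "id_map (fst X) \<in> module_maps K A X X" if "left_module K A X" for X
  proof -
    obtain M act where X: "X = (M, act)" by fastforce
    then show ?thesis
      using that left_moduleD[of M act] id_map_lin[of K M] by (simp add: module_maps_def)
  qed
  have comp: "compose (carrier (fst X)) g f \<in> module_maps K A X Z"
    if X: "left_module K A X" and f: "f \<in> module_maps K A X Y" and g: "g \<in> module_maps K A Y Z" for X Y Z f g
  proof -
    obtain M act N act' P act'' where XYZ: "X = (M, act)" "Y = (N, act')" "Z = (P, act'')"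
      by (metis surj_pair)
    note XD = left_moduleD[OF X[unfolded XYZ]]
    have f': "f \<in> module_hom K M N" "\<And>a m. a \<in> carrier A \<Longrightarrow> m \<in> carrier M \<Longrightarrow> f (act a m) = act' a (f m)"
      using f by (auto simp: XYZ module_maps_def lin_maps_def)
    have g': "g \<in> module_hom K N P" "\<And>a m. a \<in> carrier A \<Longrightarrow> m \<in> carrier N \<Longrightarrow> g (act' a m) = act'' a (g m)"
      using g by (auto simp: XYZ module_maps_def lin_maps_def)
    have "compose (carrier M) g f \<in> lin_maps K M P"
      unfolding compose_def restrict_lin_maps_iff[OF XD(1)] by (rule module_hom_comp[OF f'(1) g'(1)])
    then show ?thesis
      using f' g' XD(5) module_hom_mem[OF f'(1)] by (simp add: XYZ module_maps_def compose_eq)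
  qed
  have ext: "f \<in> extensional (carrier (fst X))" "f \<in> carrier (fst X) \<rightarrow> carrier (fst Y)"
    if "f \<in> module_maps K A X Y" for X Y f
    using that by (auto simp: module_maps_def lin_maps_def module_hom_def split: prod.splits)
  have idl: "compose (carrier (fst X)) f (id_map (fst X)) = f"
    and idr: "compose (carrier (fst X)) (id_map (fst Y)) f = f" if "f \<in> module_maps K A X Y" for X Y f
    using ext[OF that] compose_Id[of f "carrier (fst X)" "carrier (fst Y)"]
      Id_compose[of f "carrier (fst X)" "carrier (fst Y)"]
    by (simp_all add: id_map_def)
  have assoc: "compose (carrier (fst W)) h (compose (carrier (fst W)) g f)
      = compose (carrier (fst W)) (compose (carrier (fst X)) h g) f"
    if "f \<in> module_maps K A W X" for W X f g h
    by (rule compose_assoc[OF ext(2)[OF that]])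
  show ?thesis
    unfolding is_category_def left_module_cat_def cat.simps
    by (intro conjI ballI; unfold mem_Collect_eq; rule id comp idl idr assoc; assumption)
qed

lemma comodule_maps_eq_module_maps:
  assumes X: "right_comodule K D (dual_comult K A) X" and Y: "right_comodule K D (dual_comult K A) Y"
  shows "comodule_maps K D X Y = module_maps K A (comodule_to_module K A X) (comodule_to_module K A Y)"
proof -
  obtain M \<rho> N \<sigma> where XY: "X = (M, \<rho>)" "Y = (N, \<sigma>)" by fastforce
  note RX = right_comoduleD[OF X[unfolded XY]] and RY = right_comoduleD[OF Y[unfolded XY]]
  have "f \<in> comodule_maps K D X Y \<longleftrightarrow> f \<in> module_maps K A (comodule_to_module K A X) (comodule_to_module K A Y)"
    if f: "f \<in> lin_maps K M N" for f
    unfolding XY comodule_to_module_eq comodule_maps_def module_maps_def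
    using f colinear_iff_linear[OF RX(1) RY(1) RX(2) RY(2) f] module_hom_mem[OF lin_maps_hom[OF f]]
    by auto
  moreover have "comodule_maps K D X Y \<subseteq> lin_maps K M N"
    "module_maps K A (comodule_to_module K A X) (comodule_to_module K A Y) \<subseteq> lin_maps K M N"
    by (auto simp: XY comodule_to_module_eq comodule_maps_def module_maps_def)
  ultimately show ?thesis by blast
qed

lemma counital_iff_unital:
  assumes e: "is_identity A e" and X: "right_comodule K D (dual_comult K A) X"
  shows "counital_comodule K D (dual_counit K A e) X \<longleftrightarrow> unital_module e (comodule_to_module K A X)"
proof -
  obtain M \<rho> where X': "X = (M, \<rho>)" by fastforce
  note R = right_comoduleD[OF X[unfolded X']]
  have e': "e \<in> carrier A" using e by (simp add: is_identity_def)
  show ?thesis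
    using counit_map[OF e' R(1)] module_hom_mem[OF lin_maps_hom[OF R(2)]] e'
    by (simp add: X' counital_comodule_def unital_module_def comodule_to_module_eq)
qed

end

lemma fst_comodule_to_module: "fst (comodule_to_module K A X) = fst X"
  by (simp add: comodule_to_module_def split: prod.split)

theorem proposition3p5:
  fixes K :: "('k, 'r) ring_scheme" and A :: "('k, 'a, 'x) module_scheme"
  assumes "nonunital_algebra K A"
  shows
    "is_category_iso
       (dual_comodule_cat K A :: (('k, 'a \<Rightarrow> 'k, 'm) comod_struct, 'm \<Rightarrow> 'm) cat)
       (locally_finite_module_cat K A)
       (comodule_to_module K A) (\<lambda>X Y f. f)
     \<and>
     (\<forall>e. is_identity A e \<longrightarrow>
        is_category_iso
          (full_subcat (dual_comodule_cat K A :: (('k, 'a \<Rightarrow> 'k, 'm) comod_struct, 'm \<Rightarrow> 'm) cat)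
             (counital_comodule K (finite_dual K A) (dual_counit K A e)))
          (full_subcat (locally_finite_module_cat K A) (unital_module e))
          (comodule_to_module K A) (\<lambda>X Y f. f))"
proof -
  interpret nonunital_algebra K A by fact
  let ?C = "dual_comodule_cat K A :: (('k, 'a \<Rightarrow> 'k, 'm) comod_struct, 'm \<Rightarrow> 'm) cat"
  let ?D = "locally_finite_module_cat K A :: (('k, 'a, 'm) mod_struct, 'm \<Rightarrow> 'm) cat"
  have objC: "Obj ?C = {X. right_comodule K D (dual_comult K A) X}"
    by (simp add: dual_comodule_cat_def right_comodule_cat_def)
  have objD: "Obj ?D = {X. left_module K A X \<and> locally_finite K A X}"
    by (simp add: locally_finite_module_cat_def full_subcat_def left_module_cat_def)
  have catD: "is_category ?D"
    unfolding locally_finite_module_cat_def by (rule is_category_full_subcat[OF left_module_category])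
  have bij: "bij_betw (comodule_to_module K A) (Obj ?C) (Obj ?D)"
    unfolding objC objD by (rule comodule_to_module_bij)
  have arrows: "Hom ?C X Y = Hom ?D (comodule_to_module K A X) (comodule_to_module K A Y)"
    if "X \<in> Obj ?C" "Y \<in> Obj ?C" for X Y
    using comodule_maps_eq_module_maps that
    by (simp add: objC dual_comodule_cat_def right_comodule_cat_def locally_finite_module_cat_def
        full_subcat_def left_module_cat_def)
  have id: "Ident ?C X = Ident ?D (comodule_to_module K A X)"
    and comp: "Comp ?C X Y Z = Comp ?D (comodule_to_module K A X) (comodule_to_module K A Y) (comodule_to_module K A Z)"
    for X Y Z
    by (simp_all add: dual_comodule_cat_def right_comodule_cat_def locally_finite_module_cat_def
        full_subcat_def left_module_cat_def fst_comodule_to_module)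
  show ?thesis
  proof (intro conjI allI impI)
    show "is_category_iso ?C ?D (comodule_to_module K A) (\<lambda>X Y f. f)"
      by (rule is_category_iso_identity_on_arrows[OF catD bij arrows id comp])
  next
    fix e assume e: "is_identity A e"
    let ?P = "counital_comodule K D (dual_counit K A e)"
    have PQ: "?P X \<longleftrightarrow> unital_module e (comodule_to_module K A X)" if "X \<in> Obj ?C" for X
      using counital_iff_unital[OF e] that by (simp add: objC)
    show "is_category_iso (full_subcat ?C ?P) (full_subcat ?D (unital_module e))
        (comodule_to_module K A) (\<lambda>X Y f. f)"
    proof (rule is_category_iso_identity_on_arrows[OF is_category_full_subcat[OF catD]])
      show "bij_betw (comodule_to_module K A) (Obj (full_subcat ?C ?P)) (Obj (full_subcat ?D (unital_module e)))"
        using bij_betw_Collect[OF bij, of "unital_module e" ?P] PQ by (simp add: full_subcat_def)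
    qed (use arrows id comp in \<open>simp_all add: full_subcat_def\<close>)
  qed
qed

end
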